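(* Let $H_{n,m}(z)=\sum_{j=0}^n a_j z^j+\sum_{j=0}^m b_j\overline{z}^{\,j}$ with $0\le m\le n$ be a random harmonic polynomial from the Weyl model, i.e. the $a_j$ ($0\le j\le n$) and $b_j$ ($0\le j\le m$) are all independent, centered complex Gaussian random variables with $\mathbb{E}[a_j\overline{a}_k]=\delta_{jk}\frac{1}{j!}$ and $\mathbb{E}[b_j\overline{b}_k]=\delta_{jk}\frac{1}{j!}$. Let $\mathcal{N}_{n,m}(\mathbb{C})$ denote the number of zeros of $H_{n,m}$ in $\mathbb{C}$. Then, as $n\to\infty$: (i) if $m$ is fixed (independent of $n$), then $\mathbb{E}[\mathcal{N}_{n,m}(\mathbb{C})]\sim n$; (ii) if $m=m(n)$ satisfies $m=\alpha n+O(1)$ for a fixed $\alpha\in(0,1]$, then $\mathbb{E}[\mathcal{N}_{n,m}(\mathbb{C})]\sim\frac{1}{3}m^{3/2}$.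
   Context: A centered complex Gaussian random variable of variance $\sigma^2$ means one of the form $X+iY$ with $X,Y$ independent real Gaussians of mean $0$ and variance $\sigma^2/2$ each (so $\mathbb{E}|X+iY|^2=\sigma^2$). Here $\overline{z}$ is the complex conjugate of $z$, a zero of $H_{n,m}$ is a point $z\in\mathbb{C}$ with $H_{n,m}(z)=0$, $\delta_{jk}$ is the Kronecker delta, and $f(n)\sim g(n)$ means $f(n)/g(n)\to1$ as $n\to\infty$. *)

theory Defs
  imports "HOL-Probability.Probability" "HOL-Library.Landau_Symbols"
begin

definition harmonic_poly ::
    "nat \<Rightarrow> nat \<Rightarrow> (nat \<Rightarrow> complex) \<Rightarrow> (nat \<Rightarrow> complex) \<Rightarrow> complex \<Rightarrow> complex" where
  "harmonic_poly n m a b z = (\<Sum>j\<le>n. a j * z ^ j) + (\<Sum>j\<le>m. b j * cnj z ^ j)"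

text \<open>Zeros are counted without multiplicity. The counting measure gives an infinite zero set
  the value \<open>\<infinity>\<close>, whereas \<^const>\<open>card\<close> would give it \<open>0\<close>.\<close>

definition num_zeros :: "nat \<Rightarrow> nat \<Rightarrow> (nat \<Rightarrow> complex) \<Rightarrow> (nat \<Rightarrow> complex) \<Rightarrow> ennreal" where
  "num_zeros n m a b = emeasure (count_space UNIV) {z. harmonic_poly n m a b z = 0}"

definition expected_zeros ::
    "'w measure \<Rightarrow> nat \<Rightarrow> nat \<Rightarrow> (nat \<Rightarrow> 'w \<Rightarrow> complex) \<Rightarrow> (nat \<Rightarrow> 'w \<Rightarrow> complex) \<Rightarrow> ennreal" where
  "expected_zeros M n m a b = (\<integral>\<^sup>+ w. num_zeros n m (\<lambda>j. a j w) (\<lambda>j. b j w) \<partial>M)"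

text \<open>The parameter \<open>v\<close> is the variance of \<open>X\<close>. The second parameter of
  \<^const>\<open>normal_density\<close> is a standard deviation, and the real and imaginary parts
  each have variance \<open>v / 2\<close>.\<close>

definition centered_complex_gaussian :: "'w measure \<Rightarrow> real \<Rightarrow> ('w \<Rightarrow> complex) \<Rightarrow> bool" where
  "centered_complex_gaussian M v X \<longleftrightarrow>
     distributed M lborel (\<lambda>w. Re (X w)) (normal_density 0 (sqrt (v / 2))) \<and>
     distributed M lborel (\<lambda>w. Im (X w)) (normal_density 0 (sqrt (v / 2))) \<and>
     prob_space.indep_var M borel (\<lambda>w. Re (X w)) borel (\<lambda>w. Im (X w))"

text \<open>The disjoint sum as index set makes the combined family
  \<open>a 0, \<dots>, a n, b 0, \<dots>, b m\<close> jointly independent.\<close>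

definition weyl_model ::
    "'w measure \<Rightarrow> nat \<Rightarrow> nat \<Rightarrow> (nat \<Rightarrow> 'w \<Rightarrow> complex) \<Rightarrow> (nat \<Rightarrow> 'w \<Rightarrow> complex) \<Rightarrow> bool" where
  "weyl_model M n m a b \<longleftrightarrow>
     prob_space M \<and>
     (\<forall>j\<le>n. centered_complex_gaussian M (1 / fact j) (a j)) \<and>
     (\<forall>j\<le>m. centered_complex_gaussian M (1 / fact j) (b j)) \<and>
     prob_space.indep_vars M (\<lambda>_. borel) (case_sum a b) ({..n} <+> {..m})"

end

(* Write H = p(z) + q(conj z).  Given all coefficients except a_0, the zeros of H are the solutions
   of G(z) = -a_0 with G = H - a_0.  Since a_0 has the density exp(-|c|^2) / pi, the area formula
   for the plane map G turns the conditional expectation of the number of zeros into the integral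
   of |J_G(z)| exp(-|G(z)|^2) / pi over z; no Kac-Rice formula is needed.  For fixed z, Givens
   rotations reduce the Gaussian vector (p', q', G) at z to three independent Gaussians, and a
   hyperbolic rotation evaluates the expectation of the integrand.  With x = |z|^2 the result is a
   density on [0, oo) that lies between sqrt D / (x S) and (d + sqrt D) / (x S), where
   d / (x S) >= 0 is the derivative of a function increasing from 0 to n (or vanishing, if m = n).
   For fixed m this gives n <= E N <= n + O(1).  For m comparable to n, the substitution x = m t in
   the integral of sqrt D / (x S) and dominated convergence give the limit density sqrt t / 2 on
   0 < t < 1 and 0 for t > 1, hence E N ~ m^(3/2) / 3. *)

theory Submission
  imports Defs "HOL-Real_Asymp.Real_Asymp"
begin

section \<open>Lebesgue measure on the complex plane\<close>

text \<open>The obstacle is the absolute value of the Jacobian. Without it the conditional mean is a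
  difference of variances, \<open>drift\<close>, and its integral counts zeros with the sign of the
  Jacobian. With it the mean is explicit (\<open>signed_mean\<close>) but unwieldy to integrate, so
  each regime uses bounds: for fixed \<open>m\<close> the signed count wins, for \<open>m\<close>
  comparable to \<open>n\<close> it is of lower order than the term with \<open>sqrt D\<close>. The
  limit density comes from Poisson weights. For \<open>t < 1\<close> and \<open>x = m * t\<close>
  neither truncation is felt, and mean and variance \<open>x\<close> of the full Poisson law give
  \<open>sqrt x / 2\<close>. For \<open>t > 1\<close> the weights truncated at \<open>m\<close> pile
  up next to \<open>m\<close>, and the density stays bounded, but for two different reasons. If
  \<open>n - m\<close> is bounded, the weights truncated at \<open>n\<close> pile up there as well.
  If \<open>n - m\<close> grows linearly, the total weight up to \<open>m\<close> is smaller than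
  that up to \<open>n\<close> by a factor of order \<open>1 / m\<close>. Hence the separate
  treatment of \<open>\<alpha> = 1\<close> and \<open>\<alpha> < 1\<close> in
  \<open>theorem1\<close>.\<close>

lemma distr_lborel_Complex:
  "distr (lborel \<Otimes>\<^sub>M lborel) borel (\<lambda>(x, y). Complex x y) = (lborel :: complex measure)"
proof (rule lborel_eqI[symmetric])
  have [measurable]: "(\<lambda>(x, y). Complex x y) \<in> borel_measurable borel"
    by (auto intro!: borel_measurable_continuous_onI continuous_intros
        simp: case_prod_beta Complex_eq)
  have meas: "(\<lambda>(x, y). Complex x y) \<in> borel_measurable (lborel \<Otimes>\<^sub>M lborel)"
    by (simp add: lborel_prod)
  fix l u :: complex
  assume lu: "\<And>b. b \<in> Basis \<Longrightarrow> l \<bullet> b \<le> u \<bullet> b"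
  have le: "Re l \<le> Re u" "Im l \<le> Im u"
    using lu[of 1] lu[of \<i>] by (auto simp: Basis_complex_def)
  have "(\<lambda>(x, y). Complex x y) -` box l u \<inter> space (lborel \<Otimes>\<^sub>M lborel)
      = {Re l<..<Re u} \<times> {Im l<..<Im u}"
    by (auto simp: box_def Basis_complex_def space_pair_measure)
  then have "emeasure (distr (lborel \<Otimes>\<^sub>M lborel) borel (\<lambda>(x, y). Complex x y)) (box l u)
      = emeasure (lborel \<Otimes>\<^sub>M lborel) ({Re l<..<Re u} \<times> {Im l<..<Im u})"
    using meas by (subst emeasure_distr) auto
  also have "\<dots> = ennreal (Re u - Re l) * ennreal (Im u - Im l)"
    using le by (subst lborel.emeasure_pair_measure_Times) auto
  also have "\<dots> = ennreal (\<Prod>b\<in>Basis. (u - l) \<bullet> b)"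
    using le by (simp add: Basis_complex_def ennreal_mult)
  finally show "emeasure (distr (lborel \<Otimes>\<^sub>M lborel) borel (\<lambda>(x, y). Complex x y)) (box l u)
      = ennreal (\<Prod>b\<in>Basis. (u - l) \<bullet> b)" .
qed simp

lemma nn_integral_lborel_Complex:
  assumes "f \<in> borel_measurable (borel :: complex measure)"
  shows "(\<integral>\<^sup>+z. f z \<partial>lborel) = (\<integral>\<^sup>+x. \<integral>\<^sup>+y. f (Complex x y) \<partial>lborel \<partial>lborel)"
proof -
  have [measurable]: "(\<lambda>(x, y). Complex x y) \<in> borel_measurable (lborel \<Otimes>\<^sub>M lborel)"
    unfolding lborel_prod
    by (auto intro!: borel_measurable_continuous_onI continuous_intros
        simp: case_prod_beta Complex_eq)
  note [measurable] = assms
  have "(\<integral>\<^sup>+z. f z \<partial>lborel) = (\<integral>\<^sup>+z. f z \<partial>distr (lborel \<Otimes>\<^sub>M lborel) borel (\<lambda>(x, y). Complex x y))"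
    by (simp add: distr_lborel_Complex)
  also have "\<dots> = (\<integral>\<^sup>+p. f (case p of (x, y) \<Rightarrow> Complex x y) \<partial>(lborel \<Otimes>\<^sub>M lborel))"
    by (subst nn_integral_distr) auto
  also have "\<dots> = (\<integral>\<^sup>+x. \<integral>\<^sup>+y. f (Complex x y) \<partial>lborel \<partial>lborel)"
    by (subst lborel.nn_integral_fst[symmetric]) auto
  finally show ?thesis .
qed

lemma nn_integral_lborel_translate:
  fixes t :: complex
  assumes [measurable]: "f \<in> borel_measurable borel"
  shows "(\<integral>\<^sup>+z. f (z + t) \<partial>lborel) = (\<integral>\<^sup>+z. f z \<partial>lborel)"
proof -
  have "(\<integral>\<^sup>+z. f z \<partial>lborel) = (\<integral>\<^sup>+z. f z \<partial>distr lborel borel ((+) t))"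
    by (simp add: lborel_distr_plus)
  also have "\<dots> = (\<integral>\<^sup>+z. f (z + t) \<partial>lborel)"
    by (subst nn_integral_distr) (auto simp: add.commute)
  finally show ?thesis ..
qed

lemma nn_integral_lborel_scale:
  fixes c :: real
  assumes c: "c \<noteq> 0" and [measurable]: "f \<in> borel_measurable (borel :: complex measure)"
  shows "(\<integral>\<^sup>+z. f z \<partial>lborel) = ennreal (c\<^sup>2) * (\<integral>\<^sup>+z. f (c *\<^sub>R z) \<partial>lborel)"
proof -
  have "(\<integral>\<^sup>+z. f z \<partial>lborel)
      = (\<integral>\<^sup>+z. f z \<partial>density (distr lborel borel (\<lambda>x. 0 + c *\<^sub>R x)) (\<lambda>_. ennreal (\<bar>c\<bar> ^ DIM(complex))))"
    using lborel_affine[OF c, of "0::complex"] by simp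
  also have "\<dots> = (\<integral>\<^sup>+z. ennreal (c\<^sup>2) * f (c *\<^sub>R z) \<partial>lborel)"
    by (subst nn_integral_density) (auto simp: nn_integral_distr)
  also have "\<dots> = ennreal (c\<^sup>2) * (\<integral>\<^sup>+z. f (c *\<^sub>R z) \<partial>lborel)"
    by (subst nn_integral_cmult) auto
  finally show ?thesis .
qed

text \<open>For a fixed value of the other variable a shear is a translation, so translation
  invariance suffices, with Fubini for the first shear. No determinant of a real four-by-four matrix
  is involved.\<close>

lemma nn_integral_shear:
  fixes t :: complex
  assumes h [measurable]: "(\<lambda>(x, y). h x y) \<in> borel_measurable (borel \<Otimes>\<^sub>M borel)"
  shows "(\<integral>\<^sup>+x. \<integral>\<^sup>+y. h (x + t * y) y \<partial>lborel \<partial>lborel) = (\<integral>\<^sup>+x. \<integral>\<^sup>+y. h x y \<partial>lborel \<partial>lborel)"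
    and "(\<integral>\<^sup>+x. \<integral>\<^sup>+y. h x (y + t * x) \<partial>lborel \<partial>lborel) = (\<integral>\<^sup>+x. \<integral>\<^sup>+y. h x y \<partial>lborel \<partial>lborel)"
proof -
  have "(\<integral>\<^sup>+x. \<integral>\<^sup>+y. h (x + t * y) y \<partial>lborel \<partial>lborel) = (\<integral>\<^sup>+y. \<integral>\<^sup>+x. h (x + t * y) y \<partial>lborel \<partial>lborel)"
    by (rule lborel_pair.Fubini') measurable
  also have "\<dots> = (\<integral>\<^sup>+y. \<integral>\<^sup>+x. h x y \<partial>lborel \<partial>lborel)"
    by (intro nn_integral_cong nn_integral_lborel_translate[where f="\<lambda>x. h x _"]) measurable
  also have "\<dots> = (\<integral>\<^sup>+x. \<integral>\<^sup>+y. h x y \<partial>lborel \<partial>lborel)"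
    by (rule lborel_pair.Fubini') measurable
  finally show "(\<integral>\<^sup>+x. \<integral>\<^sup>+y. h (x + t * y) y \<partial>lborel \<partial>lborel) = (\<integral>\<^sup>+x. \<integral>\<^sup>+y. h x y \<partial>lborel \<partial>lborel)" .
  show "(\<integral>\<^sup>+x. \<integral>\<^sup>+y. h x (y + t * x) \<partial>lborel \<partial>lborel) = (\<integral>\<^sup>+x. \<integral>\<^sup>+y. h x y \<partial>lborel \<partial>lborel)"
    by (intro nn_integral_cong nn_integral_lborel_translate[where f="\<lambda>y. h _ y"]) measurable
qed

text \<open>A matrix in \<open>SL\<^sub>2(\<complex>)\<close> with nonzero lower left entry is a product of three shears.\<close>

lemma nn_integral_SL2:
  fixes a b c d :: complex
  assumes h [measurable]: "(\<lambda>(x, y). h x y) \<in> borel_measurable (borel \<Otimes>\<^sub>M borel)"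
    and det: "a * d - b * c = 1" and c: "c \<noteq> 0"
  shows "(\<integral>\<^sup>+x. \<integral>\<^sup>+y. h (a * x + b * y) (c * x + d * y) \<partial>lborel \<partial>lborel)
    = (\<integral>\<^sup>+x. \<integral>\<^sup>+y. h x y \<partial>lborel \<partial>lborel)"
proof -
  \<comment> \<open>Read off the diagonal: the upper shear by \<open>p\<close>, the lower shear by
    \<open>c\<close> and the upper shear by \<open>q\<close> multiply to a matrix with diagonal
    entries \<open>1 + p * c\<close> and \<open>1 + q * c\<close>. The determinant then forces
    \<open>b\<close>.\<close>
  define p q where "p = (a - 1) / c" and "q = (d - 1) / c"
  have a: "a = 1 + p * c" and d: "d = 1 + q * c" using c by (auto simp: p_def q_def)
  have b: "b = p + q + p * q * c"
  proof -
    have "b * c = a * d - 1" using det by (simp add: algebra_simps)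
    also have "\<dots> = (p + q + p * q * c) * c" by (simp add: a d algebra_simps)
    finally show ?thesis using c by simp
  qed
  define h1 where "h1 = (\<lambda>x y. h (x + p * y) y)"
  define h2 where "h2 = (\<lambda>x y. h1 x (y + c * x))"
  have m1 [measurable]: "(\<lambda>(x, y). h1 x y) \<in> borel_measurable (borel \<Otimes>\<^sub>M borel)"
    unfolding h1_def by measurable
  have m2 [measurable]: "(\<lambda>(x, y). h2 x y) \<in> borel_measurable (borel \<Otimes>\<^sub>M borel)"
    unfolding h2_def by measurable
  have "h (a * x + b * y) (c * x + d * y) = h2 (x + q * y) y" for x y
    by (simp add: h2_def h1_def a b d algebra_simps)
  then have "(\<integral>\<^sup>+x. \<integral>\<^sup>+y. h (a * x + b * y) (c * x + d * y) \<partial>lborel \<partial>lborel)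
      = (\<integral>\<^sup>+x. \<integral>\<^sup>+y. h2 (x + q * y) y \<partial>lborel \<partial>lborel)" by simp
  also have "\<dots> = (\<integral>\<^sup>+x. \<integral>\<^sup>+y. h2 x y \<partial>lborel \<partial>lborel)" by (rule nn_integral_shear(1)[OF m2])
  also have "\<dots> = (\<integral>\<^sup>+x. \<integral>\<^sup>+y. h1 x y \<partial>lborel \<partial>lborel)"
    unfolding h2_def by (rule nn_integral_shear(2)[OF m1])
  also have "\<dots> = (\<integral>\<^sup>+x. \<integral>\<^sup>+y. h x y \<partial>lborel \<partial>lborel)"
    unfolding h1_def by (rule nn_integral_shear(1)[OF h])
  finally show ?thesis .
qed

text \<open>The squared modulus is the convenient radial variable: the disc of squared radius
  \<open>a\<close> has area \<open>pi * a\<close>, so the image measure has a constant density.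
  Half-lines generate the Borel sets and are stable under intersection.\<close>

lemma nn_integral_lborel_radial:
  assumes f [measurable]: "f \<in> borel_measurable borel"
  shows "(\<integral>\<^sup>+z. f ((cmod z)\<^sup>2) \<partial>lborel) = ennreal pi * (\<integral>\<^sup>+x\<in>{0..}. f x \<partial>lborel)"
proof -
  have sb: "sets (borel :: real measure) = sigma_sets UNIV (range (\<lambda>a. {..<a}))"
    by (subst borel_Iio) simp
  have eq: "distr lborel borel (\<lambda>z. (cmod z)\<^sup>2) = density lborel (\<lambda>x. ennreal pi * indicator {0..} x)"
    (is "?A = ?B")
  proof (rule measure_eqI_generator_eq[where E="range (\<lambda>a. {..<a})" and \<Omega>=UNIV
          and A="\<lambda>i. {..<real i}"])
    show "Int_stable (range (\<lambda>a::real. {..<a}))"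
    proof (clarsimp simp: Int_stable_def)
      fix a b :: real
      have "{..<a} \<inter> {..<b} = {..<min a b}" by auto
      then show "{..<a} \<inter> {..<b} \<in> range lessThan" by blast
    qed
    show "emeasure ?A X = emeasure ?B X" if "X \<in> range (\<lambda>a. {..<a})" for X
    proof -
      from that obtain a where X: "X = {..<a}" by auto
      have "emeasure ?A X = emeasure lborel {z :: complex. (cmod z)\<^sup>2 < a}"
        unfolding X by (subst emeasure_distr) (auto simp: vimage_def)
      also have "\<dots> = ennreal (pi * max 0 a)"
      proof (cases "a \<le> 0")
        case True
        then have "{z :: complex. (cmod z)\<^sup>2 < a} = {}"
          by (auto simp: not_less intro: order_trans[of a 0])
        then show ?thesis using True by simp
      next
        case False
        then have "{z :: complex. (cmod z)\<^sup>2 < a} = ball 0 (sqrt a)"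
          by (auto simp: real_less_rsqrt)
             (metis abs_of_nonneg norm_ge_zero real_sqrt_abs real_sqrt_less_iff)+
        also have "emeasure lborel (ball (0::complex) (sqrt a)) = ennreal (pi * a)"
          using False by (subst emeasure_ball) (auto simp: unit_ball_vol_2)
        finally show ?thesis using False by simp
      qed
      also have "\<dots> = (\<integral>\<^sup>+x. ennreal pi * indicator {0..<max 0 a} x \<partial>lborel)"
        by (subst nn_integral_cmult_indicator) (auto simp: ennreal_mult)
      also have "\<dots> = emeasure ?B X"
        unfolding X by (subst emeasure_density) (auto intro!: nn_integral_cong split: split_indicator)
      finally show ?thesis .
    qed
    show "sets ?A = sigma_sets UNIV (range (\<lambda>a. {..<a}))"
      by (simp add: sb)
    show "sets ?B = sigma_sets UNIV (range (\<lambda>a. {..<a}))"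
      by (simp add: sb)
    show "(\<Union>i. {..<real i}) = UNIV" by (auto intro: reals_Archimedean2)
    show "emeasure ?A {..<real i} \<noteq> \<infinity>" for i
    proof -
      have "emeasure ?A {..<real i} = emeasure lborel {z :: complex. (cmod z)\<^sup>2 < real i}"
        by (subst emeasure_distr) (auto simp: vimage_def)
      also have "\<dots> \<le> emeasure lborel (ball (0::complex) (sqrt (real i)))"
        by (intro emeasure_mono) (auto simp: real_less_rsqrt)
      also have "\<dots> < \<infinity>" by (rule emeasure_lborel_ball_finite)
      finally show ?thesis by simp
    qed
  qed auto
  have "(\<integral>\<^sup>+z. f ((cmod z)\<^sup>2) \<partial>lborel) = (\<integral>\<^sup>+x. f x \<partial>?A)"
    by (subst nn_integral_distr) auto
  also have "\<dots> = (\<integral>\<^sup>+x. ennreal pi * (f x * indicator {0..} x) \<partial>lborel)"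
    unfolding eq by (subst nn_integral_density) (auto simp: mult_ac)
  also have "\<dots> = ennreal pi * (\<integral>\<^sup>+x\<in>{0..}. f x \<partial>lborel)"
    by (subst nn_integral_cmult) auto
  finally show ?thesis .
qed

section \<open>Complex Gaussian vectors\<close>

lemma nn_integral_exp_neg:
  assumes k: "0 < (k :: real)"
  shows "(\<integral>\<^sup>+x\<in>{0..}. ennreal (exp (- k * x)) \<partial>lborel) = ennreal (1 / k)"
proof -
  have "((\<lambda>x. exp (- (k * x))) \<longlongrightarrow> 0) at_top"
    using k by real_asymp
  then have "((\<lambda>x. - exp (- k * x) / k) \<longlongrightarrow> - 0 / k) at_top"
    using k by (intro tendsto_intros) auto
  then have "(\<integral>\<^sup>+x\<in>{0..}. ennreal (exp (- k * x)) \<partial>lborel) = ennreal (- 0 / k - (- exp (- k * 0) / k))"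
    using k by (intro nn_integral_FTC_atLeast) (auto intro!: derivative_eq_intros)
  then show ?thesis by simp
qed

text \<open>The mean of the squared modulus is 1, so real and imaginary part have variance 1/2 each;
  this is the law of \<open>a 0\<close>.\<close>

definition gauss :: "complex measure" where
  "gauss = density lborel (\<lambda>z. ennreal (exp (- (cmod z)\<^sup>2) / pi))"

lemma space_gauss [simp]: "space gauss = UNIV"
  by (simp add: gauss_def)

lemma sets_gauss [simp, measurable_cong]: "sets gauss = sets borel"
  by (simp add: gauss_def)

lemma nn_integral_gauss:
  assumes [measurable]: "f \<in> borel_measurable borel"
  shows "(\<integral>\<^sup>+z. f z \<partial>gauss) = (\<integral>\<^sup>+z. ennreal (exp (- (cmod z)\<^sup>2) / pi) * f z \<partial>lborel)"
  unfolding gauss_def by (subst nn_integral_density) auto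

lemma nn_integral_lborel_exp_cmod:
  assumes k: "0 < k"
  shows "(\<integral>\<^sup>+z. ennreal (exp (- k * (cmod z)\<^sup>2)) \<partial>lborel) = ennreal (pi / k)"
  using k by (subst nn_integral_lborel_radial[where f = "\<lambda>x. ennreal (exp (- k * x))"], measurable)
    (simp only: nn_integral_exp_neg, simp add: ennreal_mult[symmetric])

interpretation gauss: prob_space gauss
proof
  have "(\<integral>\<^sup>+z. 1 \<partial>gauss) = (\<integral>\<^sup>+z. ennreal (1 / pi) * ennreal (exp (- 1 * (cmod z)\<^sup>2)) \<partial>lborel)"
    by (subst nn_integral_gauss) (auto simp: ennreal_mult[symmetric] intro!: nn_integral_cong)
  also have "\<dots> = 1"
    by (subst nn_integral_cmult, measurable)
       (simp only: nn_integral_lborel_exp_cmod zero_less_one, simp add: ennreal_mult[symmetric])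
  finally show "emeasure gauss (space gauss) = 1" by simp
qed

interpretation gauss_pair: pair_sigma_finite gauss gauss ..

lemma nn_integral_gauss2:
  assumes [measurable]: "(\<lambda>(x, y). h x y) \<in> borel_measurable (borel \<Otimes>\<^sub>M borel)"
  shows "(\<integral>\<^sup>+x. \<integral>\<^sup>+y. h x y \<partial>gauss \<partial>gauss)
    = (\<integral>\<^sup>+x. \<integral>\<^sup>+y. ennreal (exp (- ((cmod x)\<^sup>2 + (cmod y)\<^sup>2)) / pi\<^sup>2) * h x y \<partial>lborel \<partial>lborel)"
proof -
  have "(\<integral>\<^sup>+x. \<integral>\<^sup>+y. h x y \<partial>gauss \<partial>gauss) = (\<integral>\<^sup>+x. ennreal (exp (- (cmod x)\<^sup>2) / pi) *
      (\<integral>\<^sup>+y. ennreal (exp (- (cmod y)\<^sup>2) / pi) * h x y \<partial>lborel) \<partial>lborel)"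
    by (simp add: nn_integral_gauss)
  also have "\<dots> = (\<integral>\<^sup>+x. \<integral>\<^sup>+y. ennreal (exp (- ((cmod x)\<^sup>2 + (cmod y)\<^sup>2)) / pi\<^sup>2) * h x y \<partial>lborel \<partial>lborel)"
    by (subst nn_integral_cmult[symmetric])
       (auto intro!: nn_integral_cong simp: mult.assoc[symmetric] ennreal_mult[symmetric]
         power2_eq_square exp_add[symmetric] add.commute)
  finally show ?thesis .
qed

lemma cmod_rotate:
  fixes x y \<beta> :: complex and \<alpha> :: real
  shows "(cmod (\<alpha> * x - \<beta> * y))\<^sup>2 + (cmod (cnj \<beta> * x + \<alpha> * y))\<^sup>2
    = (\<alpha>\<^sup>2 + (cmod \<beta>)\<^sup>2) * ((cmod x)\<^sup>2 + (cmod y)\<^sup>2)"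
  unfolding cmod_power2 by simp algebra

text \<open>The matrix is unitary of determinant one: by \<open>cmod_rotate\<close> it preserves the
  Gaussian density, by \<open>nn_integral_SL2\<close> Lebesgue measure.\<close>

lemma nn_integral_gauss_rotate:
  fixes \<beta> :: complex and \<alpha> :: real
  assumes h [measurable]: "(\<lambda>(x, y). h x y) \<in> borel_measurable (borel \<Otimes>\<^sub>M borel)"
    and \<alpha>: "0 \<le> \<alpha>" and unit: "\<alpha>\<^sup>2 + (cmod \<beta>)\<^sup>2 = 1"
  shows "(\<integral>\<^sup>+x. \<integral>\<^sup>+y. h (\<alpha> * x - \<beta> * y) (cnj \<beta> * x + \<alpha> * y) \<partial>gauss \<partial>gauss)
    = (\<integral>\<^sup>+x. \<integral>\<^sup>+y. h x y \<partial>gauss \<partial>gauss)"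
\<comment> \<open>\<open>nn_integral_SL2\<close> divides by the lower left entry
  \<open>cnj \<beta>\<close>. If that entry is 0, the sign condition on \<open>\<alpha>\<close>
  leaves only the identity.\<close>
proof (cases "\<beta> = 0")
  case True
  then have "\<alpha> = 1" using \<alpha> unit by (simp add: power2_eq_1_iff)
  then show ?thesis using True by simp
next
  case False
  define k where "k = (\<lambda>x y. ennreal (exp (- ((cmod x)\<^sup>2 + (cmod y)\<^sup>2)) / pi\<^sup>2) * h x y)"
  have m [measurable]: "(\<lambda>(x, y). k x y) \<in> borel_measurable (borel \<Otimes>\<^sub>M borel)"
    unfolding k_def by measurable
  have "(\<integral>\<^sup>+x. \<integral>\<^sup>+y. h (\<alpha> * x - \<beta> * y) (cnj \<beta> * x + \<alpha> * y) \<partial>gauss \<partial>gauss)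
     = (\<integral>\<^sup>+(x :: complex). \<integral>\<^sup>+(y :: complex). k (\<alpha> * x + (- \<beta>) * y) (cnj \<beta> * x + \<alpha> * y) \<partial>lborel \<partial>lborel)"
    by (subst nn_integral_gauss2, measurable)
       (simp only: k_def add_uminus_conv_diff mult_minus_left cmod_rotate unit mult_1)
  also have "\<dots> = (\<integral>\<^sup>+x. \<integral>\<^sup>+y. k x y \<partial>lborel \<partial>lborel)"
  proof (rule nn_integral_SL2[OF m])
    have "of_real \<alpha> * of_real \<alpha> - (- \<beta>) * cnj \<beta> = (of_real (\<alpha>\<^sup>2 + (cmod \<beta>)\<^sup>2) :: complex)"
      by (simp add: complex_norm_square[symmetric] power2_eq_square)
    then show "of_real \<alpha> * of_real \<alpha> - (- \<beta>) * cnj \<beta> = (1 :: complex)" by (simp only: unit of_real_1)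
  qed (use False in auto)
  also have "\<dots> = (\<integral>\<^sup>+x. \<integral>\<^sup>+y. h x y \<partial>gauss \<partial>gauss)"
    by (subst nn_integral_gauss2) (simp_all add: k_def)
  finally show ?thesis .
qed

text \<open>The rotation takes the row \<open>(r, U)\<close> to \<open>(R, 0)\<close>. For
  \<open>R = 0\<close> every rotation would do that; the choice \<open>\<beta> = 0\<close> lets
  \<open>gauss_absorb\<close> preserve the implication from \<open>r = 0\<close> to
  \<open>t = 0\<close>.\<close>

lemma givens:
  fixes r :: real and U :: complex
  assumes r: "0 \<le> r"
  defines "R \<equiv> sqrt (r\<^sup>2 + (cmod U)\<^sup>2)"
  obtains \<alpha> :: real and \<beta> :: complex where "0 \<le> \<alpha>" "\<alpha>\<^sup>2 + (cmod \<beta>)\<^sup>2 = 1" "R * \<alpha> = r" "R * \<beta> = U" "R = 0 \<longrightarrow> \<beta> = 0"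
proof (cases "R = 0")
  case True
  then have "r\<^sup>2 + (cmod U)\<^sup>2 = 0" by (simp add: R_def)
  then have "r = 0" "U = 0" by (auto simp: add_nonneg_eq_0_iff)
  then show ?thesis using True that[of 1 0] by simp
next
  case False
  have R2: "R\<^sup>2 = r\<^sup>2 + (cmod U)\<^sup>2" by (simp add: R_def)
  have "0 \<le> r / R" using r by (simp add: R_def)
  moreover have "(r / R)\<^sup>2 + (cmod (U / R))\<^sup>2 = 1"
    using False by (simp add: norm_divide power_divide add_divide_distrib[symmetric] R2[symmetric])
  ultimately show ?thesis using False that[of "r / R" "U / R"] by simp
qed

text \<open>Variances of independent summands add: after the \<open>givens\<close> rotation the sum
  depends on \<open>w\<close> alone, and \<open>\<eta>\<close> integrates to one.\<close>

lemma gauss_merge: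
  fixes s :: real and P a :: complex
  assumes F [measurable]: "F \<in> borel_measurable borel" and s: "0 \<le> s"
  shows "(\<integral>\<^sup>+w. \<integral>\<^sup>+\<eta>. F (a + s * w + P * \<eta>) \<partial>gauss \<partial>gauss)
    = (\<integral>\<^sup>+w. F (a + sqrt (s\<^sup>2 + (cmod P)\<^sup>2) * w) \<partial>gauss)"
proof -
  define R where "R = sqrt (s\<^sup>2 + (cmod P)\<^sup>2)"
  obtain \<alpha> :: real and \<beta> :: complex where g: "0 \<le> \<alpha>" "\<alpha>\<^sup>2 + (cmod \<beta>)\<^sup>2 = 1" "R * \<alpha> = s" "R * \<beta> = P"
    using givens[OF s, of P] unfolding R_def by metis
  have one: "of_real (\<alpha>\<^sup>2) + \<beta> * cnj \<beta> = 1"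
    using g(2) by (metis complex_norm_square of_real_1 of_real_add)
  have eq: "of_real s * (\<alpha> * w - \<beta> * \<eta>) + P * (cnj \<beta> * w + \<alpha> * \<eta>) = R * w" for w \<eta> :: complex
  proof -
    have "of_real s * (\<alpha> * w - \<beta> * \<eta>) + P * (cnj \<beta> * w + \<alpha> * \<eta>)
      = R * (of_real (\<alpha>\<^sup>2) + \<beta> * cnj \<beta>) * w"
      unfolding g(3,4)[symmetric] by (simp add: algebra_simps power2_eq_square)
    then show ?thesis by (simp only: one mult_1_right)
  qed
  have "(\<integral>\<^sup>+w. \<integral>\<^sup>+\<eta>. F (a + s * w + P * \<eta>) \<partial>gauss \<partial>gauss)
     = (\<integral>\<^sup>+w. \<integral>\<^sup>+\<eta>. F (a + s * (\<alpha> * w - \<beta> * \<eta>) + P * (cnj \<beta> * w + \<alpha> * \<eta>)) \<partial>gauss \<partial>gauss)"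
    by (rule nn_integral_gauss_rotate[symmetric, OF _ g(1,2)]) measurable
  also have "\<dots> = (\<integral>\<^sup>+w. \<integral>\<^sup>+\<eta>. F (a + R * w) \<partial>gauss \<partial>gauss)"
    by (simp only: add.assoc eq)
  also have "\<dots> = (\<integral>\<^sup>+w. F (a + R * w) \<partial>gauss)"
    by (simp add: gauss.emeasure_space_1[simplified])
  finally show ?thesis by (simp add: R_def)
qed

text \<open>One more Gaussian summand \<open>\<eta> (U, P)\<close> is absorbed into a vector in echelon form
  by two rotations.\<close>

lemma gauss_absorb:
  fixes r s :: real and t U P :: complex
  assumes r: "0 \<le> r" and s: "0 \<le> s" and rt: "r = 0 \<longrightarrow> t = 0"
  obtains r' s' t' where "0 \<le> r'" "0 \<le> s'" "r'\<^sup>2 = r\<^sup>2 + (cmod U)\<^sup>2" "r' * t' = r * t + cnj U * P"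
    "(cmod t')\<^sup>2 + s'\<^sup>2 = (cmod t)\<^sup>2 + s\<^sup>2 + (cmod P)\<^sup>2" "r' = 0 \<longrightarrow> t' = 0"
    "\<forall>F \<in> borel_measurable (borel \<Otimes>\<^sub>M borel).
      (\<integral>\<^sup>+x. \<integral>\<^sup>+w. \<integral>\<^sup>+\<eta>. F (r * x + U * \<eta>, t * x + s * w + P * \<eta>) \<partial>gauss \<partial>gauss \<partial>gauss)
      = (\<integral>\<^sup>+x. \<integral>\<^sup>+w. F (r' * x, t' * x + s' * w) \<partial>gauss \<partial>gauss)"
proof -
  define R where "R = sqrt (r\<^sup>2 + (cmod U)\<^sup>2)"
  obtain \<alpha> :: real and \<beta> :: complex where g: "0 \<le> \<alpha>" "\<alpha>\<^sup>2 + (cmod \<beta>)\<^sup>2 = 1" "R * \<alpha> = r" "R * \<beta> = U" "R = 0 \<longrightarrow> \<beta> = 0"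
    using givens[OF r, of U] unfolding R_def by metis
  have one: "of_real (\<alpha>\<^sup>2) + \<beta> * cnj \<beta> = 1"
    using g(2) by (metis complex_norm_square of_real_1 of_real_add)
  have eqr: "of_real r * (\<alpha> * x - \<beta> * \<eta>) + U * (cnj \<beta> * x + \<alpha> * \<eta>) = R * x" for x \<eta> :: complex
  proof -
    have "of_real r * (\<alpha> * x - \<beta> * \<eta>) + U * (cnj \<beta> * x + \<alpha> * \<eta>)
      = R * (of_real (\<alpha>\<^sup>2) + \<beta> * cnj \<beta>) * x"
      unfolding g(3,4)[symmetric] by (simp add: algebra_simps power2_eq_square)
    then show ?thesis by (simp only: one mult_1_right)
  qed
  \<comment> \<open>The rotation that clears the first row turns the second row
    \<open>(t, P)\<close> into \<open>(t', P')\<close>. The remainder \<open>P' * \<eta>\<close> is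
    independent of the new first row and joins \<open>s * w\<close> through
    \<open>gauss_merge\<close>.\<close>
  define t' where "t' = \<alpha> * t + cnj \<beta> * P"
  define P' where "P' = \<alpha> * P - \<beta> * t"
  have eqt: "t * (\<alpha> * x - \<beta> * \<eta>) + s * w + P * (cnj \<beta> * x + \<alpha> * \<eta>)
      = t' * x + s * w + P' * \<eta>" for x w \<eta> :: complex
    by (simp add: t'_def P'_def algebra_simps)
  define s' where "s' = sqrt (s\<^sup>2 + (cmod P')\<^sup>2)"
  have norms: "(cmod t')\<^sup>2 + (cmod P')\<^sup>2 = (cmod t)\<^sup>2 + (cmod P)\<^sup>2"
    using cmod_rotate[of \<alpha> P \<beta> t] g(2) by (simp add: t'_def P'_def add_ac)
  show ?thesis
  proof (rule that[of R s' t'])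
    show "0 \<le> R" "0 \<le> s'" "R\<^sup>2 = r\<^sup>2 + (cmod U)\<^sup>2" by (simp_all add: R_def s'_def)
    show "R * t' = r * t + cnj U * P"
      unfolding g(3,4)[symmetric] t'_def by (simp add: algebra_simps)
    show "(cmod t')\<^sup>2 + s'\<^sup>2 = (cmod t)\<^sup>2 + s\<^sup>2 + (cmod P)\<^sup>2"
      using norms by (simp add: s'_def)
    show "R = 0 \<longrightarrow> t' = 0" using g(3,5) rt by (auto simp: t'_def)
    show "\<forall>F \<in> borel_measurable (borel \<Otimes>\<^sub>M borel).
      (\<integral>\<^sup>+x. \<integral>\<^sup>+w. \<integral>\<^sup>+\<eta>. F (r * x + U * \<eta>, t * x + s * w + P * \<eta>) \<partial>gauss \<partial>gauss \<partial>gauss)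
      = (\<integral>\<^sup>+x. \<integral>\<^sup>+w. F (R * x, t' * x + s' * w) \<partial>gauss \<partial>gauss)"
    proof
      fix F :: "complex \<times> complex \<Rightarrow> ennreal" assume [measurable]: "F \<in> borel_measurable (borel \<Otimes>\<^sub>M borel)"
      have "(\<integral>\<^sup>+x. \<integral>\<^sup>+w. \<integral>\<^sup>+\<eta>. F (r * x + U * \<eta>, t * x + s * w + P * \<eta>) \<partial>gauss \<partial>gauss \<partial>gauss)
        = (\<integral>\<^sup>+x. \<integral>\<^sup>+\<eta>. \<integral>\<^sup>+w. F (r * x + U * \<eta>, t * x + s * w + P * \<eta>) \<partial>gauss \<partial>gauss \<partial>gauss)"
        by (intro nn_integral_cong gauss_pair.Fubini') measurable
      also have "\<dots> = (\<integral>\<^sup>+x. \<integral>\<^sup>+\<eta>. \<integral>\<^sup>+w. F (r * (\<alpha> * x - \<beta> * \<eta>) + U * (cnj \<beta> * x + \<alpha> * \<eta>),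
          t * (\<alpha> * x - \<beta> * \<eta>) + s * w + P * (cnj \<beta> * x + \<alpha> * \<eta>)) \<partial>gauss \<partial>gauss \<partial>gauss)"
        by (rule nn_integral_gauss_rotate[symmetric, OF _ g(1,2)]) measurable
      also have "\<dots> = (\<integral>\<^sup>+x. \<integral>\<^sup>+\<eta>. \<integral>\<^sup>+w. F (R * x, t' * x + s * w + P' * \<eta>) \<partial>gauss \<partial>gauss \<partial>gauss)"
        by (simp only: eqr eqt)
      also have "\<dots> = (\<integral>\<^sup>+x. \<integral>\<^sup>+w. \<integral>\<^sup>+\<eta>. F (R * x, t' * x + s * w + P' * \<eta>) \<partial>gauss \<partial>gauss \<partial>gauss)"
        by (intro nn_integral_cong gauss_pair.Fubini') measurable
      also have "\<dots> = (\<integral>\<^sup>+x. \<integral>\<^sup>+w. F (R * x, t' * x + s' * w) \<partial>gauss \<partial>gauss)"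
        unfolding s'_def by (intro nn_integral_cong gauss_merge[OF _ s]) measurable
      finally show "(\<integral>\<^sup>+x. \<integral>\<^sup>+w. \<integral>\<^sup>+\<eta>. F (r * x + U * \<eta>, t * x + s * w + P * \<eta>) \<partial>gauss \<partial>gauss \<partial>gauss)
        = (\<integral>\<^sup>+x. \<integral>\<^sup>+w. F (R * x, t' * x + s' * w) \<partial>gauss \<partial>gauss)" .
    qed
  qed
qed

text \<open>This is the Cholesky form of the pair of sums: the equations match the two variances and
  the covariance \<open>r * t\<close>. \<open>gauss_absorb\<close> adds one summand at a time. The
  clause for \<open>r = 0\<close> fixes \<open>t\<close>, which the covariance then leaves
  open.\<close>

lemma gauss_collapse:
  fixes u p :: "'i \<Rightarrow> complex" and c :: "'i \<Rightarrow> real"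
  assumes "finite I"
  shows "\<exists>r s t. 0 \<le> r \<and> 0 \<le> s \<and> r\<^sup>2 = (\<Sum>i\<in>I. (c i)\<^sup>2 * (cmod (u i))\<^sup>2)
    \<and> of_real r * t = (\<Sum>i\<in>I. of_real ((c i)\<^sup>2) * cnj (u i) * p i)
    \<and> (cmod t)\<^sup>2 + s\<^sup>2 = (\<Sum>i\<in>I. (c i)\<^sup>2 * (cmod (p i))\<^sup>2) \<and> (r = 0 \<longrightarrow> t = 0)
    \<and> (\<forall>F :: complex \<times> complex \<Rightarrow> ennreal. F \<in> borel_measurable (borel \<Otimes>\<^sub>M borel) \<longrightarrow>
      (\<integral>\<^sup>+f. F (\<Sum>i\<in>I. f i * u i, \<Sum>i\<in>I. f i * p i) \<partial>(\<Pi>\<^sub>M i\<in>I. distr gauss borel (\<lambda>x. of_real (c i) * x)))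
      = (\<integral>\<^sup>+x. \<integral>\<^sup>+w. F (of_real r * x, t * x + of_real s * w) \<partial>gauss \<partial>gauss))"
  using assms
proof (induction I rule: finite_induct)
  case empty
  have "(\<integral>\<^sup>+f. F (0, 0) \<partial>(\<Pi>\<^sub>M i\<in>{}. distr gauss borel (\<lambda>x. of_real (c i) * x))) = F (0, 0)"
    for F :: "complex \<times> complex \<Rightarrow> ennreal"
    by (simp add: nn_integral_empty space_PiM emeasure_PiM_empty PiM_empty)
  then show ?case
    by (intro exI[of _ 0]) (simp add: gauss.emeasure_space_1[simplified])
next
  case (insert j I)
  interpret product_prob_space "\<lambda>i. distr gauss borel (\<lambda>x. of_real (c i) * x)" UNIV
    by (auto intro!: product_prob_spaceI gauss.prob_space_distr)
  from insert.IH obtain r s t where IH: "0 \<le> r" "0 \<le> s" "r\<^sup>2 = (\<Sum>i\<in>I. (c i)\<^sup>2 * (cmod (u i))\<^sup>2)"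
    "of_real r * t = (\<Sum>i\<in>I. of_real ((c i)\<^sup>2) * cnj (u i) * p i)"
    "(cmod t)\<^sup>2 + s\<^sup>2 = (\<Sum>i\<in>I. (c i)\<^sup>2 * (cmod (p i))\<^sup>2)" "r = 0 \<longrightarrow> t = 0"
    and IHF: "\<And>F :: complex \<times> complex \<Rightarrow> ennreal. F \<in> borel_measurable (borel \<Otimes>\<^sub>M borel) \<Longrightarrow>
      (\<integral>\<^sup>+f. F (\<Sum>i\<in>I. f i * u i, \<Sum>i\<in>I. f i * p i) \<partial>(\<Pi>\<^sub>M i\<in>I. distr gauss borel (\<lambda>x. of_real (c i) * x)))
      = (\<integral>\<^sup>+x. \<integral>\<^sup>+w. F (of_real r * x, t * x + of_real s * w) \<partial>gauss \<partial>gauss)"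
    by blast
  define U P where "U = of_real (c j) * u j" and "P = of_real (c j) * p j"
  obtain r' s' t' where n: "0 \<le> r'" "0 \<le> s'" "r'\<^sup>2 = r\<^sup>2 + (cmod U)\<^sup>2" "r' * t' = r * t + cnj U * P"
    "(cmod t')\<^sup>2 + s'\<^sup>2 = (cmod t)\<^sup>2 + s\<^sup>2 + (cmod P)\<^sup>2" "r' = 0 \<longrightarrow> t' = 0"
    and nF: "\<forall>F \<in> borel_measurable (borel \<Otimes>\<^sub>M borel).
      (\<integral>\<^sup>+x. \<integral>\<^sup>+w. \<integral>\<^sup>+\<eta>. F (r * x + U * \<eta>, t * x + s * w + P * \<eta>) \<partial>gauss \<partial>gauss \<partial>gauss)
      = (\<integral>\<^sup>+x. \<integral>\<^sup>+w. F (r' * x, t' * x + s' * w) \<partial>gauss \<partial>gauss)"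
    by (rule gauss_absorb[OF IH(1,2,6), where U=U and P=P])
  show ?case
  proof (rule exI[of _ r'], rule exI[of _ s'], rule exI[of _ t'], intro conjI allI impI)
    show "0 \<le> r'" "0 \<le> s'" by fact+
    show "r'\<^sup>2 = (\<Sum>i\<in>insert j I. (c i)\<^sup>2 * (cmod (u i))\<^sup>2)"
      using insert.hyps n(3) IH(3) by (simp add: U_def norm_mult power_mult_distrib)
    show "of_real r' * t' = (\<Sum>i\<in>insert j I. of_real ((c i)\<^sup>2) * cnj (u i) * p i)"
      using insert.hyps n(4) IH(4) by (simp add: U_def P_def power2_eq_square mult_ac)
    show "(cmod t')\<^sup>2 + s'\<^sup>2 = (\<Sum>i\<in>insert j I. (c i)\<^sup>2 * (cmod (p i))\<^sup>2)"
      using insert.hyps n(5) IH(5) by (simp add: P_def norm_mult power_mult_distrib)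
    show "t' = 0" if "r' = 0" using that n(6) by blast
    fix F :: "complex \<times> complex \<Rightarrow> ennreal"
    assume F [measurable]: "F \<in> borel_measurable (borel \<Otimes>\<^sub>M borel)"
    \<comment> \<open>Integrating the new coefficient first turns the test function \<open>F\<close>
      into the test function \<open>G\<close>, which is why the induction hypothesis must cover all
      of them.\<close>
    define G where "G = (\<lambda>q. \<integral>\<^sup>+\<eta>. F (fst q + U * \<eta>, snd q + P * \<eta>) \<partial>gauss)"
    have G [measurable]: "G \<in> borel_measurable (borel \<Otimes>\<^sub>M borel)"
      unfolding G_def by measurable
    have "(\<integral>\<^sup>+f. F (\<Sum>i\<in>insert j I. f i * u i, \<Sum>i\<in>insert j I. f i * p i)
        \<partial>(\<Pi>\<^sub>M i\<in>insert j I. distr gauss borel (\<lambda>x. of_real (c i) * x)))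
      = (\<integral>\<^sup>+f. (\<integral>\<^sup>+y. F (\<Sum>i\<in>insert j I. (f(j := y)) i * u i, \<Sum>i\<in>insert j I. (f(j := y)) i * p i)
        \<partial>distr gauss borel (\<lambda>x. of_real (c j) * x)) \<partial>(\<Pi>\<^sub>M i\<in>I. distr gauss borel (\<lambda>x. of_real (c i) * x)))"
      by (rule product_nn_integral_insert[OF insert.hyps]) measurable
    also have "\<dots> = (\<integral>\<^sup>+f. G (\<Sum>i\<in>I. f i * u i, \<Sum>i\<in>I. f i * p i)
         \<partial>(\<Pi>\<^sub>M i\<in>I. distr gauss borel (\<lambda>x. of_real (c i) * x)))"
    proof (rule nn_integral_cong)
      fix f :: "'i \<Rightarrow> complex"
      have s: "(\<Sum>i\<in>insert j I. (f(j := y)) i * q i) = (\<Sum>i\<in>I. f i * q i) + y * q j" for y and q :: "'i \<Rightarrow> complex"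
        using insert.hyps by (simp add: add.commute) (rule sum.cong, auto)
      have "(\<integral>\<^sup>+y. F (\<Sum>i\<in>insert j I. (f(j := y)) i * u i, \<Sum>i\<in>insert j I. (f(j := y)) i * p i)
          \<partial>distr gauss borel (\<lambda>x. of_real (c j) * x))
         = (\<integral>\<^sup>+y. F ((\<Sum>i\<in>I. f i * u i) + (of_real (c j) * y) * u j, (\<Sum>i\<in>I. f i * p i) + (of_real (c j) * y) * p j) \<partial>gauss)"
        unfolding s by (subst nn_integral_distr) measurable
      then show "(\<integral>\<^sup>+y. F (\<Sum>i\<in>insert j I. (f(j := y)) i * u i, \<Sum>i\<in>insert j I. (f(j := y)) i * p i)
          \<partial>distr gauss borel (\<lambda>x. of_real (c j) * x))
          = G (\<Sum>i\<in>I. f i * u i, \<Sum>i\<in>I. f i * p i)"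
        by (simp add: G_def U_def P_def mult_ac)
    qed
    also have "\<dots> = (\<integral>\<^sup>+x. \<integral>\<^sup>+w. G (of_real r * x, t * x + of_real s * w) \<partial>gauss \<partial>gauss)"
      by (rule IHF[OF G])
    also have "\<dots> = (\<integral>\<^sup>+x. \<integral>\<^sup>+w. F (of_real r' * x, t' * x + of_real s' * w) \<partial>gauss \<partial>gauss)"
      using bspec[OF nF F] by (simp add: G_def)
    finally show "(\<integral>\<^sup>+f. F (\<Sum>i\<in>insert j I. f i * u i, \<Sum>i\<in>insert j I. f i * p i)
        \<partial>(\<Pi>\<^sub>M i\<in>insert j I. distr gauss borel (\<lambda>x. of_real (c i) * x)))
      = (\<integral>\<^sup>+x. \<integral>\<^sup>+w. F (of_real r' * x, t' * x + of_real s' * w) \<partial>gauss \<partial>gauss)" .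
  qed
qed

text \<open>To be applied with the holomorphic coefficients in \<open>I\<close>, the antiholomorphic
  ones in \<open>J\<close>, the two derivatives as first and second sum and the value as third. The
  derivatives use disjoint sets of coefficients and are independent; only the value correlates with
  both. The clause for \<open>r2 = 0\<close> serves \<open>m = 0\<close>, where the antiholomorphic
  derivative vanishes.\<close>

lemma gauss_collapse2:
  fixes u v p :: "'i \<Rightarrow> complex" and c :: "'i \<Rightarrow> real"
  assumes fin: "finite I" "finite J" and disj: "I \<inter> J = {}"
  shows "\<exists>r1 r2 s t1 t2. 0 \<le> r1 \<and> 0 \<le> r2 \<and> r1\<^sup>2 = (\<Sum>i\<in>I. (c i)\<^sup>2 * (cmod (u i))\<^sup>2)
    \<and> r2\<^sup>2 = (\<Sum>i\<in>J. (c i)\<^sup>2 * (cmod (v i))\<^sup>2)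
    \<and> of_real r1 * t1 = (\<Sum>i\<in>I. of_real ((c i)\<^sup>2) * cnj (u i) * p i)
    \<and> of_real r2 * t2 = (\<Sum>i\<in>J. of_real ((c i)\<^sup>2) * cnj (v i) * p i)
    \<and> (cmod t1)\<^sup>2 + (cmod t2)\<^sup>2 + s\<^sup>2 = (\<Sum>i\<in>I \<union> J. (c i)\<^sup>2 * (cmod (p i))\<^sup>2)
    \<and> (r2 = 0 \<longrightarrow> t2 = 0)
    \<and> (\<forall>F :: complex \<times> complex \<times> complex \<Rightarrow> ennreal. F \<in> borel_measurable (borel \<Otimes>\<^sub>M borel \<Otimes>\<^sub>M borel) \<longrightarrow>
      (\<integral>\<^sup>+f. F (\<Sum>i\<in>I. f i * u i, \<Sum>i\<in>J. f i * v i, \<Sum>i\<in>I \<union> J. f i * p i)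
         \<partial>(\<Pi>\<^sub>M i\<in>I \<union> J. distr gauss borel (\<lambda>x. of_real (c i) * x)))
      = (\<integral>\<^sup>+x. \<integral>\<^sup>+y. \<integral>\<^sup>+w. F (of_real r1 * x, of_real r2 * y, t1 * x + t2 * y + of_real s * w) \<partial>gauss \<partial>gauss \<partial>gauss))"
proof -
  interpret product_prob_space "\<lambda>i. distr gauss borel (\<lambda>x. of_real (c i) * x)" UNIV
    by (auto intro!: product_prob_spaceI gauss.prob_space_distr)
  let ?\<mu> = "\<lambda>i. distr gauss borel (\<lambda>x. of_real (c i) * x)"
  from gauss_collapse[OF fin(1), of c u p] obtain r1 s1 t1 where
    A: "0 \<le> r1" "0 \<le> s1" "r1\<^sup>2 = (\<Sum>i\<in>I. (c i)\<^sup>2 * (cmod (u i))\<^sup>2)"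
    "of_real r1 * t1 = (\<Sum>i\<in>I. of_real ((c i)\<^sup>2) * cnj (u i) * p i)"
    "(cmod t1)\<^sup>2 + s1\<^sup>2 = (\<Sum>i\<in>I. (c i)\<^sup>2 * (cmod (p i))\<^sup>2)"
    and AF: "\<And>F :: complex \<times> complex \<Rightarrow> ennreal. F \<in> borel_measurable (borel \<Otimes>\<^sub>M borel) \<Longrightarrow>
      (\<integral>\<^sup>+f. F (\<Sum>i\<in>I. f i * u i, \<Sum>i\<in>I. f i * p i) \<partial>Pi\<^sub>M I ?\<mu>)
      = (\<integral>\<^sup>+x. \<integral>\<^sup>+w. F (of_real r1 * x, t1 * x + of_real s1 * w) \<partial>gauss \<partial>gauss)"
    by blast
  from gauss_collapse[OF fin(2), of c v p] obtain r2 s2 t2 where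
    B: "0 \<le> r2" "0 \<le> s2" "r2\<^sup>2 = (\<Sum>i\<in>J. (c i)\<^sup>2 * (cmod (v i))\<^sup>2)"
    "of_real r2 * t2 = (\<Sum>i\<in>J. of_real ((c i)\<^sup>2) * cnj (v i) * p i)"
    "(cmod t2)\<^sup>2 + s2\<^sup>2 = (\<Sum>i\<in>J. (c i)\<^sup>2 * (cmod (p i))\<^sup>2)" "r2 = 0 \<longrightarrow> t2 = 0"
    and BF: "\<And>F :: complex \<times> complex \<Rightarrow> ennreal. F \<in> borel_measurable (borel \<Otimes>\<^sub>M borel) \<Longrightarrow>
      (\<integral>\<^sup>+f. F (\<Sum>i\<in>J. f i * v i, \<Sum>i\<in>J. f i * p i) \<partial>Pi\<^sub>M J ?\<mu>)
      = (\<integral>\<^sup>+x. \<integral>\<^sup>+w. F (of_real r2 * x, t2 * x + of_real s2 * w) \<partial>gauss \<partial>gauss)"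
    by blast
  \<comment> \<open>Each block leaves a remainder in the third coordinate; the two are independent
    and merge into one.\<close>
  define s where "s = sqrt (s1\<^sup>2 + s2\<^sup>2)"
  show ?thesis
  proof (rule exI[of _ r1], rule exI[of _ r2], rule exI[of _ s], rule exI[of _ t1], rule exI[of _ t2], intro conjI allI impI)
    show "0 \<le> r1" "0 \<le> r2" "r1\<^sup>2 = (\<Sum>i\<in>I. (c i)\<^sup>2 * (cmod (u i))\<^sup>2)"
      "r2\<^sup>2 = (\<Sum>i\<in>J. (c i)\<^sup>2 * (cmod (v i))\<^sup>2)"
      "of_real r1 * t1 = (\<Sum>i\<in>I. of_real ((c i)\<^sup>2) * cnj (u i) * p i)"
      "of_real r2 * t2 = (\<Sum>i\<in>J. of_real ((c i)\<^sup>2) * cnj (v i) * p i)" by fact+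
    show "t2 = 0" if "r2 = 0" using that B(6) by blast
    show "(cmod t1)\<^sup>2 + (cmod t2)\<^sup>2 + s\<^sup>2 = (\<Sum>i\<in>I \<union> J. (c i)\<^sup>2 * (cmod (p i))\<^sup>2)"
      using A(5) B(5) fin disj by (simp add: s_def sum.union_disjoint)
    fix F :: "complex \<times> complex \<times> complex \<Rightarrow> ennreal"
    assume F [measurable]: "F \<in> borel_measurable (borel \<Otimes>\<^sub>M borel \<Otimes>\<^sub>M borel)"
    have eq: "(\<Sum>i\<in>I. merge I J (f, f') i * q i) = (\<Sum>i\<in>I. f i * q i)"
      "(\<Sum>i\<in>J. merge I J (f, f') i * q i) = (\<Sum>i\<in>J. f' i * q i)"
      "(\<Sum>i\<in>I \<union> J. merge I J (f, f') i * q i) = (\<Sum>i\<in>I. f i * q i) + (\<Sum>i\<in>J. f' i * q i)"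
      for f f' and q :: "'i \<Rightarrow> complex"
    proof -
      show 1: "(\<Sum>i\<in>I. merge I J (f, f') i * q i) = (\<Sum>i\<in>I. f i * q i)"
        by (rule sum.cong) (auto simp: merge_def)
      show 2: "(\<Sum>i\<in>J. merge I J (f, f') i * q i) = (\<Sum>i\<in>J. f' i * q i)"
        using disj by (intro sum.cong) (auto simp: merge_def)
      show "(\<Sum>i\<in>I \<union> J. merge I J (f, f') i * q i) = (\<Sum>i\<in>I. f i * q i) + (\<Sum>i\<in>J. f' i * q i)"
        using fin disj by (simp add: sum.union_disjoint 1 2)
    qed
    define G where "G = (\<lambda>a. \<integral>\<^sup>+y. \<integral>\<^sup>+w'. F (fst a, of_real r2 * y, snd a + (t2 * y + of_real s2 * w')) \<partial>gauss \<partial>gauss)"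
    have G [measurable]: "G \<in> borel_measurable (borel \<Otimes>\<^sub>M borel)"
      unfolding G_def by measurable
    have "(\<integral>\<^sup>+f. F (\<Sum>i\<in>I. f i * u i, \<Sum>i\<in>J. f i * v i, \<Sum>i\<in>I \<union> J. f i * p i) \<partial>Pi\<^sub>M (I \<union> J) ?\<mu>)
      = (\<integral>\<^sup>+f. \<integral>\<^sup>+f'. F (\<Sum>i\<in>I. merge I J (f, f') i * u i, \<Sum>i\<in>J. merge I J (f, f') i * v i,
          \<Sum>i\<in>I \<union> J. merge I J (f, f') i * p i) \<partial>Pi\<^sub>M J ?\<mu> \<partial>Pi\<^sub>M I ?\<mu>)"
      by (rule product_nn_integral_fold[OF disj fin]) measurable
    also have "\<dots> = (\<integral>\<^sup>+f. \<integral>\<^sup>+f'. F (\<Sum>i\<in>I. f i * u i, \<Sum>i\<in>J. f' i * v i,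
         (\<Sum>i\<in>I. f i * p i) + (\<Sum>i\<in>J. f' i * p i)) \<partial>Pi\<^sub>M J ?\<mu> \<partial>Pi\<^sub>M I ?\<mu>)"
      by (simp only: eq)
    also have "\<dots> = (\<integral>\<^sup>+f. G (\<Sum>i\<in>I. f i * u i, \<Sum>i\<in>I. f i * p i) \<partial>Pi\<^sub>M I ?\<mu>)"
    proof (rule nn_integral_cong)
      fix f :: "'i \<Rightarrow> complex"
      have "(\<lambda>q. F (\<Sum>i\<in>I. f i * u i, fst q, (\<Sum>i\<in>I. f i * p i) + snd q)) \<in> borel_measurable (borel \<Otimes>\<^sub>M borel)"
        by measurable
      from BF[OF this] show "(\<integral>\<^sup>+f'. F (\<Sum>i\<in>I. f i * u i, \<Sum>i\<in>J. f' i * v i,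
         (\<Sum>i\<in>I. f i * p i) + (\<Sum>i\<in>J. f' i * p i)) \<partial>Pi\<^sub>M J ?\<mu>)
        = G (\<Sum>i\<in>I. f i * u i, \<Sum>i\<in>I. f i * p i)"
        by (simp add: G_def)
    qed
    also have "\<dots> = (\<integral>\<^sup>+x. \<integral>\<^sup>+w. G (of_real r1 * x, t1 * x + of_real s1 * w) \<partial>gauss \<partial>gauss)"
      by (rule AF[OF G])
    also have "\<dots> = (\<integral>\<^sup>+x. \<integral>\<^sup>+w. \<integral>\<^sup>+y. \<integral>\<^sup>+w'.
        F (of_real r1 * x, of_real r2 * y, (t1 * x + t2 * y) + of_real s1 * w + of_real s2 * w') \<partial>gauss \<partial>gauss \<partial>gauss \<partial>gauss)"
      by (simp add: G_def add_ac)
    also have "\<dots> = (\<integral>\<^sup>+x. \<integral>\<^sup>+y. \<integral>\<^sup>+w. \<integral>\<^sup>+w'.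
        F (of_real r1 * x, of_real r2 * y, (t1 * x + t2 * y) + of_real s1 * w + of_real s2 * w') \<partial>gauss \<partial>gauss \<partial>gauss \<partial>gauss)"
      by (intro nn_integral_cong gauss_pair.Fubini') measurable
    also have "\<dots> = (\<integral>\<^sup>+x. \<integral>\<^sup>+y. \<integral>\<^sup>+w.
        F (of_real r1 * x, of_real r2 * y, (t1 * x + t2 * y) + of_real (sqrt (s1\<^sup>2 + (cmod (of_real s2))\<^sup>2)) * w) \<partial>gauss \<partial>gauss \<partial>gauss)"
      by (intro nn_integral_cong gauss_merge[OF _ A(2), where F = "\<lambda>z. F (_, _, z)"]) measurable
    finally show "(\<integral>\<^sup>+f. F (\<Sum>i\<in>I. f i * u i, \<Sum>i\<in>J. f i * v i, \<Sum>i\<in>I \<union> J. f i * p i) \<partial>Pi\<^sub>M (I \<union> J) ?\<mu>)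
      = (\<integral>\<^sup>+x. \<integral>\<^sup>+y. \<integral>\<^sup>+w. F (of_real r1 * x, of_real r2 * y, t1 * x + t2 * y + of_real s * w) \<partial>gauss \<partial>gauss \<partial>gauss)"
      by (simp add: s_def)
  qed
qed

section \<open>Gaussian integrals of Hermitian forms\<close>

lemma measurable_cnj [measurable]: "cnj \<in> borel_measurable borel"
  by (intro borel_measurable_continuous_onI continuous_intros)

text \<open>Completing the square: \<open>W\<close> is the coefficient of the squared modulus of
  \<open>w\<close> in the exponent, once the exponent of the Gaussian density is included.\<close>

lemma nn_integral_gauss_exp_quadratic:
  fixes s :: real and q :: complex
  defines "W \<equiv> 1 + s\<^sup>2"
  shows "(\<integral>\<^sup>+w. ennreal (exp (- (cmod (q + s * w))\<^sup>2)) \<partial>gauss) = ennreal (exp (- (cmod q)\<^sup>2 / W) / W)"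
proof -
  have W: "0 < W" by (simp add: W_def add_pos_nonneg)
  have sq: "(cmod (q + s * w))\<^sup>2 + (cmod w)\<^sup>2 = W * (cmod (w + (s / W) * q))\<^sup>2 + (cmod q)\<^sup>2 / W" for w :: complex
  proof -
    have "W * ((cmod (q + s * w))\<^sup>2 + (cmod w)\<^sup>2) = (cmod (W * w + s * q))\<^sup>2 + (cmod q)\<^sup>2"
      unfolding cmod_power2 W_def by simp algebra
    also have "W * w + s * q = W * (w + (s / W) * q)"
      using W by (simp add: field_simps)
    also have "(cmod (W * (w + (s / W) * q)))\<^sup>2 = W * (W * (cmod (w + (s / W) * q))\<^sup>2)"
      by (simp add: norm_mult power_mult_distrib power2_eq_square)
    finally show ?thesis using W by (simp add: field_simps)
  qed
  have "(\<integral>\<^sup>+w. ennreal (exp (- (cmod (q + s * w))\<^sup>2)) \<partial>gauss)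
    = (\<integral>\<^sup>+w. ennreal (exp (- (cmod q)\<^sup>2 / W) / pi) * ennreal (exp (- W * (cmod (w + (s / W) * q))\<^sup>2)) \<partial>lborel)"
  proof (subst nn_integral_gauss, measurable, intro nn_integral_cong)
    fix w :: complex
    have "exp (- (cmod w)\<^sup>2) * exp (- (cmod (q + s * w))\<^sup>2)
      = exp (- (cmod q)\<^sup>2 / W) * exp (- W * (cmod (w + (s / W) * q))\<^sup>2)"
      unfolding exp_add[symmetric] using sq[of w] by simp
    then show "ennreal (exp (- (cmod w)\<^sup>2) / pi) * ennreal (exp (- (cmod (q + s * w))\<^sup>2))
      = ennreal (exp (- (cmod q)\<^sup>2 / W) / pi) * ennreal (exp (- W * (cmod (w + (s / W) * q))\<^sup>2))"
      by (simp add: ennreal_mult[symmetric])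
  qed
  also have "\<dots> = ennreal (exp (- (cmod q)\<^sup>2 / W) / pi) *
      (\<integral>\<^sup>+w. ennreal (exp (- W * (cmod (w + (s / W) * q))\<^sup>2)) \<partial>lborel)"
    by (subst nn_integral_cmult) measurable
  also have "(\<integral>\<^sup>+w. ennreal (exp (- W * (cmod (w + (s / W) * q))\<^sup>2)) \<partial>lborel) = ennreal (pi / W)"
    by (subst nn_integral_lborel_translate[where f = "\<lambda>w. ennreal (exp (- W * (cmod w)\<^sup>2))"], measurable)
       (rule nn_integral_lborel_exp_cmod[OF W])
  finally show ?thesis using W by (simp add: ennreal_mult[symmetric])
qed

lemma nn_integral_abs_diff_exp:
  fixes s \<nu> :: real
  assumes s: "0 \<le> s" and \<nu>: "0 < \<nu>"
  shows "(\<integral>\<^sup>+t\<in>{0..}. ennreal (\<bar>s - t\<bar> * exp (- \<nu> * t)) \<partial>lborel)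
    = ennreal (s / \<nu> - 1 / \<nu>\<^sup>2 + 2 * exp (- \<nu> * s) / \<nu>\<^sup>2)"
proof -
  \<comment> \<open>An antiderivative of the integrand without the absolute value. It enters with
    opposite signs on the two sides of the kink at \<open>s\<close>, so \<open>F s\<close> counts
    twice; hence the factor 2 before the exponential.\<close>
  define F where "F = (\<lambda>t. - (s - t) * exp (- \<nu> * t) / \<nu> + exp (- \<nu> * t) / \<nu>\<^sup>2)"
  have F: "(F has_real_derivative (s - t) * exp (- \<nu> * t)) (at t)" for t
    unfolding F_def using \<nu>
    by (auto intro!: derivative_eq_intros simp: field_simps power2_eq_square)
  have "(\<integral>\<^sup>+t\<in>{0..}. ennreal (\<bar>s - t\<bar> * exp (- \<nu> * t)) \<partial>lborel)
     = (\<integral>\<^sup>+t. ennreal ((s - t) * exp (- \<nu> * t)) * indicator {0..s} t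
         + ennreal ((t - s) * exp (- \<nu> * t)) * indicator {s..} t \<partial>lborel)"
    using s by (intro nn_integral_cong) (auto split: split_indicator)
  also have "\<dots> = (\<integral>\<^sup>+t. ennreal ((s - t) * exp (- \<nu> * t)) * indicator {0..s} t \<partial>lborel)
         + (\<integral>\<^sup>+t. ennreal ((t - s) * exp (- \<nu> * t)) * indicator {s..} t \<partial>lborel)"
    by (rule nn_integral_add) measurable
  also have "(\<integral>\<^sup>+t. ennreal ((s - t) * exp (- \<nu> * t)) * indicator {0..s} t \<partial>lborel) = ennreal (F s - F 0)"
    using s by (intro nn_integral_FTC_Icc F) auto
  also have "(\<integral>\<^sup>+t. ennreal ((t - s) * exp (- \<nu> * t)) * indicator {s..} t \<partial>lborel) = ennreal (0 - (- F s))"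
  proof (rule nn_integral_FTC_atLeast)
    show "((\<lambda>t. - F t) has_real_derivative (t - s) * exp (- \<nu> * t)) (at t)" for t
      using DERIV_minus[OF F[of t]] by (simp add: algebra_simps)
    show "((\<lambda>t. - F t) \<longlongrightarrow> 0) at_top"
      unfolding F_def using \<nu> by real_asymp
  qed auto
  also have "ennreal (F s - F 0) + ennreal (0 - (- F s)) = ennreal (F s - F 0 + F s)"
  proof -
    have "F 0 \<le> F s"
    proof (rule DERIV_nonneg_imp_nondecreasing[OF s])
      show "\<exists>y. DERIV F x :> y \<and> 0 \<le> y" if "0 \<le> x" "x \<le> s" for x
        using F[of x] that by (intro exI[of _ "(s - x) * exp (- \<nu> * x)"]) auto
    qed
    moreover have "0 \<le> F s" by (simp add: F_def)
    ultimately show ?thesis by (simp flip: ennreal_plus)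
  qed
  also have "F s - F 0 + F s = s / \<nu> - 1 / \<nu>\<^sup>2 + 2 * exp (- \<nu> * s) / \<nu>\<^sup>2"
    using \<nu> by (simp add: F_def)
  finally show ?thesis .
qed

text \<open>Only squared moduli occur, and under the exponential weight they are, up to
  normalisation, independent exponential variables with rates \<open>\<mu>\<close> and
  \<open>\<nu>\<close>. What is computed is the mean distance between them.\<close>

lemma nn_integral_diagonal_form:
  fixes \<mu> \<nu> :: real
  assumes \<mu>: "0 < \<mu>" and \<nu>: "0 < \<nu>"
  shows "(\<integral>\<^sup>+x. \<integral>\<^sup>+y. ennreal (\<bar>(cmod x)\<^sup>2 - (cmod y)\<^sup>2\<bar> * exp (- (\<mu> * (cmod x)\<^sup>2 + \<nu> * (cmod y)\<^sup>2))) \<partial>lborel \<partial>lborel)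
    = ennreal (pi\<^sup>2 * ((\<mu>\<^sup>2 + \<nu>\<^sup>2) / ((\<mu> * \<nu>)\<^sup>2 * (\<mu> + \<nu>))))"
proof -
  define g where "g = (\<lambda>s. s / \<nu> - 1 / \<nu>\<^sup>2 + 2 * exp (- \<nu> * s) / \<nu>\<^sup>2)"
  have g0: "0 \<le> g s" for s
  proof -
    have "g s = (\<nu> * s - 1 + 2 * exp (- (\<nu> * s))) / \<nu>\<^sup>2"
      using \<nu> by (simp add: g_def field_simps power2_eq_square)
    moreover have "0 \<le> \<nu> * s - 1 + 2 * exp (- (\<nu> * s))"
      using exp_ge_add_one_self[of "- (\<nu> * s)"] exp_gt_zero[of "- (\<nu> * s)"] by linarith
    ultimately show ?thesis by simp
  qed
  have "(\<integral>\<^sup>+y. ennreal (\<bar>s - (cmod y)\<^sup>2\<bar> * exp (- (\<mu> * s + \<nu> * (cmod y)\<^sup>2))) \<partial>lborel)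
      = ennreal (pi * (exp (- \<mu> * s) * g s))" if s: "0 \<le> s" for s
  proof -
    have "(\<integral>\<^sup>+y. ennreal (\<bar>s - (cmod y)\<^sup>2\<bar> * exp (- (\<mu> * s + \<nu> * (cmod y)\<^sup>2))) \<partial>lborel)
        = (\<integral>\<^sup>+y. ennreal (exp (- \<mu> * s)) * ennreal (\<bar>s - (cmod y)\<^sup>2\<bar> * exp (- \<nu> * (cmod y)\<^sup>2)) \<partial>lborel)"
      by (intro nn_integral_cong) (simp add: ennreal_mult[symmetric] exp_diff exp_minus field_simps)
    also have "\<dots> = ennreal (exp (- \<mu> * s)) * (\<integral>\<^sup>+y. ennreal (\<bar>s - (cmod y)\<^sup>2\<bar> * exp (- \<nu> * (cmod y)\<^sup>2)) \<partial>lborel)"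
      by (rule nn_integral_cmult) measurable
    also have "(\<integral>\<^sup>+y. ennreal (\<bar>s - (cmod y)\<^sup>2\<bar> * exp (- \<nu> * (cmod y)\<^sup>2)) \<partial>lborel) = ennreal pi * ennreal (g s)"
      by (subst nn_integral_lborel_radial[where f = "\<lambda>t. ennreal (\<bar>s - t\<bar> * exp (- \<nu> * t))"], measurable)
         (simp only: nn_integral_abs_diff_exp[OF s \<nu>] g_def)
    finally show ?thesis using g0 by (simp add: ennreal_mult[symmetric] mult_ac)
  qed
  then have "(\<integral>\<^sup>+x. \<integral>\<^sup>+y. ennreal (\<bar>(cmod x)\<^sup>2 - (cmod y)\<^sup>2\<bar> * exp (- (\<mu> * (cmod x)\<^sup>2 + \<nu> * (cmod y)\<^sup>2))) \<partial>lborel \<partial>lborel)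
      = (\<integral>\<^sup>+x. ennreal (pi * (exp (- \<mu> * (cmod x)\<^sup>2) * g ((cmod x)\<^sup>2))) \<partial>lborel)"
    by simp
  also have "\<dots> = ennreal pi * (\<integral>\<^sup>+s\<in>{0..}. ennreal (pi * (exp (- \<mu> * s) * g s)) \<partial>lborel)"
    unfolding g_def by (subst nn_integral_lborel_radial[where f = "\<lambda>s. ennreal (pi * (exp (- \<mu> * s) * (s / \<nu> - 1 / \<nu>\<^sup>2 + 2 * exp (- \<nu> * s) / \<nu>\<^sup>2)))"])
      auto
  also have "(\<integral>\<^sup>+s\<in>{0..}. ennreal (pi * (exp (- \<mu> * s) * g s)) \<partial>lborel)
      = ennreal (0 - pi * (- 1 / (\<mu>\<^sup>2 * \<nu>) + 1 / (\<mu> * \<nu>\<^sup>2) - 2 / ((\<mu> + \<nu>) * \<nu>\<^sup>2)))"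
  proof -
    \<comment> \<open>An antiderivative that vanishes at infinity, with one term for each summand of
      \<open>g\<close> after integration by parts. Splitting it into \<open>f1\<close>,
      \<open>f2\<close>, \<open>f3\<close> separates the exponentials for the limit and for the
      derivative.\<close>
    define G where "G = (\<lambda>s. pi * (- (s / \<mu> + 1 / \<mu>\<^sup>2) * exp (- \<mu> * s) / \<nu> + exp (- \<mu> * s) / (\<mu> * \<nu>\<^sup>2)
       - 2 * exp (- (\<mu> + \<nu>) * s) / ((\<mu> + \<nu>) * \<nu>\<^sup>2)))"
    define f1 f2 f3 where "f1 = (\<lambda>s. (s / \<mu> + 1 / \<mu>\<^sup>2) * exp (- \<mu> * s))"
      and "f2 = (\<lambda>s. exp (- \<mu> * s))" and "f3 = (\<lambda>s. exp (- (\<mu> + \<nu>) * s))"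
    have Geq: "G = (\<lambda>s. pi * (- (f1 s / \<nu>) + f2 s / (\<mu> * \<nu>\<^sup>2) - 2 * f3 s / ((\<mu> + \<nu>) * \<nu>\<^sup>2)))"
      unfolding G_def f1_def f2_def f3_def by (simp only: mult_minus_left minus_divide_left)
    have "(\<integral>\<^sup>+s\<in>{0..}. ennreal (pi * (exp (- \<mu> * s) * g s)) \<partial>lborel) = ennreal (0 - G 0)"
    proof (rule nn_integral_FTC_atLeast)
      show "(\<lambda>s. pi * (exp (- \<mu> * s) * g s)) \<in> borel_measurable borel"
        unfolding g_def by measurable
      show "(G \<longlongrightarrow> 0) at_top"
      proof -
        have "((\<lambda>s. exp (- \<sigma> * s)) \<longlongrightarrow> 0) at_top" if "0 < \<sigma>" for \<sigma> :: real
          using that by real_asymp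
        from this[of "\<mu> + \<nu>"] have f3: "(f3 \<longlongrightarrow> 0) at_top"
          using \<mu> \<nu> by (simp add: f3_def)
        have f12: "(f1 \<longlongrightarrow> 0) at_top" "(f2 \<longlongrightarrow> 0) at_top"
          unfolding f1_def f2_def using \<mu> by real_asymp+
        have "((\<lambda>s. pi * (- (f1 s / \<nu>) + f2 s / (\<mu> * \<nu>\<^sup>2) - 2 * f3 s / ((\<mu> + \<nu>) * \<nu>\<^sup>2)))
            \<longlongrightarrow> pi * (- (0 / \<nu>) + 0 / (\<mu> * \<nu>\<^sup>2) - 2 * 0 / ((\<mu> + \<nu>) * \<nu>\<^sup>2))) at_top"
          using \<mu> \<nu> by (intro tendsto_intros f12 f3) auto
        then show ?thesis by (simp add: Geq)
      qed
      show "0 \<le> pi * (exp (- \<mu> * s) * g s)" for s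
        using g0[of s] by simp
      fix s :: real
      have d1: "(f1 has_real_derivative - s * exp (- \<mu> * s)) (at s)"
        unfolding f1_def using \<mu>
        by (auto intro!: derivative_eq_intros simp: field_simps power2_eq_square)
      have d2: "(f2 has_real_derivative - \<mu> * exp (- \<mu> * s)) (at s)"
        unfolding f2_def by (auto intro!: derivative_eq_intros)
      have d3: "(f3 has_real_derivative - (\<mu> + \<nu>) * exp (- (\<mu> + \<nu>) * s)) (at s)"
        unfolding f3_def by (rule derivative_eq_intros refl | simp)+
      have "(G has_real_derivative pi * (- (- s * exp (- \<mu> * s) / \<nu>) + - \<mu> * exp (- \<mu> * s) / (\<mu> * \<nu>\<^sup>2)
          - 2 * (- (\<mu> + \<nu>) * exp (- (\<mu> + \<nu>) * s)) / ((\<mu> + \<nu>) * \<nu>\<^sup>2))) (at s)"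
        unfolding Geq
        by (intro DERIV_cmult DERIV_diff DERIV_add DERIV_minus DERIV_cdivide d1 d2 d3)
      also have "pi * (- (- s * exp (- \<mu> * s) / \<nu>) + - \<mu> * exp (- \<mu> * s) / (\<mu> * \<nu>\<^sup>2)
          - 2 * (- (\<mu> + \<nu>) * exp (- (\<mu> + \<nu>) * s)) / ((\<mu> + \<nu>) * \<nu>\<^sup>2)) = pi * (exp (- \<mu> * s) * g s)"
      proof -
        have e: "exp (- (\<mu> + \<nu>) * s) = exp (- \<mu> * s) * exp (- \<nu> * s)"
          by (simp add: exp_add[symmetric] algebra_simps)
        have b: "- \<mu> * exp (- \<mu> * s) / (\<mu> * \<nu>\<^sup>2) = - (exp (- \<mu> * s) / \<nu>\<^sup>2)"
          using \<mu> by simp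
        have "2 * (- \<sigma> * q) / (\<sigma> * n) = - 2 * q / n" if "0 < \<sigma>" for \<sigma> q n :: real
          using that by simp
        from this[of "\<mu> + \<nu>" "exp (- (\<mu> + \<nu>) * s)" "\<nu>\<^sup>2"]
        have c: "2 * (- (\<mu> + \<nu>) * exp (- (\<mu> + \<nu>) * s)) / ((\<mu> + \<nu>) * \<nu>\<^sup>2)
            = - 2 * (exp (- \<mu> * s) * exp (- \<nu> * s)) / \<nu>\<^sup>2"
          using \<mu> \<nu> by (simp only: e add_pos_pos)
        show ?thesis unfolding b c g_def by (simp add: algebra_simps)
      qed
      finally show "(G has_real_derivative pi * (exp (- \<mu> * s) * g s)) (at s)" .
    qed
    then show ?thesis by (simp add: G_def)
  qed
  also have "0 - pi * (- 1 / (\<mu>\<^sup>2 * \<nu>) + 1 / (\<mu> * \<nu>\<^sup>2) - 2 / ((\<mu> + \<nu>) * \<nu>\<^sup>2))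
      = pi * ((\<mu>\<^sup>2 + \<nu>\<^sup>2) / ((\<mu> * \<nu>)\<^sup>2 * (\<mu> + \<nu>)))"
  proof -
    have nz: "\<mu> \<noteq> 0" "\<nu> \<noteq> 0" "\<mu> + \<nu> \<noteq> 0" using \<mu> \<nu> by auto
    have "- 1 / (\<mu>\<^sup>2 * \<nu>) + 1 / (\<mu> * \<nu>\<^sup>2) - 2 / ((\<mu> + \<nu>) * \<nu>\<^sup>2) = - ((\<mu>\<^sup>2 + \<nu>\<^sup>2) / ((\<mu> * \<nu>)\<^sup>2 * (\<mu> + \<nu>)))"
      using nz by (simp add: divide_simps) algebra
    then show ?thesis by simp
  qed
  finally show ?thesis
    using \<mu> \<nu> by (simp add: ennreal_mult[symmetric] power2_eq_square mult_ac)
qed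

text \<open>A hyperbolic rotation in \<open>SU(1,1)\<close> preserves \<open>|x|\<^sup>2 - |y|\<^sup>2\<close> and diagonalises
  the Hermitian form in the exponent.\<close>

lemma nn_integral_hermitian_form:
  fixes A B :: real and \<kappa> :: complex
  assumes A: "0 < A" and B: "0 < B" and pos: "(cmod \<kappa>)\<^sup>2 < A * B"
  shows "\<exists>\<mu> \<nu>. 0 < \<mu> \<and> 0 < \<nu> \<and> \<mu> - \<nu> = A - B \<and> \<mu> * \<nu> = A * B - (cmod \<kappa>)\<^sup>2 \<and>
    (\<integral>\<^sup>+x. \<integral>\<^sup>+y. ennreal (\<bar>(cmod x)\<^sup>2 - (cmod y)\<^sup>2\<bar> *
        exp (- (A * (cmod x)\<^sup>2 + B * (cmod y)\<^sup>2 + 2 * Re (\<kappa> * x * cnj y)))) \<partial>lborel \<partial>lborel)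
    = ennreal (pi\<^sup>2 * ((\<mu>\<^sup>2 + \<nu>\<^sup>2) / ((\<mu> * \<nu>)\<^sup>2 * (\<mu> + \<nu>))))"
proof -
  \<comment> \<open>A matrix in \<open>SU(1,1)\<close> preserves the difference \<open>A - B\<close>
    and the determinant \<open>A * B - K\<close> of the form. Hence the diagonal entries must
    satisfy \<open>(\<mu> + \<nu>)\<^sup>2 = (A - B)\<^sup>2 + 4 * (A * B - K) = T\<^sup>2 - 4 *
    K\<close>, which makes \<open>\<Delta>\<close> their sum.\<close>
  define K T where "K = (cmod \<kappa>)\<^sup>2" and "T = A + B"
  define \<Delta> where "\<Delta> = sqrt (T\<^sup>2 - 4 * K)"
  have TK: "0 < T\<^sup>2 - 4 * K"
  proof -
    have "T\<^sup>2 - 4 * K = (A - B)\<^sup>2 + 4 * (A * B - K)" by (simp add: T_def power2_eq_square algebra_simps)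
    also have "0 < \<dots>" using pos by (intro add_nonneg_pos) (simp_all add: K_def)
    finally show ?thesis .
  qed
  then have \<Delta>0: "0 < \<Delta>" and \<Delta>2: "\<Delta>\<^sup>2 = T\<^sup>2 - 4 * K" by (simp_all add: \<Delta>_def)
  have T0: "0 < T" using A B by (simp add: T_def)
  have K0: "0 \<le> K" by (simp add: K_def)
  \<comment> \<open>A hyperbolic half-angle: \<open>a\<close> is a \<open>cosh\<close> and
    \<open>cmod b\<close> the matching \<open>sinh\<close>, with doubled angle given by
    \<open>cosh = T / \<Delta>\<close>. The phase of \<open>b\<close> is that of
    \<open>- cnj \<kappa>\<close>, which makes the mixed term vanish, see
    \<open>coef\<close>.\<close>
  define a where "a = sqrt ((1 + T / \<Delta>) / 2)"
  have a2: "a\<^sup>2 = (1 + T / \<Delta>) / 2" using T0 \<Delta>0 by (simp add: a_def)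
  have a0: "0 < a" using T0 \<Delta>0 by (simp add: a_def add_pos_pos)
  define b where "b = - cnj \<kappa> / of_real (a * \<Delta>)"
  have b2: "(cmod b)\<^sup>2 = (T / \<Delta> - 1) / 2"
  proof -
    have "(cmod b)\<^sup>2 = K / (a\<^sup>2 * \<Delta>\<^sup>2)"
      unfolding b_def K_def using a0 \<Delta>0
      by (simp add: norm_divide norm_mult power_divide power_mult_distrib)
    also have "K = (T\<^sup>2 - \<Delta>\<^sup>2) / 4" using \<Delta>2 by simp
    also have "a\<^sup>2 * \<Delta>\<^sup>2 = (\<Delta> + T) * \<Delta> / 2" unfolding a2 using \<Delta>0 by (simp add: field_simps power2_eq_square)
    also have "(T\<^sup>2 - \<Delta>\<^sup>2) / 4 / ((\<Delta> + T) * \<Delta> / 2) = (T / \<Delta> - 1) / 2"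
    proof -
      have "\<Delta> + T \<noteq> 0" "\<Delta> \<noteq> 0" using T0 \<Delta>0 by auto
      then show ?thesis by (simp add: divide_simps) algebra
    qed
    finally show ?thesis .
  qed
  have det: "a\<^sup>2 - (cmod b)\<^sup>2 = 1" unfolding a2 b2 by (simp add: field_simps)
  have kb: "a * (\<kappa> * b) = - of_real (K / \<Delta>)"
    unfolding b_def K_def using a0 \<Delta>0 by (simp add: complex_norm_square[symmetric] divide_simps)
  define \<mu> where "\<mu> = a\<^sup>2 * A + (cmod b)\<^sup>2 * B - 2 * K / \<Delta>"
  define \<nu> where "\<nu> = (cmod b)\<^sup>2 * A + a\<^sup>2 * B - 2 * K / \<Delta>"
  have diff: "\<mu> - \<nu> = A - B"
  proof -
    have "\<mu> - \<nu> = (a\<^sup>2 - (cmod b)\<^sup>2) * (A - B)" by (simp add: \<mu>_def \<nu>_def algebra_simps)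
    then show ?thesis by (simp add: det)
  qed
  have sum: "\<mu> + \<nu> = \<Delta>"
  proof -
    have "\<mu> + \<nu> = (a\<^sup>2 + (cmod b)\<^sup>2) * T - 4 * K / \<Delta>" by (simp add: \<mu>_def \<nu>_def T_def algebra_simps)
    also have "a\<^sup>2 + (cmod b)\<^sup>2 = T / \<Delta>" unfolding a2 b2 by (simp add: field_simps)
    also have "T / \<Delta> * T - 4 * K / \<Delta> = \<Delta>\<^sup>2 / \<Delta>" unfolding \<Delta>2 by (simp add: power2_eq_square diff_divide_distrib)
    also have "\<dots> = \<Delta>" using \<Delta>0 by (simp add: power2_eq_square)
    finally show ?thesis .
  qed
  have prod: "\<mu> * \<nu> = A * B - K"
  proof -
    have "4 * (\<mu> * \<nu>) = (\<mu> + \<nu>)\<^sup>2 - (\<mu> - \<nu>)\<^sup>2" by algebra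
    also have "\<dots> = 4 * (A * B - K)" unfolding sum diff \<Delta>2 T_def by algebra
    finally show ?thesis by simp
  qed
  have "0 < \<mu> * \<nu>" using pos by (simp add: prod K_def)
  then have \<mu>\<nu>: "0 < \<mu>" "0 < \<nu>" using sum \<Delta>0 by (auto simp: zero_less_mult_iff)
  define h where "h = (\<lambda>(x :: complex) (y :: complex). ennreal (\<bar>(cmod x)\<^sup>2 - (cmod y)\<^sup>2\<bar> *
        exp (- (A * (cmod x)\<^sup>2 + B * (cmod y)\<^sup>2 + 2 * Re (\<kappa> * x * cnj y)))))"
  have [measurable]: "(\<lambda>(x, y). h x y) \<in> borel_measurable (borel \<Otimes>\<^sub>M borel)"
    unfolding h_def by measurable
  have coef: "of_real (a * T) * cnj b + \<kappa> * of_real (a\<^sup>2) + cnj \<kappa> * (cnj b)\<^sup>2 = 0"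
  proof -
    have cb: "of_real a * cnj b = - \<kappa> / of_real \<Delta>"
      unfolding b_def using a0 \<Delta>0 by simp
    have cb2: "cnj \<kappa> * (cnj b)\<^sup>2 = \<kappa> * of_real ((cmod b)\<^sup>2)"
    proof -
      have K: "of_real K = \<kappa> * cnj \<kappa>" unfolding K_def by (rule complex_norm_square)
      have "(cmod b)\<^sup>2 = K / (a * \<Delta>)\<^sup>2"
        unfolding b_def K_def using a0 \<Delta>0 by (simp add: norm_divide norm_mult power_divide)
      then have "of_real ((cmod b)\<^sup>2) = \<kappa> * cnj \<kappa> / (of_real (a * \<Delta>))\<^sup>2"
        by (simp only: of_real_divide K of_real_power)
      then show ?thesis by (simp add: b_def power_divide power2_eq_square)
    qed
    have "of_real (a * T) * cnj b + \<kappa> * of_real (a\<^sup>2) + cnj \<kappa> * (cnj b)\<^sup>2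
      = \<kappa> * of_real (a\<^sup>2 + (cmod b)\<^sup>2) + of_real T * (of_real a * cnj b)"
      unfolding cb2 by (simp add: algebra_simps)
    also have "a\<^sup>2 + (cmod b)\<^sup>2 = T / \<Delta>" unfolding a2 b2 by (simp add: field_simps)
    finally show ?thesis unfolding cb by simp
  qed
  have form: "A * (cmod (a * x + b * y))\<^sup>2 + B * (cmod (cnj b * x + a * y))\<^sup>2
      + 2 * Re (\<kappa> * (a * x + b * y) * cnj (cnj b * x + a * y)) = \<mu> * (cmod x)\<^sup>2 + \<nu> * (cmod y)\<^sup>2" for x y :: complex
  proof -
    have "A * (cmod (a * x + b * y))\<^sup>2 + B * (cmod (cnj b * x + a * y))\<^sup>2
      + 2 * Re (\<kappa> * (a * x + b * y) * cnj (cnj b * x + a * y))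
      = (a\<^sup>2 * A + (cmod b)\<^sup>2 * B + 2 * Re (a * (\<kappa> * b))) * (cmod x)\<^sup>2
      + ((cmod b)\<^sup>2 * A + a\<^sup>2 * B + 2 * Re (a * (\<kappa> * b))) * (cmod y)\<^sup>2
      + 2 * Re ((of_real (a * T) * cnj b + \<kappa> * of_real (a\<^sup>2) + cnj \<kappa> * (cnj b)\<^sup>2) * (x * cnj y))"
      unfolding cmod_power2 T_def by (simp add: power2_eq_square) algebra
    also have "\<dots> = \<mu> * (cmod x)\<^sup>2 + \<nu> * (cmod y)\<^sup>2"
      unfolding coef kb \<mu>_def \<nu>_def by simp
    finally show ?thesis .
  qed
  have inv: "(cmod (a * x + b * y))\<^sup>2 - (cmod (cnj b * x + a * y))\<^sup>2 = (cmod x)\<^sup>2 - (cmod y)\<^sup>2" for x y :: complex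
  proof -
    have "(cmod (a * x + b * y))\<^sup>2 - (cmod (cnj b * x + a * y))\<^sup>2
      = (a\<^sup>2 - (cmod b)\<^sup>2) * ((cmod x)\<^sup>2 - (cmod y)\<^sup>2)"
      unfolding cmod_power2 by simp algebra
    then show ?thesis by (simp add: det)
  qed
  have "(\<integral>\<^sup>+x. \<integral>\<^sup>+y. h x y \<partial>lborel \<partial>lborel)
     = (\<integral>\<^sup>+(x :: complex). \<integral>\<^sup>+(y :: complex). h (a * x + b * y) (cnj b * x + a * y) \<partial>lborel \<partial>lborel)"
  proof (cases "b = 0")
    case True
    then have "a = 1" using det a0 by (simp add: power2_eq_1_iff)
    then show ?thesis using True by simp
  next
    case False
    have "of_real a * of_real a - b * cnj b = (of_real (a\<^sup>2 - (cmod b)\<^sup>2) :: complex)"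
      by (simp add: complex_norm_square[symmetric] power2_eq_square)
    then have "of_real a * of_real a - b * cnj b = (1 :: complex)" by (simp only: det of_real_1)
    then show ?thesis using False by (intro nn_integral_SL2[symmetric]) auto
  qed
  also have "\<dots> = (\<integral>\<^sup>+x. \<integral>\<^sup>+y. ennreal (\<bar>(cmod x)\<^sup>2 - (cmod y)\<^sup>2\<bar> * exp (- (\<mu> * (cmod x)\<^sup>2 + \<nu> * (cmod y)\<^sup>2))) \<partial>lborel \<partial>lborel)"
    unfolding h_def form inv ..
  also have "\<dots> = ennreal (pi\<^sup>2 * ((\<mu>\<^sup>2 + \<nu>\<^sup>2) / ((\<mu> * \<nu>)\<^sup>2 * (\<mu> + \<nu>))))"
    by (rule nn_integral_diagonal_form[OF \<mu>\<nu>])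
  finally show ?thesis
    using \<mu>\<nu> diff prod unfolding h_def K_def by blast
qed

text \<open>The expectation of \<open>||U|\<^sup>2 - |V|\<^sup>2|\<close> for a centered complex Gaussian pair whose variances differ
  by \<open>\<delta>\<close> and whose covariance matrix has determinant \<open>D\<close>.\<close>

definition signed_mean :: "real \<Rightarrow> real \<Rightarrow> real" where
  "signed_mean \<delta> D = (\<delta>\<^sup>2 + 2 * D) / sqrt (\<delta>\<^sup>2 + 4 * D)"

text \<open>Here \<open>\<mu>\<close> and \<open>\<nu>\<close> are coefficients in the exponent, so
  the variances are \<open>1 / \<mu>\<close> and \<open>1 / \<nu>\<close>; the arguments of
  \<open>signed_mean\<close> are their difference and their product.\<close>

lemma signed_mean_eq:
  fixes \<mu> \<nu> :: real
  assumes "0 < \<mu>" "0 < \<nu>"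
  shows "signed_mean ((\<nu> - \<mu>) / (\<mu> * \<nu>)) (1 / (\<mu> * \<nu>)) = (\<mu>\<^sup>2 + \<nu>\<^sup>2) / (\<mu> * \<nu> * (\<mu> + \<nu>))"
proof -
  have nz: "\<mu> \<noteq> 0" "\<nu> \<noteq> 0" "\<mu> + \<nu> \<noteq> 0" using assms by auto
  have "((\<nu> - \<mu>) / (\<mu> * \<nu>))\<^sup>2 + 4 * (1 / (\<mu> * \<nu>)) = ((\<mu> + \<nu>) / (\<mu> * \<nu>))\<^sup>2"
    using nz by (simp add: divide_simps) algebra
  then have s: "sqrt (((\<nu> - \<mu>) / (\<mu> * \<nu>))\<^sup>2 + 4 * (1 / (\<mu> * \<nu>))) = (\<mu> + \<nu>) / (\<mu> * \<nu>)"
    using assms by simp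
  have "((\<nu> - \<mu>) / (\<mu> * \<nu>))\<^sup>2 + 2 * (1 / (\<mu> * \<nu>)) = (\<mu>\<^sup>2 + \<nu>\<^sup>2) / (\<mu> * \<nu>)\<^sup>2"
    using nz by (simp add: divide_simps) algebra
  moreover have "N / P\<^sup>2 / (\<sigma> / P) = N / (P * \<sigma>)" for N P \<sigma> :: real
    by (simp add: power2_eq_square)
  ultimately show ?thesis
    unfolding signed_mean_def s by (simp only:)
qed

text \<open>The remainder \<open>w\<close> enters only the exponent, so it is integrated out first.
  What is left is a Hermitian form in \<open>x\<close> and \<open>y\<close>, with the Gaussian
  normalisation and the factor \<open>1 / W\<close> in front.\<close>

lemma nn_integral_gauss_w:
  fixes r1 r2 s :: real and t1 t2 :: complex
  defines "W \<equiv> 1 + s\<^sup>2"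
  shows "(\<integral>\<^sup>+(x :: complex). \<integral>\<^sup>+(y :: complex). \<integral>\<^sup>+w. ennreal (\<bar>(cmod (r1 * x))\<^sup>2 - (cmod (r2 * y))\<^sup>2\<bar> *
        exp (- (cmod (t1 * x + t2 * y + s * w))\<^sup>2)) \<partial>gauss \<partial>gauss \<partial>gauss)
    = (\<integral>\<^sup>+(x :: complex). \<integral>\<^sup>+(y :: complex). ennreal (1 / (pi\<^sup>2 * W)) * ennreal (\<bar>(cmod (r1 * x))\<^sup>2 - (cmod (r2 * y))\<^sup>2\<bar> *
        exp (- ((cmod x)\<^sup>2 + (cmod y)\<^sup>2 + (cmod (t1 * x + t2 * y))\<^sup>2 / W))) \<partial>lborel \<partial>lborel)"
proof -
  have W: "0 < W" by (simp add: W_def add_pos_nonneg)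
  have "(\<integral>\<^sup>+(x :: complex). \<integral>\<^sup>+(y :: complex). \<integral>\<^sup>+w. ennreal (\<bar>(cmod (r1 * x))\<^sup>2 - (cmod (r2 * y))\<^sup>2\<bar> *
        exp (- (cmod (t1 * x + t2 * y + s * w))\<^sup>2)) \<partial>gauss \<partial>gauss \<partial>gauss)
    = (\<integral>\<^sup>+(x :: complex). \<integral>\<^sup>+(y :: complex). ennreal (\<bar>(cmod (r1 * x))\<^sup>2 - (cmod (r2 * y))\<^sup>2\<bar>) *
        (\<integral>\<^sup>+w. ennreal (exp (- (cmod (t1 * x + t2 * y + s * w))\<^sup>2)) \<partial>gauss) \<partial>gauss \<partial>gauss)"
    by (subst nn_integral_cmult[symmetric]) (auto simp: ennreal_mult)
  also have "\<dots> = (\<integral>\<^sup>+(x :: complex). \<integral>\<^sup>+(y :: complex). ennreal (\<bar>(cmod (r1 * x))\<^sup>2 - (cmod (r2 * y))\<^sup>2\<bar>) *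
        ennreal (exp (- (cmod (t1 * x + t2 * y))\<^sup>2 / W) / W) \<partial>gauss \<partial>gauss)"
    unfolding W_def nn_integral_gauss_exp_quadratic ..
  also have "\<dots> = (\<integral>\<^sup>+(x :: complex). \<integral>\<^sup>+(y :: complex). ennreal (exp (- ((cmod x)\<^sup>2 + (cmod y)\<^sup>2)) / pi\<^sup>2) *
      (ennreal (\<bar>(cmod (r1 * x))\<^sup>2 - (cmod (r2 * y))\<^sup>2\<bar>) *
        ennreal (exp (- (cmod (t1 * x + t2 * y))\<^sup>2 / W) / W)) \<partial>lborel \<partial>lborel)"
    by (rule nn_integral_gauss2) measurable
  also have "\<dots> = (\<integral>\<^sup>+(x :: complex). \<integral>\<^sup>+(y :: complex). ennreal (1 / (pi\<^sup>2 * W)) * ennreal (\<bar>(cmod (r1 * x))\<^sup>2 - (cmod (r2 * y))\<^sup>2\<bar> *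
        exp (- ((cmod x)\<^sup>2 + (cmod y)\<^sup>2 + (cmod (t1 * x + t2 * y))\<^sup>2 / W))) \<partial>lborel \<partial>lborel)"
  proof (intro nn_integral_cong)
    fix x y :: complex
    have "exp (- ((cmod x)\<^sup>2 + (cmod y)\<^sup>2 + (cmod (t1 * x + t2 * y))\<^sup>2 / W))
      = exp (- ((cmod x)\<^sup>2 + (cmod y)\<^sup>2)) * exp (- (cmod (t1 * x + t2 * y))\<^sup>2 / W)"
      by (simp add: exp_add[symmetric])
    then show "ennreal (exp (- ((cmod x)\<^sup>2 + (cmod y)\<^sup>2)) / pi\<^sup>2) *
      (ennreal (\<bar>(cmod (r1 * x))\<^sup>2 - (cmod (r2 * y))\<^sup>2\<bar>) *
        ennreal (exp (- (cmod (t1 * x + t2 * y))\<^sup>2 / W) / W))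
      = ennreal (1 / (pi\<^sup>2 * W)) * ennreal (\<bar>(cmod (r1 * x))\<^sup>2 - (cmod (r2 * y))\<^sup>2\<bar> *
        exp (- ((cmod x)\<^sup>2 + (cmod y)\<^sup>2 + (cmod (t1 * x + t2 * y))\<^sup>2 / W)))"
      using W by (simp only: ennreal_mult[symmetric] zero_le_mult_iff abs_ge_zero exp_ge_zero
          zero_le_divide_iff zero_le_power2 less_imp_le simp_thms pi_ge_zero zero_le_one) (simp add: mult_ac)
  qed
  finally show ?thesis .
qed

lemma nn_integral_lborel_scale':
  fixes c :: real
  assumes c: "0 < c" and f: "f \<in> borel_measurable (borel :: complex measure)"
  shows "(\<integral>\<^sup>+z. f (of_real c * z) \<partial>lborel) = ennreal (1 / c\<^sup>2) * (\<integral>\<^sup>+z. f z \<partial>lborel)"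
  using c by (subst nn_integral_lborel_scale[OF _ f, of c])
    (auto simp: scaleR_conv_of_real mult.assoc[symmetric] ennreal_mult[symmetric])

text \<open>Once the unit variance of \<open>a 0\<close> is included, \<open>S\<close> is the
  variance of \<open>H(z)\<close>, and \<open>1 / S\<close> is, up to \<open>pi\<close>, its density
  at 0. The arguments of \<open>signed_mean\<close> are the variance difference and the covariance
  determinant conditioned on \<open>H(z) = 0\<close>. The proof passes to the variables
  \<open>r1 * x\<close> and \<open>r2 * y\<close>, for which both scales must be positive.\<close>

lemma gauss_formula_pos:
  fixes r1 r2 s :: real and t1 t2 :: complex
  defines "W \<equiv> 1 + s\<^sup>2"
  defines "S \<equiv> W + (cmod t1)\<^sup>2 + (cmod t2)\<^sup>2"
  assumes r1: "0 < r1" and r2: "0 < r2"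
  shows "(\<integral>\<^sup>+(x :: complex). \<integral>\<^sup>+(y :: complex). \<integral>\<^sup>+w. ennreal (\<bar>(cmod (r1 * x))\<^sup>2 - (cmod (r2 * y))\<^sup>2\<bar> *
        exp (- (cmod (t1 * x + t2 * y + s * w))\<^sup>2)) \<partial>gauss \<partial>gauss \<partial>gauss)
    = ennreal (signed_mean ((r1\<^sup>2 * (W + (cmod t2)\<^sup>2) - r2\<^sup>2 * (W + (cmod t1)\<^sup>2)) / S) (W * r1\<^sup>2 * r2\<^sup>2 / S) / S)"
proof -
  have W: "0 < W" by (simp add: W_def add_pos_nonneg)
  then have S: "0 < S" by (simp add: S_def add_pos_nonneg)
  define T1 T2 where "T1 = (cmod t1)\<^sup>2" and "T2 = (cmod t2)\<^sup>2"
  have T: "0 \<le> T1" "0 \<le> T2" by (simp_all add: T1_def T2_def)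
  define A where "A = (W + T1) / (W * r1\<^sup>2)"
  define B where "B = (W + T2) / (W * r2\<^sup>2)"
  define \<kappa> where "\<kappa> = t1 * cnj t2 / of_real (W * r1 * r2)"
  have \<kappa>2: "(cmod \<kappa>)\<^sup>2 = T1 * T2 / (W\<^sup>2 * r1\<^sup>2 * r2\<^sup>2)"
    using W r1 r2 by (simp add: \<kappa>_def T1_def T2_def norm_divide norm_mult power_divide power_mult_distrib)
  have AB: "0 < A" "0 < B" using W T r1 r2 by (simp_all add: A_def B_def add_pos_nonneg)
  have det: "A * B - (cmod \<kappa>)\<^sup>2 = S / (W * r1\<^sup>2 * r2\<^sup>2)"
  proof -
    have "W \<noteq> 0" "r1 \<noteq> 0" "r2 \<noteq> 0" using W r1 r2 by auto
    then show ?thesis unfolding \<kappa>2 A_def B_def S_def T1_def[symmetric] T2_def[symmetric]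
      by (simp add: divide_simps) algebra
  qed
  have "0 < A * B - (cmod \<kappa>)\<^sup>2" unfolding det using W S r1 r2 by simp
  then have "(cmod \<kappa>)\<^sup>2 < A * B" by simp
  from nn_integral_hermitian_form[OF AB this] obtain \<mu> \<nu> where \<mu>\<nu>: "0 < \<mu>" "0 < \<nu>"
    and diff: "\<mu> - \<nu> = A - B" and prod: "\<mu> * \<nu> = A * B - (cmod \<kappa>)\<^sup>2"
    and int: "(\<integral>\<^sup>+(x :: complex). \<integral>\<^sup>+(y :: complex). ennreal (\<bar>(cmod x)\<^sup>2 - (cmod y)\<^sup>2\<bar> *
        exp (- (A * (cmod x)\<^sup>2 + B * (cmod y)\<^sup>2 + 2 * Re (\<kappa> * x * cnj y)))) \<partial>lborel \<partial>lborel)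
    = ennreal (pi\<^sup>2 * ((\<mu>\<^sup>2 + \<nu>\<^sup>2) / ((\<mu> * \<nu>)\<^sup>2 * (\<mu> + \<nu>))))" by blast
  define h where "h = (\<lambda>(x :: complex) (y :: complex). ennreal (\<bar>(cmod x)\<^sup>2 - (cmod y)\<^sup>2\<bar> *
        exp (- (A * (cmod x)\<^sup>2 + B * (cmod y)\<^sup>2 + 2 * Re (\<kappa> * x * cnj y)))))"
  have [measurable]: "(\<lambda>(x, y). h x y) \<in> borel_measurable (borel \<Otimes>\<^sub>M borel)"
    unfolding h_def by measurable
  have form: "(cmod x)\<^sup>2 + (cmod y)\<^sup>2 + (cmod (t1 * x + t2 * y))\<^sup>2 / W
      = A * (cmod (r1 * x))\<^sup>2 + B * (cmod (r2 * y))\<^sup>2 + 2 * Re (\<kappa> * (r1 * x) * cnj (r2 * y))" for x y :: complex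
  proof -
    have a: "A * (cmod (r1 * x))\<^sup>2 = (W + T1) / W * (cmod x)\<^sup>2"
      using r1 by (simp add: A_def norm_mult power_mult_distrib)
    have b: "B * (cmod (r2 * y))\<^sup>2 = (W + T2) / W * (cmod y)\<^sup>2"
      using r2 by (simp add: B_def norm_mult power_mult_distrib)
    have c: "\<kappa> * (r1 * x) * cnj (r2 * y) = (t1 * x * cnj (t2 * y)) / of_real W"
      using r1 r2 W by (simp add: \<kappa>_def field_simps)
    have d: "(cmod (t1 * x + t2 * y))\<^sup>2 = T1 * (cmod x)\<^sup>2 + T2 * (cmod y)\<^sup>2 + 2 * Re (t1 * x * cnj (t2 * y))"
      unfolding T1_def T2_def cmod_power2 by simp algebra
    have e: "Re (q / of_real W) = Re q / W" for q by (simp add: Re_divide_of_real)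
    show ?thesis unfolding a b c d e using W by (simp add: field_simps)
  qed
  have "(\<integral>\<^sup>+(x :: complex). \<integral>\<^sup>+(y :: complex). \<integral>\<^sup>+w. ennreal (\<bar>(cmod (r1 * x))\<^sup>2 - (cmod (r2 * y))\<^sup>2\<bar> *
        exp (- (cmod (t1 * x + t2 * y + s * w))\<^sup>2)) \<partial>gauss \<partial>gauss \<partial>gauss)
    = (\<integral>\<^sup>+(x :: complex). \<integral>\<^sup>+(y :: complex). ennreal (1 / (pi\<^sup>2 * W)) * h (r1 * x) (r2 * y) \<partial>lborel \<partial>lborel)"
    unfolding nn_integral_gauss_w h_def W_def[symmetric] form ..
  also have "\<dots> = (\<integral>\<^sup>+(x :: complex). ennreal (1 / (pi\<^sup>2 * W)) * (\<integral>\<^sup>+(y :: complex). h (r1 * x) (r2 * y) \<partial>lborel) \<partial>lborel)"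
    by (intro nn_integral_cong nn_integral_cmult) measurable
  also have "\<dots> = (\<integral>\<^sup>+(x :: complex). ennreal (1 / (pi\<^sup>2 * W)) * (ennreal (1 / r2\<^sup>2) * (\<integral>\<^sup>+(y :: complex). h (r1 * x) y \<partial>lborel)) \<partial>lborel)"
    by (subst nn_integral_lborel_scale'[OF r2, where f = "h _"]) auto
  also have "\<dots> = ennreal (1 / (pi\<^sup>2 * W)) * (ennreal (1 / r2\<^sup>2) * (\<integral>\<^sup>+(x :: complex). (\<integral>\<^sup>+(y :: complex). h (r1 * x) y \<partial>lborel) \<partial>lborel))"
    by (simp add: nn_integral_cmult)
  also have "\<dots> = ennreal (1 / (pi\<^sup>2 * W)) * (ennreal (1 / r2\<^sup>2) * (ennreal (1 / r1\<^sup>2) * (\<integral>\<^sup>+(x :: complex). (\<integral>\<^sup>+(y :: complex). h x y \<partial>lborel) \<partial>lborel)))"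
    by (subst nn_integral_lborel_scale'[OF r1, where f = "\<lambda>x. \<integral>\<^sup>+y. h x y \<partial>lborel"]) auto
  also have "\<dots> = ennreal (1 / (pi\<^sup>2 * W) * (1 / r2\<^sup>2 * (1 / r1\<^sup>2 * (pi\<^sup>2 * ((\<mu>\<^sup>2 + \<nu>\<^sup>2) / ((\<mu> * \<nu>)\<^sup>2 * (\<mu> + \<nu>)))))))"
    unfolding h_def int using W \<mu>\<nu> by (simp add: ennreal_mult[symmetric])
  also have "1 / (pi\<^sup>2 * W) * (1 / r2\<^sup>2 * (1 / r1\<^sup>2 * (pi\<^sup>2 * ((\<mu>\<^sup>2 + \<nu>\<^sup>2) / ((\<mu> * \<nu>)\<^sup>2 * (\<mu> + \<nu>))))))
      = 1 / (W * r1\<^sup>2 * r2\<^sup>2) * (1 / (\<mu> * \<nu>)) * ((\<mu>\<^sup>2 + \<nu>\<^sup>2) / (\<mu> * \<nu> * (\<mu> + \<nu>)))"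
    by (simp add: power2_eq_square)
  also have "1 / (W * r1\<^sup>2 * r2\<^sup>2) * (1 / (\<mu> * \<nu>)) = 1 / S"
    unfolding prod det using W r1 r2 by simp
  also have "(\<mu>\<^sup>2 + \<nu>\<^sup>2) / (\<mu> * \<nu> * (\<mu> + \<nu>)) = signed_mean ((\<nu> - \<mu>) / (\<mu> * \<nu>)) (1 / (\<mu> * \<nu>))"
    by (rule signed_mean_eq[OF \<mu>\<nu>, symmetric])
  also have "1 / (\<mu> * \<nu>) = W * r1\<^sup>2 * r2\<^sup>2 / S"
    unfolding prod det by simp
  also have "(\<nu> - \<mu>) / (\<mu> * \<nu>) = (r1\<^sup>2 * (W + (cmod t2)\<^sup>2) - r2\<^sup>2 * (W + (cmod t1)\<^sup>2)) / S"
  proof -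
    have e: "\<nu> - \<mu> = (W + T2) / (W * r2\<^sup>2) - (W + T1) / (W * r1\<^sup>2)"
      using diff by (simp add: A_def B_def)
    have "W \<noteq> 0" "r1 \<noteq> 0" "r2 \<noteq> 0" "S \<noteq> 0" using W r1 r2 S by auto
    then show ?thesis unfolding prod det e T1_def[symmetric] T2_def[symmetric]
      by (simp add: divide_simps)
  qed
  finally show ?thesis by simp
qed

text \<open>The case \<open>r2 = 0\<close>, which occurs for \<open>m = 0\<close>. The rescaling of
  \<open>y\<close> breaks down, but the integrand is free of \<open>y\<close>, and a single radial
  integral remains.\<close>

lemma gauss_formula_zero:
  fixes r1 s :: real and t1 :: complex
  defines "W \<equiv> 1 + s\<^sup>2"
  defines "S \<equiv> W + (cmod t1)\<^sup>2"
  assumes r1: "0 < r1"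
  shows "(\<integral>\<^sup>+x. \<integral>\<^sup>+(y :: complex). \<integral>\<^sup>+w. ennreal (\<bar>(cmod (r1 * x))\<^sup>2\<bar> *
        exp (- (cmod (t1 * x + s * w))\<^sup>2)) \<partial>gauss \<partial>gauss \<partial>gauss)
    = ennreal (signed_mean (r1\<^sup>2 * W / S) 0 / S)"
proof -
  have W: "0 < W" by (simp add: W_def add_pos_nonneg)
  then have S: "0 < S" by (simp add: S_def add_pos_nonneg)
  have k: "0 < S / W" using W S by simp
  have "(\<integral>\<^sup>+x. \<integral>\<^sup>+(y :: complex). \<integral>\<^sup>+w. ennreal (\<bar>(cmod (r1 * x))\<^sup>2\<bar> *
        exp (- (cmod (t1 * x + s * w))\<^sup>2)) \<partial>gauss \<partial>gauss \<partial>gauss)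
     = (\<integral>\<^sup>+x. \<integral>\<^sup>+w. ennreal ((cmod (r1 * x))\<^sup>2) *
        ennreal (exp (- (cmod (t1 * x + s * w))\<^sup>2)) \<partial>gauss \<partial>gauss)"
    by (simp add: gauss.emeasure_space_1[simplified] ennreal_mult)
  also have "\<dots> = (\<integral>\<^sup>+x. ennreal ((cmod (r1 * x))\<^sup>2) * ennreal (exp (- (cmod (t1 * x))\<^sup>2 / W) / W) \<partial>gauss)"
    by (simp only: W_def nn_integral_gauss_exp_quadratic[symmetric])
       (intro nn_integral_cong nn_integral_cmult, measurable)
  also have "\<dots> = (\<integral>\<^sup>+x. ennreal (r1\<^sup>2 / (pi * W) * ((cmod x)\<^sup>2 * exp (- (S / W) * (cmod x)\<^sup>2))) \<partial>lborel)"
  proof (subst nn_integral_gauss, measurable, intro nn_integral_cong)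
    fix x :: complex
    have "- (S / W) * (cmod x)\<^sup>2 = - (cmod x)\<^sup>2 + - (cmod (t1 * x))\<^sup>2 / W"
      using W by (simp add: S_def field_simps norm_mult power_mult_distrib)
    then have "exp (- (S / W) * (cmod x)\<^sup>2) = exp (- (cmod x)\<^sup>2) * exp (- (cmod (t1 * x))\<^sup>2 / W)"
      by (simp only: exp_add)
    then show "ennreal (exp (- (cmod x)\<^sup>2) / pi) * (ennreal ((cmod (r1 * x))\<^sup>2) * ennreal (exp (- (cmod (t1 * x))\<^sup>2 / W) / W))
        = ennreal (r1\<^sup>2 / (pi * W) * ((cmod x)\<^sup>2 * exp (- (S / W) * (cmod x)\<^sup>2)))"
      using W by (simp add: ennreal_mult[symmetric] norm_mult power_mult_distrib mult_ac)
  qed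
  also have "\<dots> = ennreal pi * (\<integral>\<^sup>+x\<in>{0..}. ennreal (r1\<^sup>2 / (pi * W) * (x * exp (- (S / W) * x))) \<partial>lborel)"
    by (subst nn_integral_lborel_radial[where f = "\<lambda>x. ennreal (r1\<^sup>2 / (pi * W) * (x * exp (- (S / W) * x)))"]) auto
  also have "(\<integral>\<^sup>+x\<in>{0..}. ennreal (r1\<^sup>2 / (pi * W) * (x * exp (- (S / W) * x))) \<partial>lborel)
      = ennreal (0 - r1\<^sup>2 / (pi * W) * (- (0 / (S / W) + 1 / (S / W)\<^sup>2) * exp (- (S / W) * 0)))"
  proof (rule nn_integral_FTC_atLeast)
    define k where "k = S / W"
    have k0: "0 < k" using k by (simp add: k_def)
    have "((\<lambda>x. - (x / k + 1 / k\<^sup>2) * exp (- k * x)) \<longlongrightarrow> 0) at_top" using k0 by real_asymp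
    then show "((\<lambda>x. r1\<^sup>2 / (pi * W) * (- (x / (S / W) + 1 / (S / W)\<^sup>2) * exp (- (S / W) * x))) \<longlongrightarrow> 0) at_top"
      unfolding k_def by (rule tendsto_mult_right_zero)
    fix x :: real
    have "((\<lambda>x. - (x / k + 1 / k\<^sup>2) * exp (- k * x)) has_real_derivative x * exp (- k * x)) (at x)"
      using k0 by (auto intro!: derivative_eq_intros simp: field_simps power2_eq_square)
    then show "((\<lambda>x. r1\<^sup>2 / (pi * W) * (- (x / (S / W) + 1 / (S / W)\<^sup>2) * exp (- (S / W) * x)))
        has_real_derivative r1\<^sup>2 / (pi * W) * (x * exp (- (S / W) * x))) (at x)"
      unfolding k_def by (rule DERIV_cmult)
    show "0 \<le> x \<Longrightarrow> 0 \<le> r1\<^sup>2 / (pi * W) * (x * exp (- (S / W) * x))"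
      using W by simp
  qed measurable
  also have "ennreal pi * ennreal (0 - r1\<^sup>2 / (pi * W) * (- (0 / (S / W) + 1 / (S / W)\<^sup>2) * exp (- (S / W) * 0)))
      = ennreal (r1\<^sup>2 * W / S / S)"
    using W S r1 by (simp add: ennreal_mult[symmetric] power_divide power2_eq_square)
  also have "r1\<^sup>2 * W / S = signed_mean (r1\<^sup>2 * W / S) 0"
  proof -
    have "signed_mean a 0 = a" if "0 < a" for a
      using that by (simp add: signed_mean_def power2_eq_square)
    then show ?thesis using W S r1 by simp
  qed
  finally show ?thesis .
qed

section \<open>The area formula\<close>

text \<open>A change of variables for absolutely integrable functions becomes an identity of
  nonnegative integrals, because \<open>\<phi>\<close> is integrable and has a sign; both sides are
  then finite.\<close>

lemma change_of_variables_inj: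
  fixes g :: "real^'n::{finite,wellorder} \<Rightarrow> real^'n::_" and \<phi> :: "real^'n::_ \<Rightarrow> real"
  assumes S: "S \<in> sets lebesgue"
    and der: "\<And>x. (g has_derivative g' x) (at x)"
    and inj: "inj_on g S"
    and \<phi>: "integrable lborel \<phi>" and nonneg: "\<And>x. 0 \<le> \<phi> x"
  shows "g ` S \<in> sets lebesgue"
    and "(\<integral>\<^sup>+w. indicator (g ` S) w * ennreal (\<phi> w) \<partial>lebesgue)
      = (\<integral>\<^sup>+x. indicator S x * ennreal (\<bar>det (matrix (g' x))\<bar> * \<phi> (g x)) \<partial>lebesgue)"
proof -
  have derS: "\<And>x. x \<in> S \<Longrightarrow> (g has_derivative g' x) (at x within S)"
    using der by (blast intro: has_derivative_at_withinI)
  show im: "g ` S \<in> sets lebesgue"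
    by (rule differentiable_image_in_sets_lebesgue[OF S])
       (use derS in \<open>auto simp: differentiable_on_def differentiable_def\<close>)
  have \<phi>L: "integrable lebesgue \<phi>"
    using \<phi> by (simp add: integrable_completion)
  have i1: "\<phi> absolutely_integrable_on (g ` S)"
    unfolding set_integrable_def using \<phi>L im by (rule integrable_mult_indicator[rotated])
  \<comment> \<open>\<open>has_absolute_integral_change_of_variables\<close> takes a vector-valued
    integrand; \<open>f\<close> is \<open>\<phi>\<close> as a vector with one component.\<close>
  define f :: "real^'n::_ \<Rightarrow> real^1" where "f = (\<lambda>x. vec (\<phi> x))"
  have "f absolutely_integrable_on (g ` S)"
    using i1 by (simp add: f_def absolutely_integrable_on_1_iff)
  then have "(\<lambda>x. \<bar>det (matrix (g' x))\<bar> *\<^sub>R f (g x)) absolutely_integrable_on S \<and>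
      integral S (\<lambda>x. \<bar>det (matrix (g' x))\<bar> *\<^sub>R f (g x)) = integral (g ` S) f"
    using has_absolute_integral_change_of_variables[OF S derS inj, of f "integral (g ` S) f"] by simp
  then have i2: "(\<lambda>x. \<bar>det (matrix (g' x))\<bar> * \<phi> (g x)) absolutely_integrable_on S"
    and eq: "integral S (\<lambda>x. \<bar>det (matrix (g' x))\<bar> * \<phi> (g x)) = integral (g ` S) \<phi>"
    by (auto simp: f_def absolutely_integrable_on_1_iff integral_on_1_eq vec_eq_iff)
  have nn: "(\<integral>\<^sup>+x. indicator T x * ennreal (h x) \<partial>lebesgue) = ennreal (integral T h)"
    if "h absolutely_integrable_on T" "\<And>x. 0 \<le> h x" for T and h :: "real^'n::_ \<Rightarrow> real"
  proof -
    have "(\<integral>\<^sup>+x. indicator T x * ennreal (h x) \<partial>lebesgue) = (\<integral>\<^sup>+x. ennreal (indicator T x *\<^sub>R h x) \<partial>lebesgue)"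
      by (intro nn_integral_cong) (auto split: split_indicator)
    also have "\<dots> = ennreal (LINT x|lebesgue. indicator T x *\<^sub>R h x)"
      using that by (intro nn_integral_eq_integral) (auto simp: set_integrable_def)
    also have "\<dots> = ennreal (integral T h)"
      using set_lebesgue_integral_eq_integral(2)[OF that(1)] by (simp add: set_lebesgue_integral_def)
    finally show ?thesis .
  qed
  show "(\<integral>\<^sup>+w. indicator (g ` S) w * ennreal (\<phi> w) \<partial>lebesgue)
      = (\<integral>\<^sup>+x. indicator S x * ennreal (\<bar>det (matrix (g' x))\<bar> * \<phi> (g x)) \<partial>lebesgue)"
    by (simp add: nn[OF i1 nonneg] nn[OF i2] nonneg eq)
qed

text \<open>By the inverse function theorem every regular point has a ball on which \<open>g\<close>
  is injective. Lindelof reduces these to countably many, and making them disjoint lets every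
  regular point be counted once.\<close>

lemma locally_injective_cover:
  fixes g :: "real^'n::{finite,wellorder} \<Rightarrow> real^'n::_"
  assumes der: "\<And>x. (g has_derivative g' x) (at x)"
    and cont: "\<And>x e. 0 < e \<Longrightarrow> \<exists>d>0. \<forall>y. dist x y < d \<longrightarrow> onorm (\<lambda>v. g' y v - g' x v) < e"
    and detc: "continuous_on UNIV (\<lambda>x. det (matrix (g' x)))"
  obtains P :: "nat \<Rightarrow> (real^'n::_) set" where "\<And>i. P i \<in> sets borel" "disjoint_family P"
    "(\<Union>i. P i) = {x. det (matrix (g' x)) \<noteq> 0}" "\<And>i. inj_on g (P i)"
proof -
  define \<Omega> where "\<Omega> = {x. det (matrix (g' x)) \<noteq> 0}"
  have "open \<Omega>"
  proof -
    have e: "\<Omega> = (\<lambda>x. det (matrix (g' x))) -` (- {0})" by (auto simp: \<Omega>_def)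
    show ?thesis unfolding e by (intro open_vimage detc) auto
  qed
  define \<F> where "\<F> = insert {} {U. open U \<and> U \<subseteq> \<Omega> \<and> inj_on g U}"
  have "\<Union>\<F> = \<Omega>"
  proof
    show "\<Omega> \<subseteq> \<Union>\<F>"
    proof
      fix a assume a: "a \<in> \<Omega>"
      have lin: "linear (g' a)" using der[of a] has_derivative_linear by blast
      then have "inj (g' a)" using a by (simp add: \<Omega>_def det_nz_iff_inj)
      then obtain k where k: "linear k" "k \<circ> g' a = id"
        using linear_injective_left_inverse[OF lin] by blast
      obtain r where "r > 0" "ball a r \<subseteq> \<Omega>" "inj_on g (ball a r)"
        using has_derivative_locally_injective[where f=g and f'=g' and S=\<Omega> and g'=k, OF a \<open>open \<Omega>\<close> _ k(2) der cont]
          k(1) linear_conv_bounded_linear by blast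
      then show "a \<in> \<Union>\<F>" by (auto simp: \<F>_def intro!: exI[of _ "ball a r"])
    qed
  qed (auto simp: \<F>_def)
  moreover have "\<And>U. U \<in> \<F> \<Longrightarrow> open U" by (auto simp: \<F>_def)
  ultimately obtain \<F>' where F': "\<F>' \<subseteq> \<F>" "countable \<F>'" "\<Union>\<F>' = \<Omega>"
    using Lindelof[of \<F>] by metis
  \<comment> \<open>The empty set keeps the enumerated family nonempty even if there is no regular
    point.\<close>
  define U where "U = from_nat_into (insert {} \<F>')"
  have U: "range U = insert {} \<F>'" unfolding U_def using F'(2) by (intro range_from_nat_into) auto
  have UF: "U i \<in> \<F>" for i using U F'(1) by (auto simp: \<F>_def)
  show ?thesis
  proof (rule that[of "disjointed U"])
    have "U i \<in> sets borel" for i using UF[of i] by (auto simp: \<F>_def)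
    then have "range (disjointed U) \<subseteq> sets borel" by (intro sets.range_disjointed_sets) auto
    then show "disjointed U i \<in> sets borel" for i by auto
    show "disjoint_family (disjointed U)" by (rule disjoint_family_disjointed)
    have "(\<Union>i. U i) = \<Union>\<F>'" unfolding U by auto
    then show "(\<Union>i. disjointed U i) = {x. det (matrix (g' x)) \<noteq> 0}"
      by (simp add: UN_disjointed_eq F' \<Omega>_def)
    show "inj_on g (disjointed U i)" for i
      using UF[of i] disjointed_subset[of U i] by (auto simp: \<F>_def intro: inj_on_subset)
  qed
qed

text \<open>Critical values form a null set by Sard, and critical points contribute nothing on the
  right because the determinant vanishes there. Off the critical values, the number of preimages of
  \<open>w\<close> is the number of pieces whose image contains \<open>w\<close>.\<close>

lemma area_formula_vec:
  fixes g :: "real^'n::{finite,wellorder} \<Rightarrow> real^'n::_" and \<phi> :: "real^'n::_ \<Rightarrow> real"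
  assumes der: "\<And>x. (g has_derivative g' x) (at x)"
    and cont: "\<And>x e. 0 < e \<Longrightarrow> \<exists>d>0. \<forall>y. dist x y < d \<longrightarrow> onorm (\<lambda>v. g' y v - g' x v) < e"
    and detc: "continuous_on UNIV (\<lambda>x. det (matrix (g' x)))"
    and \<phi>: "integrable lborel \<phi>" and nonneg: "\<And>x. 0 \<le> \<phi> x"
    and N [measurable]: "(\<lambda>w. emeasure (count_space UNIV) {x. g x = w}) \<in> borel_measurable borel"
  shows "(\<integral>\<^sup>+w. emeasure (count_space UNIV) {x. g x = w} * ennreal (\<phi> w) \<partial>lborel)
      = (\<integral>\<^sup>+x. ennreal (\<bar>det (matrix (g' x))\<bar> * \<phi> (g x)) \<partial>lborel)"
proof -
  obtain P :: "nat \<Rightarrow> (real^'n::_) set" where P: "\<And>i. P i \<in> sets borel" "disjoint_family P"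
    "(\<Union>i. P i) = {x. det (matrix (g' x)) \<noteq> 0}" "\<And>i. inj_on g (P i)"
    using locally_injective_cover[OF der cont detc] by metis
  have [measurable]: "\<phi> \<in> borel_measurable borel" using \<phi> by auto
  have [measurable]: "(\<lambda>x. det (matrix (g' x))) \<in> borel_measurable borel"
    using detc by (rule borel_measurable_continuous_onI)
  have "continuous_on UNIV g"
    using der by (meson continuous_at_imp_continuous_on has_derivative_continuous)
  then have [measurable]: "g \<in> borel_measurable borel" by (rule borel_measurable_continuous_onI)
  have PL: "P i \<in> sets lebesgue" for i using P(1) by (simp add: sets_completionI_sets)
  define Z where "Z = g ` {x. det (matrix (g' x)) = 0}"
  have "negligible Z"
    unfolding Z_def
  proof (rule baby_Sard)
    fix x assume "x \<in> {x. det (matrix (g' x)) = 0}"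
    then show "rank (matrix (g' x)) < CARD('n)" by (simp add: det_eq_0_rank)
    show "(g has_derivative g' x) (at x within {x. det (matrix (g' x)) = 0})"
      using der by (blast intro: has_derivative_at_withinI)
  qed simp
  then have "Z \<in> null_sets lebesgue" by (simp add: negligible_iff_null_sets)
  then have AE: "AE w in lebesgue. w \<notin> Z" by (rule AE_not_in)
  have count: "emeasure (count_space UNIV) {x. g x = w} = (\<Sum>i. indicator (g ` P i) w)" if "w \<notin> Z" for w
  proof -
    have "{x. g x = w} = (\<Union>i. {x \<in> P i. g x = w})"
      using that P(3) by (auto simp: Z_def)
    then have "emeasure (count_space UNIV) {x. g x = w} = (\<Sum>i. emeasure (count_space UNIV) {x \<in> P i. g x = w})"
      using P(2) by (simp, intro suminf_emeasure[symmetric]) (auto simp: disjoint_family_on_def)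
    moreover have "emeasure (count_space UNIV) {x \<in> P i. g x = w} = indicator (g ` P i) w" for i
    proof (cases "w \<in> g ` P i")
      case True
      then obtain x where "x \<in> P i" "g x = w" by auto
      then have "{x \<in> P i. g x = w} = {x}" using P(4)[of i] by (auto simp: inj_on_def)
      then show ?thesis using True by simp
    next
      case False
      then have e: "{x \<in> P i. g x = w} = {}" by auto
      show ?thesis unfolding e using False by simp
    qed
    ultimately show ?thesis by simp
  qed
  have "(\<integral>\<^sup>+w. emeasure (count_space UNIV) {x. g x = w} * ennreal (\<phi> w) \<partial>lborel)
      = (\<integral>\<^sup>+w. emeasure (count_space UNIV) {x. g x = w} * ennreal (\<phi> w) \<partial>lebesgue)"
    by (rule nn_integral_completion[symmetric])
  also have "\<dots> = (\<integral>\<^sup>+w. (\<Sum>i. indicator (g ` P i) w * ennreal (\<phi> w)) \<partial>lebesgue)"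
    by (rule nn_integral_cong_AE) (use AE in eventually_elim, simp add: count ennreal_suminf_multc)
  also have "\<dots> = (\<Sum>i. \<integral>\<^sup>+w. indicator (g ` P i) w * ennreal (\<phi> w) \<partial>lebesgue)"
  proof (rule nn_integral_suminf)
    fix i
    have im: "g ` P i \<in> sets lebesgue"
      by (rule change_of_variables_inj(1)[OF PL der P(4) \<phi> nonneg])
    have "(\<lambda>w. ennreal (\<phi> w)) \<in> borel_measurable lborel" by measurable
    then have "(\<lambda>w. ennreal (\<phi> w)) \<in> borel_measurable lebesgue" by (rule measurable_completion)
    then show "(\<lambda>w. indicator (g ` P i) w * ennreal (\<phi> w)) \<in> borel_measurable lebesgue"
      by (intro borel_measurable_times_ennreal borel_measurable_indicator[OF im])
  qed
  also have "\<dots> = (\<Sum>i. \<integral>\<^sup>+x. indicator (P i) x * ennreal (\<bar>det (matrix (g' x))\<bar> * \<phi> (g x)) \<partial>lebesgue)"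
    by (intro suminf_cong change_of_variables_inj(2)[OF PL der P(4) \<phi> nonneg])
  also have "\<dots> = (\<Sum>i. \<integral>\<^sup>+x. indicator (P i) x * ennreal (\<bar>det (matrix (g' x))\<bar> * \<phi> (g x)) \<partial>lborel)"
    by (simp add: nn_integral_completion)
  also have "\<dots> = (\<integral>\<^sup>+x. (\<Sum>i. indicator (P i) x * ennreal (\<bar>det (matrix (g' x))\<bar> * \<phi> (g x))) \<partial>lborel)"
    by (intro nn_integral_suminf[symmetric] borel_measurable_times_ennreal borel_measurable_indicator)
       (simp_all add: P(1))
  also have "\<dots> = (\<integral>\<^sup>+x. ennreal (\<bar>det (matrix (g' x))\<bar> * \<phi> (g x)) \<partial>lborel)"
  proof (rule nn_integral_cong)
    fix x
    have "(\<Sum>i. indicator (P i) x * ennreal (\<bar>det (matrix (g' x))\<bar> * \<phi> (g x)))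
        = (\<Sum>i. indicator (P i) x) * ennreal (\<bar>det (matrix (g' x))\<bar> * \<phi> (g x))"
      by (rule ennreal_suminf_multc)
    also have "(\<Sum>i. indicator (P i) x :: ennreal) = indicator (\<Union>i. P i) x"
      by (rule suminf_indicator[OF P(2)])
    also have "indicator (\<Union>i. P i) x * ennreal (\<bar>det (matrix (g' x))\<bar> * \<phi> (g x))
        = ennreal (\<bar>det (matrix (g' x))\<bar> * \<phi> (g x))"
      unfolding P(3) by (auto split: split_indicator)
    finally show "(\<Sum>i. indicator (P i) x * ennreal (\<bar>det (matrix (g' x))\<bar> * \<phi> (g x)))
        = ennreal (\<bar>det (matrix (g' x))\<bar> * \<phi> (g x))" .
  qed
  finally show ?thesis .
qed

section \<open>The area formula in the complex plane\<close>

definition of_vec2 :: "real^2 \<Rightarrow> complex" where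
  "of_vec2 v = Complex (v $ 1) (v $ 2)"

definition to_vec2 :: "complex \<Rightarrow> real^2" where
  "to_vec2 z = vector [Re z, Im z]"

lemma to_vec2_nth [simp]: "to_vec2 z $ 1 = Re z" "to_vec2 z $ 2 = Im z"
  by (simp_all add: to_vec2_def)

lemma of_to_vec2 [simp]: "of_vec2 (to_vec2 z) = z" "to_vec2 (of_vec2 v) = v"
  by (simp_all add: of_vec2_def vec_eq_iff forall_2)

lemma Re_Im_of_vec2 [simp]: "Re (of_vec2 v) = v $ 1" "Im (of_vec2 v) = v $ 2"
  by (simp_all add: of_vec2_def)

lemma norm_to_vec2 [simp]: "norm (to_vec2 z) = cmod z"
  by (simp add: norm_vec_def L2_set_def sum_2 cmod_def)

lemma norm_of_vec2 [simp]: "cmod (of_vec2 v) = norm v"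
  using norm_to_vec2[of "of_vec2 v"] by simp

lemma bounded_linear_of_vec2: "bounded_linear of_vec2"
  by (rule bounded_linear_intro[where K=1]) (simp_all add: complex_eq_iff)

lemma bounded_linear_to_vec2: "bounded_linear to_vec2"
  by (rule bounded_linear_intro[where K=1]) (simp_all add: vec_eq_iff forall_2)

lemma measurable_of_vec2 [measurable]: "of_vec2 \<in> borel_measurable borel"
  by (intro borel_measurable_continuous_onI linear_continuous_on bounded_linear_of_vec2)

lemma measurable_to_vec2 [measurable]: "to_vec2 \<in> borel_measurable borel"
  by (intro borel_measurable_continuous_onI linear_continuous_on bounded_linear_to_vec2)

lemma Basis_vec2: "(Basis :: (real^2) set) = {axis 1 1, axis 2 1}"
  by (auto simp: Basis_vec_def UNIV_2)

lemma distr_lborel_of_vec2: "distr lborel borel of_vec2 = lborel"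
proof (rule lborel_eqI[symmetric])
  fix l u :: complex
  assume lu: "\<And>b. b \<in> Basis \<Longrightarrow> l \<bullet> b \<le> u \<bullet> b"
  have le: "Re l \<le> Re u" "Im l \<le> Im u"
    using lu[of 1] lu[of \<i>] by (auto simp: Basis_complex_def)
  have ne: "axis 1 (1 :: real) \<noteq> (axis 2 1 :: real^2)"
    by (simp add: axis_eq_axis)
  have v: "of_vec2 -` box l u = box (to_vec2 l) (to_vec2 u)"
    by (auto simp: box_def Basis_complex_def Basis_vec2 inner_axis)
  have "emeasure (distr lborel borel of_vec2) (box l u) = emeasure lborel (box (to_vec2 l) (to_vec2 u))"
    by (subst emeasure_distr) (auto simp: v)
  also have "\<dots> = ennreal (\<Prod>b\<in>Basis. (to_vec2 u - to_vec2 l) \<bullet> b)"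
    using le by (intro emeasure_lborel_box) (auto simp: Basis_vec2 inner_axis)
  also have "(\<Prod>b\<in>Basis. (to_vec2 u - to_vec2 l) \<bullet> b) = (Re u - Re l) * (Im u - Im l)"
    unfolding Basis_vec2 using ne by (simp add: inner_axis)
  also have "\<dots> = (\<Prod>b\<in>Basis. (u - l) \<bullet> b)" by (simp add: Basis_complex_def)
  finally show "emeasure (distr lborel borel of_vec2) (box l u) = ennreal (\<Prod>b\<in>Basis. (u - l) \<bullet> b)" .
qed simp

lemma emeasure_count_space_image:
  assumes "inj_on f A"
  shows "emeasure (count_space UNIV) (f ` A) = emeasure (count_space UNIV) A"
  using assms by (simp add: emeasure_count_space card_image finite_image_iff)

text \<open>The real-linear map given by \<open>P z * h + Q z * cnj h\<close> has the determinant
  \<open>(cmod (P z))\<^sup>2 - (cmod (Q z))\<^sup>2\<close>. The rest is transport along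
  \<open>of_vec2\<close>, which preserves Lebesgue measure.\<close>

lemma area_formula_complex:
  fixes G P Q :: "complex \<Rightarrow> complex" and \<phi> :: "complex \<Rightarrow> real"
  assumes der: "\<And>z. (G has_derivative (\<lambda>h. P z * h + Q z * cnj h)) (at z)"
    and P: "continuous_on UNIV P" and Q: "continuous_on UNIV Q"
    and \<phi>: "integrable lborel \<phi>" and nonneg: "\<And>x. 0 \<le> \<phi> x"
    and N [measurable]: "(\<lambda>w. emeasure (count_space UNIV) {z. G z = w}) \<in> borel_measurable borel"
  shows "(\<integral>\<^sup>+w. emeasure (count_space UNIV) {z. G z = w} * ennreal (\<phi> w) \<partial>lborel)
      = (\<integral>\<^sup>+z. ennreal (\<bar>(cmod (P z))\<^sup>2 - (cmod (Q z))\<^sup>2\<bar> * \<phi> (G z)) \<partial>lborel)"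
proof -
  define g where "g = (\<lambda>v. to_vec2 (G (of_vec2 v)))"
  define g' where "g' = (\<lambda>v h. to_vec2 (P (of_vec2 v) * of_vec2 h + Q (of_vec2 v) * cnj (of_vec2 h)))"
  interpret ov: bounded_linear of_vec2 by (rule bounded_linear_of_vec2)
  interpret tv: bounded_linear to_vec2 by (rule bounded_linear_to_vec2)
  have contG: "continuous_on UNIV G"
    using der by (meson continuous_at_imp_continuous_on has_derivative_continuous)
  have [measurable]: "G \<in> borel_measurable borel" "P \<in> borel_measurable borel" "Q \<in> borel_measurable borel"
    using contG P Q by (auto intro: borel_measurable_continuous_onI)
  have [measurable]: "\<phi> \<in> borel_measurable borel" using \<phi> by auto
  have derg: "(g has_derivative g' v) (at v)" for v
    unfolding g_def g'_def
    by (intro tv.has_derivative has_derivative_compose[OF ov.has_derivative[OF has_derivative_ident] der])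
  have det: "det (matrix (g' v)) = (cmod (P (of_vec2 v)))\<^sup>2 - (cmod (Q (of_vec2 v)))\<^sup>2" for v
  proof -
    have "of_vec2 (axis 1 1) = 1" "of_vec2 (axis 2 1) = \<i>"
      by (simp_all add: complex_eq_iff axis_def)
    then show ?thesis
      unfolding det_2 matrix_def g'_def cmod_power2 by (simp add: power2_eq_square algebra_simps axis_def)
  qed
  have detc: "continuous_on UNIV (\<lambda>v. det (matrix (g' v)))"
    unfolding det
    by (intro continuous_intros continuous_on_compose2[OF P] continuous_on_compose2[OF Q]
        linear_continuous_on bounded_linear_of_vec2) auto
  have cont: "\<exists>d>0. \<forall>y. dist x y < d \<longrightarrow> onorm (\<lambda>v. g' y v - g' x v) < e" if "0 < e" for x e
  proof -
    \<comment> \<open>Bounds the operator norm of the change in the derivative and vanishes at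
      \<open>x\<close>, so continuity of \<open>P\<close> and \<open>Q\<close> suffices.\<close>
    define R where "R = (\<lambda>y. cmod (P (of_vec2 y) - P (of_vec2 x)) + cmod (Q (of_vec2 y) - Q (of_vec2 x)))"
    have "continuous_on UNIV R"
      unfolding R_def
      by (intro continuous_intros continuous_on_compose2[OF P] continuous_on_compose2[OF Q]
          linear_continuous_on bounded_linear_of_vec2) auto
    then have "isCont R x" by (simp add: continuous_on_eq_continuous_at)
    then obtain d where d: "d > 0" "\<And>y. dist y x < d \<Longrightarrow> dist (R y) (R x) < e"
      using \<open>0 < e\<close> unfolding continuous_at_eps_delta by (metis dist_norm dist_commute)
    have "onorm (\<lambda>v. g' y v - g' x v) \<le> R y" for y
    proof (rule onorm_le)
      fix v
      have "g' y v - g' x v = to_vec2 ((P (of_vec2 y) - P (of_vec2 x)) * of_vec2 v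
          + (Q (of_vec2 y) - Q (of_vec2 x)) * cnj (of_vec2 v))"
        unfolding g'_def tv.diff[symmetric] by (simp add: algebra_simps)
      then have "norm (g' y v - g' x v) = cmod ((P (of_vec2 y) - P (of_vec2 x)) * of_vec2 v
          + (Q (of_vec2 y) - Q (of_vec2 x)) * cnj (of_vec2 v))" by simp
      also have "\<dots> \<le> R y * norm v"
        unfolding R_def by (rule order_trans[OF norm_triangle_ineq]) (simp add: norm_mult distrib_right)
      finally show "norm (g' y v - g' x v) \<le> R y * norm v" .
    qed
    moreover have "R y < e" if "dist x y < d" for y
      using d(2)[of y] that by (simp add: R_def dist_commute)
    ultimately show ?thesis using d(1) by (meson le_less_trans)
  qed
  define \<psi> where "\<psi> = (\<lambda>v. \<phi> (of_vec2 v))"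
  have \<psi>: "integrable lborel \<psi>"
    unfolding \<psi>_def using \<phi> by (subst integrable_distr_eq[symmetric, where N=borel]) (auto simp: distr_lborel_of_vec2)
  have cnt: "emeasure (count_space UNIV) {v. g v = w} = emeasure (count_space UNIV) {z. G z = of_vec2 w}" for w
  proof -
    have "{z. G z = of_vec2 w} = of_vec2 ` {v. g v = w}"
    proof (intro set_eqI iffI)
      fix z assume z: "z \<in> {z. G z = of_vec2 w}"
      then have "g (to_vec2 z) = w" by (simp add: g_def)
      then show "z \<in> of_vec2 ` {v. g v = w}" by (intro image_eqI[of _ _ "to_vec2 z"]) auto
    next
      fix z assume "z \<in> of_vec2 ` {v. g v = w}"
      then show "z \<in> {z. G z = of_vec2 w}" by (auto simp: g_def)
    qed
    moreover have "inj_on of_vec2 {v. g v = w}" by (metis inj_onI of_to_vec2(2))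
    ultimately show ?thesis by (simp add: emeasure_count_space_image)
  qed
  have "(\<integral>\<^sup>+w. emeasure (count_space UNIV) {z. G z = w} * ennreal (\<phi> w) \<partial>lborel)
    = (\<integral>\<^sup>+w. emeasure (count_space UNIV) {v. g v = w} * ennreal (\<psi> w) \<partial>lborel)"
    unfolding cnt \<psi>_def by (subst distr_lborel_of_vec2[symmetric], subst nn_integral_distr) auto
  also have "\<dots> = (\<integral>\<^sup>+x. ennreal (\<bar>det (matrix (g' x))\<bar> * \<psi> (g x)) \<partial>lborel)"
  proof (rule area_formula_vec[OF derg cont detc \<psi>])
    show "(\<lambda>w. emeasure (count_space UNIV) {x. g x = w}) \<in> borel_measurable borel"
      unfolding cnt by measurable
  qed (auto simp: \<psi>_def nonneg)
  also have "\<dots> = (\<integral>\<^sup>+x. ennreal (\<bar>(cmod (P (of_vec2 x)))\<^sup>2 - (cmod (Q (of_vec2 x)))\<^sup>2\<bar> * \<phi> (G (of_vec2 x))) \<partial>lborel)"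
    unfolding det \<psi>_def g_def by simp
  also have "\<dots> = (\<integral>\<^sup>+z. ennreal (\<bar>(cmod (P z))\<^sup>2 - (cmod (Q z))\<^sup>2\<bar> * \<phi> (G z)) \<partial>lborel)"
    by (subst distr_lborel_of_vec2[symmetric], subst nn_integral_distr) auto
  finally show ?thesis .
qed

section \<open>Measurability of the number of zeros\<close>

text \<open>On a compact set the modulus attains its minimum, so a zero exists exactly when the
  values on a countable dense subset come arbitrarily close to 0. This is a countable
  condition.\<close>

lemma measurable_exists_zero:
  fixes f :: "'a \<Rightarrow> complex \<Rightarrow> complex"
  assumes meas [measurable]: "\<And>z. (\<lambda>w. f w z) \<in> borel_measurable M"
    and cont: "\<And>w. continuous_on UNIV (f w)" and K: "compact K"
  shows "Measurable.pred M (\<lambda>w. \<exists>z\<in>K. f w z = 0)"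
proof -
  obtain D where D: "countable D" "D \<subseteq> K" "K \<subseteq> closure D"
    using separable by metis
  have "(\<exists>z\<in>K. f w z = 0) \<longleftrightarrow> (\<forall>k. \<exists>d\<in>D. cmod (f w d) < 1 / real (Suc k))" for w
  proof
    assume "\<exists>z\<in>K. f w z = 0"
    then obtain z where z: "z \<in> K" "f w z = 0" by auto
    show "\<forall>k. \<exists>d\<in>D. cmod (f w d) < 1 / real (Suc k)"
    proof
      fix k
      have "isCont (f w) z" using cont[of w] by (simp add: continuous_on_eq_continuous_at)
      then obtain \<delta> where \<delta>: "\<delta> > 0" "\<And>y. dist y z < \<delta> \<Longrightarrow> dist (f w y) (f w z) < 1 / real (Suc k)"
        unfolding continuous_at_eps_delta by (metis dist_norm of_nat_0_less_iff zero_less_Suc zero_less_divide_1_iff)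
      obtain d where "d \<in> D" "dist d z < \<delta>" using D(3) z(1) \<delta>(1) by (meson closure_approachable subsetD)
      then show "\<exists>d\<in>D. cmod (f w d) < 1 / real (Suc k)" using \<delta>(2)[of d] z(2) by auto
    qed
  next
    assume *: "\<forall>k. \<exists>d\<in>D. cmod (f w d) < 1 / real (Suc k)"
    show "\<exists>z\<in>K. f w z = 0"
    proof (cases "K = {}")
      case True
      then show ?thesis using * D(2) by auto
    next
      case False
      have "continuous_on K (\<lambda>z. cmod (f w z))"
        by (intro continuous_intros continuous_on_subset[OF cont]) auto
      from continuous_attains_inf[OF K False this] obtain z where z: "z \<in> K" "\<And>y. y \<in> K \<Longrightarrow> cmod (f w z) \<le> cmod (f w y)"
        by auto
      have "cmod (f w z) \<le> 1 / real (Suc k)" for k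
      proof -
        obtain d where "d \<in> D" "cmod (f w d) < 1 / real (Suc k)" using * by blast
        then show ?thesis using z(2)[of d] D(2) by force
      qed
      then have "cmod (f w z) \<le> 0"
        by (metis le_less_trans less_irrefl nat_approx_posE not_le)
      then show ?thesis using z(1) by auto
    qed
  qed
  then show ?thesis using D(1) by (simp add: pred_intros_countable)
qed

text \<open>The count is the supremum, over finite disjoint families of balls from a countable
  stock, of the number of balls that contain a zero. Disjointness prevents overcounting; small balls
  around the points of any finite set of zeros attain its size. Infinite zero sets are covered as
  well, with the value \<open>\<top>\<close>.\<close>

lemma measurable_count_zeros:
  fixes f :: "'a \<Rightarrow> complex \<Rightarrow> complex"
  assumes meas: "\<And>z. (\<lambda>w. f w z) \<in> borel_measurable M"
    and cont: "\<And>w. continuous_on UNIV (f w)"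
  shows "(\<lambda>w. emeasure (count_space UNIV) {z. f w z = 0}) \<in> borel_measurable M"
proof -
  obtain D :: "complex set" where D: "countable D" "UNIV \<subseteq> closure D"
    using separable[of "UNIV :: complex set"] by metis
  define \<B> where "\<B> = (\<lambda>(c, k). cball c (1 / real (Suc k))) ` (D \<times> (UNIV :: nat set))"
  define \<FF> where "\<FF> = {F. finite F \<and> F \<subseteq> \<B> \<and> disjoint F}"
  have cB: "countable \<B>" unfolding \<B>_def using D(1) by auto
  have c: "countable \<FF>"
    by (rule countable_subset[OF _ countable_Collect_finite_subset[OF cB]]) (auto simp: \<FF>_def)
  have e: "{} \<in> \<FF>" by (auto simp: \<FF>_def disjoint_def)
  define h where "h = (\<lambda>B w. if \<exists>z\<in>B. f w z = 0 then 1 else (0 :: ennreal))"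
  have hm: "h B \<in> borel_measurable M" if "B \<in> \<B>" for B
  proof -
    have "compact B" using that by (auto simp: \<B>_def)
    from measurable_exists_zero[OF meas cont this] show ?thesis unfolding h_def by measurable
  qed
  have "emeasure (count_space UNIV) {z. f w z = 0} = (SUP F\<in>\<FF>. \<Sum>B\<in>F. h B w)" for w
  proof (rule antisym)
    show "(SUP F\<in>\<FF>. \<Sum>B\<in>F. h B w) \<le> emeasure (count_space UNIV) {z. f w z = 0}"
    proof (rule SUP_least)
      fix F assume F: "F \<in> \<FF>"
      define F' where "F' = {B \<in> F. \<exists>z\<in>B. f w z = 0}"
      have fin: "finite F" "finite F'" using F by (auto simp: \<FF>_def F'_def)
      define s where "s = (\<lambda>B. SOME z. z \<in> B \<and> f w z = 0)"
      have s: "s B \<in> B \<and> f w (s B) = 0" if "B \<in> F'" for B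
        unfolding s_def by (rule someI_ex) (use that in \<open>auto simp: F'_def\<close>)
      have inj: "inj_on s F'"
      proof (rule inj_onI)
        fix A B assume AB: "A \<in> F'" "B \<in> F'" "s A = s B"
        then have "s A \<in> A \<inter> B" using s by fastforce
        then show "A = B" using F AB(1,2) by (auto simp: \<FF>_def F'_def disjoint_def)
      qed
      have "(\<Sum>B\<in>F. h B w) = (\<Sum>B\<in>F'. 1)"
        unfolding F'_def h_def using fin(1) by (subst sum.inter_filter) auto
      also have "\<dots> = emeasure (count_space UNIV) (s ` F')"
        using fin(2) inj by (simp add: emeasure_count_space card_image)
      also have "\<dots> \<le> emeasure (count_space UNIV) {z. f w z = 0}"
        using s by (intro emeasure_mono) auto
      finally show "(\<Sum>B\<in>F. h B w) \<le> emeasure (count_space UNIV) {z. f w z = 0}" .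
    qed
    have fin: "of_nat (card Z) \<le> (SUP F\<in>\<FF>. \<Sum>B\<in>F. h B w)" if Z: "finite Z" "Z \<subseteq> {z. f w z = 0}" for Z
    proof -
      obtain \<delta> where \<delta>: "\<delta> > 0" "\<And>x y. x \<in> Z \<Longrightarrow> y \<in> Z \<Longrightarrow> x \<noteq> y \<Longrightarrow> \<delta> \<le> dist x y"
      proof -
        \<comment> \<open>The element 1 keeps the minimum meaningful when \<open>Z\<close> has fewer
          than two points.\<close>
        define T where "T = insert 1 ((\<lambda>p. dist (fst p) (snd p)) ` {p \<in> Z \<times> Z. fst p \<noteq> snd p})"
        have "finite {p \<in> Z \<times> Z. fst p \<noteq> snd p}"
          by (rule finite_subset[of _ "Z \<times> Z"]) (use Z(1) in auto)
        then have T: "finite T" "T \<noteq> {}" by (simp_all add: T_def)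
        have "0 < t" if "t \<in> T" for t using that by (auto simp: T_def)
        then have pos: "0 < Min T" using T by simp
        have le: "Min T \<le> dist x y" if "x \<in> Z" "y \<in> Z" "x \<noteq> y" for x y
        proof (rule Min_le[OF T(1)])
          show "dist x y \<in> T" unfolding T_def using that
            by (intro insertI2 image_eqI[where x = "(x, y)"]) auto
        qed
        show ?thesis by (rule that[OF pos le])
      qed
      \<comment> \<open>If two of the balls met, their points of \<open>Z\<close> would be joined by
        four steps of length at most \<open>r\<close>: point to centre, centre to common point, and
        back. Hence the quarter.\<close>
      obtain k where k: "1 / real (Suc k) < \<delta> / 4"
        by (rule nat_approx_posE[of "\<delta> / 4"]) (use \<delta>(1) in simp)
      define r where "r = 1 / real (Suc k)"
      have r: "0 < r" "4 * r < \<delta>" using k by (auto simp: r_def)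
      have "\<exists>c\<in>D. dist c z < r" for z
        using D(2) r(1) by (meson UNIV_I closure_approachable subsetD)
      then obtain c where c: "\<And>z. c z \<in> D" "\<And>z. dist (c z) z < r" by metis
      define F where "F = (\<lambda>z. cball (c z) r) ` Z"
      have far: "cball (c x) r \<inter> cball (c y) r = {}" if "x \<in> Z" "y \<in> Z" "x \<noteq> y" for x y
      proof (rule ccontr)
        assume "cball (c x) r \<inter> cball (c y) r \<noteq> {}"
        then obtain p where p: "dist (c x) p \<le> r" "dist (c y) p \<le> r" by auto
        have "dist x y \<le> dist x (c x) + dist (c x) p + dist p (c y) + dist (c y) y"
          by (smt (verit) dist_triangle)
        also have "\<dots> < \<delta>" using p c(2)[of x] c(2)[of y] r by (simp add: dist_commute)
        finally show False using \<delta>(2)[OF that] by simp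
      qed
      have ne: "z \<in> cball (c z) r" for z using c(2)[of z] by simp
      have inj: "inj_on (\<lambda>z. cball (c z) r) Z"
        using far ne by (intro inj_onI) blast
      have FF: "F \<in> \<FF>"
        unfolding \<FF>_def
      proof (intro CollectI conjI)
        show "finite F" unfolding F_def using Z(1) by simp
        show "F \<subseteq> \<B>"
        proof
          fix B assume "B \<in> F"
          then obtain z where "B = cball (c z) (1 / real (Suc k))" by (auto simp: F_def r_def)
          then show "B \<in> \<B>" unfolding \<B>_def using c(1) by (intro image_eqI[where x = "(c z, k)"]) auto
        qed
        show "disjoint F"
          unfolding disjoint_def
        proof (intro ballI impI)
          fix A B assume "A \<in> F" "B \<in> F" and ne': "A \<noteq> B"
          then obtain a b where ab: "a \<in> Z" "b \<in> Z" "A = cball (c a) r" "B = cball (c b) r"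
            by (auto simp: F_def)
          then have "a \<noteq> b" using ne' by auto
          then show "A \<inter> B = {}" unfolding ab(3,4) by (rule far[OF ab(1,2)])
        qed
      qed
      have "(\<Sum>B\<in>F. h B w) = (\<Sum>z\<in>Z. h (cball (c z) r) w)"
        unfolding F_def by (simp add: sum.reindex[OF inj])
      also have "\<dots> = (\<Sum>z\<in>Z. 1)"
        using ne Z(2) by (intro sum.cong) (auto simp: h_def)
      also have "\<dots> = of_nat (card Z)" by simp
      finally have "of_nat (card Z) = (\<Sum>B\<in>F. h B w)" ..
      also have "\<dots> \<le> (SUP F\<in>\<FF>. \<Sum>B\<in>F. h B w)" by (rule SUP_upper[OF FF])
      finally show ?thesis .
    qed
    show "emeasure (count_space UNIV) {z. f w z = 0} \<le> (SUP F\<in>\<FF>. \<Sum>B\<in>F. h B w)"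
    proof (cases "finite {z. f w z = 0}")
      case True
      then show ?thesis using fin[OF True] by (simp add: emeasure_count_space)
    next
      case False
      have "of_nat n \<le> (SUP F\<in>\<FF>. \<Sum>B\<in>F. h B w)" for n
        using infinite_arbitrarily_large[OF False, of n] fin by metis
      then have "(SUP F\<in>\<FF>. \<Sum>B\<in>F. h B w) = \<top>"
        by (metis ennreal_SUP_of_nat_eq_top SUP_least top.extremum_unique)
      then show ?thesis by (simp only: top_greatest)
    qed
  qed
  moreover have "(\<lambda>w. SUP F\<in>\<FF>. \<Sum>B\<in>F. h B w) \<in> borel_measurable M"
    using c hm by (intro borel_measurable_SUP borel_measurable_sum) (auto simp: \<FF>_def)
  ultimately show ?thesis by simp
qed

section \<open>The expected number of zeros\<close>

lemma gauss_formula: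
  fixes r1 r2 s :: real and t1 t2 :: complex
  defines "W \<equiv> 1 + s\<^sup>2"
  defines "S \<equiv> W + (cmod t1)\<^sup>2 + (cmod t2)\<^sup>2"
  assumes r1: "0 < r1" and r2: "0 \<le> r2" "r2 = 0 \<longrightarrow> t2 = 0"
  shows "(\<integral>\<^sup>+(x :: complex). \<integral>\<^sup>+(y :: complex). \<integral>\<^sup>+(w :: complex). ennreal (\<bar>(cmod (r1 * x))\<^sup>2 - (cmod (r2 * y))\<^sup>2\<bar> *
        exp (- (cmod (t1 * x + t2 * y + s * w))\<^sup>2)) \<partial>gauss \<partial>gauss \<partial>gauss)
    = ennreal (signed_mean ((r1\<^sup>2 * (W + (cmod t2)\<^sup>2) - r2\<^sup>2 * (W + (cmod t1)\<^sup>2)) / S) (W * r1\<^sup>2 * r2\<^sup>2 / S) / S)"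
proof (cases "r2 = 0")
  case True
  then show ?thesis
    using gauss_formula_zero[OF r1, where s=s and ?t1.0=t1] r2(2) by (simp add: S_def W_def)
next
  case False
  then have "0 < r2" using r2(1) by simp
  then show ?thesis unfolding S_def W_def by (rule gauss_formula_pos[OF r1])
qed

section \<open>The law of the coefficients\<close>

text \<open>By independence the joint density is the product of two normal densities of variance
  \<open>v / 2\<close>. It depends on the modulus only, and scaling by \<open>sqrt v\<close> brings
  it to \<open>gauss\<close>.\<close>

lemma distr_complex_gaussian:
  assumes M: "prob_space M" and v: "0 < v" and X: "centered_complex_gaussian M v X"
  shows "X \<in> borel_measurable M"
    and "distr M borel X = distr gauss borel (\<lambda>x. of_real (sqrt v) * x)"
proof -
  interpret prob_space M by (rule M)
  let ?f = "\<lambda>x. ennreal (normal_density 0 (sqrt (v / 2)) x)"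
  have d: "distributed M lborel (\<lambda>w. Re (X w)) ?f" "distributed M lborel (\<lambda>w. Im (X w)) ?f"
    and ind: "indep_var borel (\<lambda>w. Re (X w)) borel (\<lambda>w. Im (X w))"
    using X by (auto simp: centered_complex_gaussian_def)
  have [measurable]: "(\<lambda>w. Re (X w)) \<in> borel_measurable M" "(\<lambda>w. Im (X w)) \<in> borel_measurable M"
    using distributed_measurable[OF d(1)] distributed_measurable[OF d(2)] by simp_all
  show Xm [measurable]: "X \<in> borel_measurable M"
    by (simp add: borel_measurable_complex_iff)
  have dens: "distr M borel (\<lambda>w. Re (X w)) = density lborel ?f" "distr M borel (\<lambda>w. Im (X w)) = density lborel ?f"
    using distributed_distr_eq_density[OF d(1)] distributed_distr_eq_density[OF d(2)]
    by (simp_all cong: distr_cong)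
  have joint: "distr M (borel \<Otimes>\<^sub>M borel) (\<lambda>w. (Re (X w), Im (X w))) = density lborel ?f \<Otimes>\<^sub>M density lborel ?f"
    using ind unfolding indep_var_distribution_eq dens by simp
  have [measurable]: "(\<lambda>(x, y). Complex x y) \<in> borel_measurable (borel \<Otimes>\<^sub>M borel)"
    by (simp add: borel_measurable_complex_iff case_prod_beta)
  have nd: "?f x * ?f y = ennreal (exp (- (cmod (Complex x y))\<^sup>2 / v) / (pi * v))" for x y
  proof -
    have "exp (- (cmod (Complex x y))\<^sup>2 / v) = exp (- x\<^sup>2 / v) * exp (- y\<^sup>2 / v)"
      by (simp add: exp_add[symmetric] cmod_power2 add_divide_distrib diff_divide_distrib)
    then show ?thesis
      using v by (simp add: normal_density_def ennreal_mult[symmetric] real_sqrt_mult[symmetric] del: of_real_sqrt)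
  qed
  show "distr M borel X = distr gauss borel (\<lambda>x. of_real (sqrt v) * x)"
  proof (rule measure_eqI)
    fix A assume "A \<in> sets (distr M borel X)"
    then have A [measurable]: "A \<in> sets borel" by simp
    interpret D: prob_space "density lborel ?f" unfolding dens(1)[symmetric] by (rule prob_space_distr) simp
    have "emeasure (distr M borel X) A = (\<integral>\<^sup>+w. indicator A (Complex (Re (X w)) (Im (X w))) \<partial>M)"
      by (simp add: nn_integral_indicator[symmetric] nn_integral_distr del: nn_integral_indicator)
    also have "\<dots> = (\<integral>\<^sup>+p. indicator A (case p of (x, y) \<Rightarrow> Complex x y) \<partial>distr M (borel \<Otimes>\<^sub>M borel) (\<lambda>w. (Re (X w), Im (X w))))"
      by (subst nn_integral_distr) auto
    also have "\<dots> = (\<integral>\<^sup>+x. \<integral>\<^sup>+y. indicator A (Complex x y) \<partial>density lborel ?f \<partial>density lborel ?f)"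
      unfolding joint by (subst D.nn_integral_fst[symmetric]) auto
    also have "\<dots> = (\<integral>\<^sup>+x. ?f x * (\<integral>\<^sup>+y. ?f y * indicator A (Complex x y) \<partial>lborel) \<partial>lborel)"
      by (simp add: nn_integral_density)
    also have "\<dots> = (\<integral>\<^sup>+x. \<integral>\<^sup>+y. ?f x * ?f y * indicator A (Complex x y) \<partial>lborel \<partial>lborel)"
      by (simp add: nn_integral_cmult mult.assoc)
    also have "\<dots> = (\<integral>\<^sup>+x. \<integral>\<^sup>+y. ennreal (exp (- (cmod (Complex x y))\<^sup>2 / v) / (pi * v)) * indicator A (Complex x y) \<partial>lborel \<partial>lborel)"
      unfolding nd ..
    also have "\<dots> = (\<integral>\<^sup>+z. ennreal (exp (- (cmod z)\<^sup>2 / v) / (pi * v)) * indicator A z \<partial>lborel)"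
      by (rule nn_integral_lborel_Complex[symmetric]) measurable
    also have "\<dots> = ennreal ((sqrt v)\<^sup>2) * (\<integral>\<^sup>+z. ennreal (exp (- (cmod (sqrt v *\<^sub>R z))\<^sup>2 / v) / (pi * v)) * indicator A (sqrt v *\<^sub>R z) \<partial>lborel)"
      using v by (intro nn_integral_lborel_scale) auto
    also have "\<dots> = (\<integral>\<^sup>+z. ennreal ((sqrt v)\<^sup>2) * (ennreal (exp (- (cmod (sqrt v *\<^sub>R z))\<^sup>2 / v) / (pi * v)) * indicator A (sqrt v *\<^sub>R z)) \<partial>lborel)"
      by (rule nn_integral_cmult[symmetric]) measurable
    also have "\<dots> = (\<integral>\<^sup>+z. ennreal (exp (- (cmod z)\<^sup>2) / pi) * indicator A (of_real (sqrt v) * z) \<partial>lborel)"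
      using v by (intro nn_integral_cong)
        (simp add: mult.assoc[symmetric] ennreal_mult[symmetric] scaleR_conv_of_real norm_mult power_mult_distrib)
    also have "\<dots> = emeasure (distr gauss borel (\<lambda>x. of_real (sqrt v) * x)) A"
      by (simp add: nn_integral_indicator[symmetric] nn_integral_distr nn_integral_gauss del: nn_integral_indicator)
    finally show "emeasure (distr M borel X) A = emeasure (distr gauss borel (\<lambda>x. of_real (sqrt v) * x)) A" .
  qed simp
qed

text \<open>The map \<open>case_sum id id\<close> gives the degree of a coefficient regardless of
  its side.\<close>

definition weight :: "nat + nat \<Rightarrow> real" where
  "weight i = sqrt (1 / fact (case_sum id id i))"

lemma weight_power2: "(weight (Inl j))\<^sup>2 = 1 / fact j" "(weight (Inr j))\<^sup>2 = 1 / fact j"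
  by (simp_all add: weight_def)

abbreviation coeff_law :: "nat + nat \<Rightarrow> complex measure" where
  "coeff_law i \<equiv> distr gauss borel (\<lambda>x. of_real (weight i) * x)"

text \<open>The zero count depends only on coefficients with index in \<open>I\<close>, whose joint
  law is a product measure by independence. From here on the probability space is concrete.\<close>

lemma weyl_model_law:
  assumes "weyl_model M n m a b"
  defines "I \<equiv> {..n} <+> {..m}"
  shows "expected_zeros M n m a b
    = (\<integral>\<^sup>+c. num_zeros n m (\<lambda>j. c (Inl j)) (\<lambda>j. c (Inr j)) \<partial>Pi\<^sub>M I coeff_law)"
proof -
  interpret prob_space M using assms(1) by (simp add: weyl_model_def)
  let ?X = "case_sum a b"
  have law: "?X i \<in> borel_measurable M \<and> distr M borel (?X i) = coeff_law i" if "i \<in> I" for i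
  proof -
    have G: "Y \<in> borel_measurable M \<and> distr M borel Y = distr gauss borel (\<lambda>x. of_real (sqrt (1 / fact j)) * x)"
      if "centered_complex_gaussian M (1 / fact j) Y" for j :: nat and Y
      using distr_complex_gaussian[OF prob_space_axioms _ that] by simp
    have "\<forall>j\<le>n. centered_complex_gaussian M (1 / fact j) (a j)" "\<forall>j\<le>m. centered_complex_gaussian M (1 / fact j) (b j)"
      using assms(1) by (auto simp: weyl_model_def)
    then show ?thesis using that by (cases i) (auto simp: I_def weight_def simp del: real_sqrt_divide dest!: G)
  qed
  have fin: "finite I" "I \<noteq> {}" by (auto simp: I_def)
  have "indep_vars (\<lambda>_. borel) ?X I" using assms(1) by (simp add: weyl_model_def I_def)
  then have "distr M (\<Pi>\<^sub>M i\<in>I. borel) (\<lambda>w. \<lambda>i\<in>I. ?X i w) = (\<Pi>\<^sub>M i\<in>I. distr M borel (?X i))"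
    using law fin by (subst (asm) indep_vars_iff_distr_eq_PiM') auto
  also have "\<dots> = Pi\<^sub>M I coeff_law" using law by (intro PiM_cong) auto
  finally have eq: "distr M (\<Pi>\<^sub>M i\<in>I. borel) (\<lambda>w. \<lambda>i\<in>I. ?X i w) = Pi\<^sub>M I coeff_law" .
  have Xm [measurable]: "(\<lambda>w. \<lambda>i\<in>I. ?X i w) \<in> measurable M (\<Pi>\<^sub>M i\<in>I. borel)"
    using law by (intro measurable_restrict) auto
  have [measurable]: "(\<lambda>c. num_zeros n m (\<lambda>j. c (Inl j)) (\<lambda>j. c (Inr j))) \<in> borel_measurable (\<Pi>\<^sub>M i\<in>I. borel)"
    unfolding num_zeros_def
  proof (rule measurable_count_zeros)
    fix z show "(\<lambda>c. harmonic_poly n m (\<lambda>j. c (Inl j)) (\<lambda>j. c (Inr j)) z) \<in> borel_measurable (\<Pi>\<^sub>M i\<in>I. borel)"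
      unfolding harmonic_poly_def
      by (intro borel_measurable_add borel_measurable_sum borel_measurable_times borel_measurable_const
          measurable_component_singleton) (auto simp: I_def)
    fix c :: "nat + nat \<Rightarrow> complex"
    show "continuous_on UNIV (harmonic_poly n m (\<lambda>j. c (Inl j)) (\<lambda>j. c (Inr j)))"
      unfolding harmonic_poly_def by (intro continuous_intros)
  qed
  have hp: "num_zeros n m (\<lambda>j. a j w) (\<lambda>j. b j w)
      = num_zeros n m (\<lambda>j. (\<lambda>i\<in>I. ?X i w) (Inl j)) (\<lambda>j. (\<lambda>i\<in>I. ?X i w) (Inr j))" for w
  proof -
    have "harmonic_poly n m (\<lambda>j. a j w) (\<lambda>j. b j w)
      = harmonic_poly n m (\<lambda>j. (\<lambda>i\<in>I. ?X i w) (Inl j)) (\<lambda>j. (\<lambda>i\<in>I. ?X i w) (Inr j))"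
      unfolding harmonic_poly_def by (intro ext arg_cong2[where f = "(+)"] sum.cong) (auto simp: I_def)
    then show ?thesis by (simp add: num_zeros_def)
  qed
  show ?thesis
    unfolding expected_zeros_def hp eq[symmetric] by (subst nn_integral_distr) auto
qed

text \<open>The \<open>k\<close>-th moment of the Poisson weights with parameter \<open>x\<close> truncated at \<open>N\<close>, not normalised.\<close>

definition moment_sum :: "nat \<Rightarrow> nat \<Rightarrow> real \<Rightarrow> real" where
  "moment_sum k N x = (\<Sum>j\<le>N. real j ^ k * x ^ j / fact j)"

definition total_sum :: "nat \<Rightarrow> nat \<Rightarrow> real \<Rightarrow> real" where
  "total_sum n m x = moment_sum 0 n x + moment_sum 0 m x"

text \<open>Variance difference and covariance determinant of \<open>z p'\<close> and \<open>z q'\<close> given \<open>H(z) = 0\<close>, where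
  \<open>x = |z|\<^sup>2\<close>, and \<open>p\<close> and \<open>q\<close> are the holomorphic and the antiholomorphic part of \<open>H\<close>.\<close>

definition drift :: "nat \<Rightarrow> nat \<Rightarrow> real \<Rightarrow> real" where
  "drift n m x = moment_sum 2 n x - moment_sum 2 m x
     - ((moment_sum 1 n x)\<^sup>2 - (moment_sum 1 m x)\<^sup>2) / total_sum n m x"

definition discr :: "nat \<Rightarrow> nat \<Rightarrow> real \<Rightarrow> real" where
  "discr n m x = moment_sum 2 n x * moment_sum 2 m x
     - ((moment_sum 1 n x)\<^sup>2 * moment_sum 2 m x + moment_sum 2 n x * (moment_sum 1 m x)\<^sup>2) / total_sum n m x"

lemma moment_sum_pos:
  assumes "0 < x" "1 \<le> N"
  shows "0 < moment_sum k N x"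
proof -
  have "0 < real 1 ^ k * x ^ 1 / fact 1" using assms by simp
  also have "\<dots> \<le> moment_sum k N x"
    unfolding moment_sum_def using assms by (intro member_le_sum) auto
  finally show ?thesis .
qed

lemma moment_sum_0_pos:
  assumes "0 \<le> x"
  shows "0 < moment_sum 0 N x"
proof -
  have "0 < real 0 ^ 0 * x ^ 0 / (fact 0 :: real)" by simp
  also have "\<dots> \<le> moment_sum 0 N x"
    unfolding moment_sum_def using assms by (intro member_le_sum) auto
  finally show ?thesis .
qed

text \<open>The holomorphic sums start at \<open>j = 1\<close>, because the zero equation is solved for \<open>a\<^sub>0\<close>. The
  derivatives are multiplied by \<open>z\<close> and by its conjugate, so that only powers of \<open>|z|\<^sup>2\<close> appear.\<close>

lemma gaussian_jacobian:
  fixes z :: complex and n m :: nat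
  assumes z: "z \<noteq> 0" and n: "1 \<le> n"
  defines "I \<equiv> Inl ` {1..n}" and "J \<equiv> Inr ` {..m}"
  defines "x \<equiv> (cmod z)\<^sup>2"
  shows "(\<integral>\<^sup>+c. ennreal (\<bar>(cmod (\<Sum>j=1..n. c (Inl j) * (of_nat j * z ^ j)))\<^sup>2 - (cmod (\<Sum>j\<le>m. c (Inr j) * (of_nat j * cnj z ^ j)))\<^sup>2\<bar>
      * exp (- (cmod ((\<Sum>j=1..n. c (Inl j) * z ^ j) + (\<Sum>j\<le>m. c (Inr j) * cnj z ^ j)))\<^sup>2)) \<partial>Pi\<^sub>M (I \<union> J) coeff_law)
    = ennreal (signed_mean (drift n m x) (discr n m x) / total_sum n m x)"
proof -
  have x: "0 < x" using z by (simp add: x_def)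
  define u where "u = (\<lambda>i :: nat + nat. of_nat (case_sum id id i) * z ^ (case_sum id id i))"
  define v where "v = (\<lambda>i :: nat + nat. of_nat (case_sum id id i) * cnj z ^ (case_sum id id i))"
  define p where "p = (\<lambda>i. case i of Inl j \<Rightarrow> z ^ j | Inr j \<Rightarrow> cnj z ^ j)"
  have fin: "finite I" "finite J" and disj: "I \<inter> J = {}" by (auto simp: I_def J_def)
  have sumI: "(\<Sum>i\<in>I. f i) = (\<Sum>j=1..n. f (Inl j))" for f :: "nat + nat \<Rightarrow> 'b::comm_monoid_add"
    unfolding I_def by (subst sum.reindex) auto
  have sumJ: "(\<Sum>i\<in>J. f i) = (\<Sum>j\<le>m. f (Inr j))" for f :: "nat + nat \<Rightarrow> 'b::comm_monoid_add"
    unfolding J_def by (subst sum.reindex) auto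
  have sumIJ: "(\<Sum>i\<in>I \<union> J. f i) = (\<Sum>j=1..n. f (Inl j)) + (\<Sum>j\<le>m. f (Inr j))" for f :: "nat + nat \<Rightarrow> 'b::comm_monoid_add"
    using fin disj by (simp add: sum.union_disjoint sumI sumJ)
  \<comment> \<open>The term for \<open>j = 0\<close> vanishes in the moments of order one and two
    and equals 1 in the total weight.\<close>
  have drop0: "(\<Sum>j=Suc 0..n. f j) = (\<Sum>j\<le>n. f j) - f 0" for f :: "nat \<Rightarrow> real"
    by (simp add: sum.atLeast1_atMost_eq[symmetric] atLeast0AtMost[symmetric] sum.atLeast_Suc_atMost)
  obtain r1 r2 s :: real and t1 t2 :: complex where r: "0 \<le> r1" "0 \<le> r2" "r1\<^sup>2 = (\<Sum>i\<in>I. (weight i)\<^sup>2 * (cmod (u i))\<^sup>2)"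
    "r2\<^sup>2 = (\<Sum>i\<in>J. (weight i)\<^sup>2 * (cmod (v i))\<^sup>2)"
    "of_real r1 * t1 = (\<Sum>i\<in>I. of_real ((weight i)\<^sup>2) * cnj (u i) * p i)"
    "of_real r2 * t2 = (\<Sum>i\<in>J. of_real ((weight i)\<^sup>2) * cnj (v i) * p i)"
    "(cmod t1)\<^sup>2 + (cmod t2)\<^sup>2 + s\<^sup>2 = (\<Sum>i\<in>I \<union> J. (weight i)\<^sup>2 * (cmod (p i))\<^sup>2)"
    "r2 = 0 \<longrightarrow> t2 = 0"
    and rF: "\<And>F :: complex \<times> complex \<times> complex \<Rightarrow> ennreal. F \<in> borel_measurable (borel \<Otimes>\<^sub>M borel \<Otimes>\<^sub>M borel) \<Longrightarrow>
      (\<integral>\<^sup>+c. F (\<Sum>i\<in>I. c i * u i, \<Sum>i\<in>J. c i * v i, \<Sum>i\<in>I \<union> J. c i * p i) \<partial>Pi\<^sub>M (I \<union> J) coeff_law)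
      = (\<integral>\<^sup>+x. \<integral>\<^sup>+y. \<integral>\<^sup>+w. F (of_real r1 * x, of_real r2 * y, t1 * x + t2 * y + of_real s * w) \<partial>gauss \<partial>gauss \<partial>gauss)"
    using gauss_collapse2[OF fin disj, of weight u v p] by blast
  have zx: "(cmod (z ^ j))\<^sup>2 = x ^ j" for j
    by (simp add: x_def norm_power power_mult[symmetric] mult.commute)
  have zz: "cnj z ^ j * z ^ j = of_real (x ^ j)" for j
  proof -
    have "cnj z * z = of_real x" unfolding x_def by (simp only: complex_norm_square mult.commute)
    then show ?thesis by (simp only: power_mult_distrib[symmetric] of_real_power)
  qed
  have R1: "r1\<^sup>2 = moment_sum 2 n x"
    unfolding r(3) sumI u_def by (simp add: weight_power2 norm_mult power_mult_distrib zx drop0 moment_sum_def)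
  have R2: "r2\<^sup>2 = moment_sum 2 m x"
    unfolding r(4) sumJ v_def
    by (simp add: weight_power2 norm_mult power_mult_distrib zx moment_sum_def flip: complex_cnj_power)
  have Q1: "of_real r1 * t1 = of_real (moment_sum 1 n x)"
  proof -
    have "of_real r1 * t1 = (\<Sum>j=1..n. of_real (real j * x ^ j / fact j))"
      unfolding r(5) sumI u_def p_def weight_power2
      by (intro sum.cong refl) (simp add: zz zz[unfolded mult.commute[of "cnj z ^ _"]])
    also have "\<dots> = of_real (\<Sum>j=1..n. real j * x ^ j / fact j)" by simp
    also have "(\<Sum>j=1..n. real j * x ^ j / fact j) = moment_sum 1 n x"
      by (simp add: drop0 moment_sum_def)
    finally show ?thesis .
  qed
  have Q2: "of_real r2 * t2 = of_real (moment_sum 1 m x)"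
  proof -
    have "of_real r2 * t2 = (\<Sum>j\<le>m. of_real (real j * x ^ j / fact j))"
      unfolding r(6) sumJ v_def p_def weight_power2
      by (intro sum.cong refl) (simp add: zz zz[unfolded mult.commute[of "cnj z ^ _"]])
    also have "\<dots> = of_real (\<Sum>j\<le>m. real j * x ^ j / fact j)" by simp
    also have "(\<Sum>j\<le>m. real j * x ^ j / fact j) = moment_sum 1 m x"
      by (simp add: moment_sum_def)
    finally show ?thesis .
  qed
  \<comment> \<open>The summand 1, the variance of \<open>a 0\<close>, restores the term
    \<open>j = 0\<close> that the holomorphic sum lacks.\<close>
  have S: "1 + s\<^sup>2 + (cmod t1)\<^sup>2 + (cmod t2)\<^sup>2 = total_sum n m x"
  proof -
    have "(cmod t1)\<^sup>2 + (cmod t2)\<^sup>2 + s\<^sup>2 = moment_sum 0 n x - 1 + moment_sum 0 m x"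
      unfolding r(7) sumIJ p_def
      by (simp add: weight_power2 zx drop0 moment_sum_def flip: complex_cnj_power)
    then show ?thesis by (simp add: total_sum_def)
  qed
  \<comment> \<open>The covariance relations determine \<open>t1\<close> and \<open>t2\<close> only
    after multiplication by \<open>r1\<close> and \<open>r2\<close>. The conditional variances need
    just these products, so \<open>r2 = 0\<close> is no exception.\<close>
  have T1: "r1\<^sup>2 * (cmod t1)\<^sup>2 = (moment_sum 1 n x)\<^sup>2"
  proof -
    have "r1\<^sup>2 * (cmod t1)\<^sup>2 = (cmod (of_real r1 * t1))\<^sup>2" by (simp add: norm_mult power_mult_distrib)
    then show ?thesis unfolding Q1 by simp
  qed
  have T2: "r2\<^sup>2 * (cmod t2)\<^sup>2 = (moment_sum 1 m x)\<^sup>2"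
  proof -
    have "r2\<^sup>2 * (cmod t2)\<^sup>2 = (cmod (of_real r2 * t2))\<^sup>2" by (simp add: norm_mult power_mult_distrib)
    then show ?thesis unfolding Q2 by simp
  qed
  have r1: "0 < r1" using R1 moment_sum_pos[OF x n, of 2] r(1) by (cases "r1 = 0") auto
  have S0: "0 < total_sum n m x"
    unfolding total_sum_def using moment_sum_0_pos[of x n] moment_sum_0_pos[of x m] x by simp
  define F :: "complex \<times> complex \<times> complex \<Rightarrow> ennreal" where
    "F = (\<lambda>q. ennreal (\<bar>(cmod (fst q))\<^sup>2 - (cmod (fst (snd q)))\<^sup>2\<bar> * exp (- (cmod (snd (snd q)))\<^sup>2)))"
  have F: "F \<in> borel_measurable (borel \<Otimes>\<^sub>M borel \<Otimes>\<^sub>M borel)" unfolding F_def by measurable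
  have "(\<integral>\<^sup>+c. F (\<Sum>i\<in>I. c i * u i, \<Sum>i\<in>J. c i * v i, \<Sum>i\<in>I \<union> J. c i * p i) \<partial>Pi\<^sub>M (I \<union> J) coeff_law)
    = ennreal (signed_mean ((r1\<^sup>2 * (1 + s\<^sup>2 + (cmod t2)\<^sup>2) - r2\<^sup>2 * (1 + s\<^sup>2 + (cmod t1)\<^sup>2)) / total_sum n m x)
        ((1 + s\<^sup>2) * r1\<^sup>2 * r2\<^sup>2 / total_sum n m x) / total_sum n m x)"
    unfolding rF[OF F] unfolding F_def fst_conv snd_conv
    using gauss_formula[OF r1 r(2,8), where s=s and ?t1.0=t1] by (simp only: S)
  also have "(r1\<^sup>2 * (1 + s\<^sup>2 + (cmod t2)\<^sup>2) - r2\<^sup>2 * (1 + s\<^sup>2 + (cmod t1)\<^sup>2)) / total_sum n m x = drift n m x"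
  proof -
    have "r1\<^sup>2 * (1 + s\<^sup>2 + (cmod t2)\<^sup>2) - r2\<^sup>2 * (1 + s\<^sup>2 + (cmod t1)\<^sup>2)
       = (r1\<^sup>2 - r2\<^sup>2) * (1 + s\<^sup>2 + (cmod t1)\<^sup>2 + (cmod t2)\<^sup>2) - (r1\<^sup>2 * (cmod t1)\<^sup>2 - r2\<^sup>2 * (cmod t2)\<^sup>2)"
      by algebra
    then show ?thesis unfolding S T1 T2 unfolding R1 R2 drift_def using S0 by (simp add: diff_divide_distrib)
  qed
  also have "(1 + s\<^sup>2) * r1\<^sup>2 * r2\<^sup>2 / total_sum n m x = discr n m x"
  proof -
    have "(1 + s\<^sup>2) * r1\<^sup>2 * r2\<^sup>2 = r1\<^sup>2 * r2\<^sup>2 * (1 + s\<^sup>2 + (cmod t1)\<^sup>2 + (cmod t2)\<^sup>2)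
      - ((r1\<^sup>2 * (cmod t1)\<^sup>2) * r2\<^sup>2 + r1\<^sup>2 * (r2\<^sup>2 * (cmod t2)\<^sup>2))" by algebra
    then show ?thesis unfolding S T1 T2 unfolding R1 R2 discr_def using S0 by (simp add: diff_divide_distrib)
  qed
  finally show ?thesis
    unfolding F_def sumI sumJ sumIJ u_def v_def p_def by simp
qed

lemma measurable_moment_sum [measurable]: "moment_sum k N \<in> borel_measurable borel"
  unfolding moment_sum_def by measurable

lemma measurable_total_sum [measurable]: "total_sum n m \<in> borel_measurable borel"
  unfolding total_sum_def by measurable

lemma measurable_drift [measurable]: "drift n m \<in> borel_measurable borel"
  unfolding drift_def by measurable

lemma measurable_discr [measurable]: "discr n m \<in> borel_measurable borel"
  unfolding discr_def by measurable

lemma measurable_signed_mean [measurable (raw)]: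
  assumes [measurable]: "f \<in> borel_measurable M" "g \<in> borel_measurable M"
  shows "(\<lambda>x. signed_mean (f x) (g x)) \<in> borel_measurable M"
  unfolding signed_mean_def by measurable

lemma integrable_gauss_density: "integrable lborel (\<lambda>w :: complex. exp (- (cmod w)\<^sup>2) / pi)"
proof (rule integrableI_nonneg)
  have "(\<integral>\<^sup>+w. ennreal (exp (- (cmod w)\<^sup>2) / pi) \<partial>lborel) = (\<integral>\<^sup>+w. 1 \<partial>gauss)"
    by (subst nn_integral_gauss) auto
  also have "\<dots> = 1" by (simp add: gauss.emeasure_space_1[simplified])
  finally show "(\<integral>\<^sup>+w. ennreal (exp (- (cmod w)\<^sup>2) / pi) \<partial>lborel) < \<infinity>" by simp
qed auto

lemma has_derivative_sum_power:
  fixes c :: "nat \<Rightarrow> complex"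
  shows "((\<lambda>z. \<Sum>j\<in>A. c j * z ^ j) has_derivative (\<lambda>h. (\<Sum>j\<in>A. c j * (of_nat j * z ^ (j - 1))) * h)) (at z within S)"
proof -
  have "((\<lambda>z. \<Sum>j\<in>A. c j * z ^ j) has_derivative (\<lambda>h. \<Sum>j\<in>A. c j * (of_nat j * h * z ^ (j - 1)))) (at z within S)"
    by (intro has_derivative_sum has_derivative_mult_right has_derivative_power has_derivative_ident)
  then show ?thesis by (simp add: sum_distrib_left mult_ac)
qed

section \<open>Conditioning on all coefficients but one\<close>

lemma zeros_given_rest:
  fixes c :: "nat + nat \<Rightarrow> complex" and n m :: nat
  defines "G \<equiv> \<lambda>z. (\<Sum>j=1..n. c (Inl j) * z ^ j) + (\<Sum>j\<le>m. c (Inr j) * cnj z ^ j)"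
  defines "P \<equiv> \<lambda>z. \<Sum>j=1..n. c (Inl j) * (of_nat j * z ^ (j - 1))"
  defines "Q \<equiv> \<lambda>z. \<Sum>j\<le>m. c (Inr j) * (of_nat j * cnj z ^ (j - 1))"
  shows "(\<integral>\<^sup>+y. num_zeros n m (\<lambda>j. (c(Inl 0 := y)) (Inl j)) (\<lambda>j. (c(Inl 0 := y)) (Inr j)) \<partial>coeff_law (Inl 0))
    = (\<integral>\<^sup>+z. ennreal (\<bar>(cmod (P z))\<^sup>2 - (cmod (Q z))\<^sup>2\<bar> * (exp (- (cmod (G z))\<^sup>2) / pi)) \<partial>lborel)"
proof -
  have w0: "weight (Inl 0) = 1" by (simp add: weight_def)
  have hp: "harmonic_poly n m (\<lambda>j. (c(Inl 0 := y)) (Inl j)) (\<lambda>j. (c(Inl 0 := y)) (Inr j)) z = y + G z" for y z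
  proof -
    have "(\<Sum>j\<le>n. (c(Inl 0 := y)) (Inl j) * z ^ j) = y + (\<Sum>j=1..n. c (Inl j) * z ^ j)"
      unfolding atLeast0AtMost[symmetric] by (subst sum.atLeast_Suc_atMost) auto
    then show ?thesis by (simp add: harmonic_poly_def G_def)
  qed
  \<comment> \<open>Solving for \<open>a 0\<close> yields the map \<open>- G\<close>; the sign is
    lost in the end, because Jacobian and density see only moduli.\<close>
  have cnt: "num_zeros n m (\<lambda>j. (c(Inl 0 := y)) (Inl j)) (\<lambda>j. (c(Inl 0 := y)) (Inr j))
      = emeasure (count_space UNIV) {z. - G z = y}" for y
    unfolding num_zeros_def hp by (simp add: eq_neg_iff_add_eq_0 neg_eq_iff_add_eq_0 add.commute)
  have contG: "continuous_on UNIV G" unfolding G_def by (intro continuous_intros)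
  have cm [measurable]: "(\<lambda>y. emeasure (count_space UNIV) {z. - G z = y}) \<in> borel_measurable borel"
  proof -
    have "(\<lambda>y. emeasure (count_space UNIV) {z. y + G z = 0}) \<in> borel_measurable borel"
      by (rule measurable_count_zeros) (auto intro!: continuous_intros contG)
    then show ?thesis by (simp add: neg_eq_iff_add_eq_0 add.commute)
  qed
  have der: "((\<lambda>z. - G z) has_derivative (\<lambda>h. - P z * h + - Q z * cnj h)) (at z)" for z
  proof -
    have "((\<lambda>z. \<Sum>j\<le>m. c (Inr j) * cnj z ^ j) has_derivative (\<lambda>h. Q z * cnj h)) (at z)"
      unfolding Q_def
      by (rule has_derivative_compose[OF bounded_linear.has_derivative[OF bounded_linear_cnj has_derivative_ident]
            has_derivative_sum_power[where c = "\<lambda>j. c (Inr j)"]])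
    moreover have "((\<lambda>z. \<Sum>j=1..n. c (Inl j) * z ^ j) has_derivative (\<lambda>h. P z * h)) (at z)"
      unfolding P_def by (rule has_derivative_sum_power[where c = "\<lambda>j. c (Inl j)"])
    ultimately have "(G has_derivative (\<lambda>h. P z * h + Q z * cnj h)) (at z)"
      unfolding G_def by (intro has_derivative_add)
    from has_derivative_minus[OF this] show ?thesis by simp
  qed
  have "(\<integral>\<^sup>+y. num_zeros n m (\<lambda>j. (c(Inl 0 := y)) (Inl j)) (\<lambda>j. (c(Inl 0 := y)) (Inr j)) \<partial>coeff_law (Inl 0))
    = (\<integral>\<^sup>+y. emeasure (count_space UNIV) {z. - G z = y} \<partial>gauss)"
    unfolding cnt w0 by (subst nn_integral_distr) auto
  also have "\<dots> = (\<integral>\<^sup>+y. emeasure (count_space UNIV) {z. - G z = y} * ennreal (exp (- (cmod y)\<^sup>2) / pi) \<partial>lborel)"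
    by (subst nn_integral_gauss) (auto simp: mult.commute)
  also have "\<dots> = (\<integral>\<^sup>+z. ennreal (\<bar>(cmod (- P z))\<^sup>2 - (cmod (- Q z))\<^sup>2\<bar> * (exp (- (cmod (- G z))\<^sup>2) / pi)) \<partial>lborel)"
  proof (rule area_formula_complex[OF der _ _ integrable_gauss_density _ cm])
    show "continuous_on UNIV (\<lambda>z. - P z)" "continuous_on UNIV (\<lambda>z. - Q z)"
      unfolding P_def Q_def by (intro continuous_intros)+
  qed simp
  finally show ?thesis by simp
qed

theorem expected_zeros_formula:
  assumes wm: "weyl_model M n m a b" and n: "1 \<le> n"
  shows "expected_zeros M n m a b
    = (\<integral>\<^sup>+x\<in>{0..}. ennreal (signed_mean (drift n m x) (discr n m x) / (x * total_sum n m x)) \<partial>lborel)"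
proof -
  interpret product_prob_space coeff_law UNIV
    by (auto intro!: product_prob_spaceI gauss.prob_space_distr)
  define I :: "(nat + nat) set" where "I = Inl ` {1..n} \<union> Inr ` {..m}"
  have ins: "{..n} <+> {..m} = insert (Inl 0) I"
  proof -
    have "{..n} = insert 0 {1..n}" by auto
    then show ?thesis unfolding I_def Plus_def by (simp only: image_insert Un_insert_left)
  qed
  have fin: "finite I" "Inl 0 \<notin> I" by (auto simp: I_def)
  have sf: "sigma_finite_measure (Pi\<^sub>M I coeff_law)" 
    by (intro prob_space_imp_sigma_finite prob_space_PiM gauss.prob_space_distr) measurable
  interpret L: pair_sigma_finite "Pi\<^sub>M I coeff_law" "lborel :: complex measure"
    by (rule pair_sigma_finite.intro[OF sf lborel.sigma_finite_measure_axioms])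
  define G where "G = (\<lambda>(c :: nat + nat \<Rightarrow> complex) z. (\<Sum>j=1..n. c (Inl j) * z ^ j) + (\<Sum>j\<le>m. c (Inr j) * cnj z ^ j))"
  define P where "P = (\<lambda>(c :: nat + nat \<Rightarrow> complex) z. \<Sum>j=1..n. c (Inl j) * (of_nat j * z ^ (j - 1)))"
  define Q where "Q = (\<lambda>(c :: nat + nat \<Rightarrow> complex) z. \<Sum>j\<le>m. c (Inr j) * (of_nat j * cnj z ^ (j - 1)))"
  define K where "K = (\<lambda>c z. ennreal (\<bar>(cmod (P c z))\<^sup>2 - (cmod (Q c z))\<^sup>2\<bar> * (exp (- (cmod (G c z))\<^sup>2) / pi)))"
  have comp: "(\<lambda>p. fst p i) \<in> borel_measurable (Pi\<^sub>M I coeff_law \<Otimes>\<^sub>M lborel)" if "i \<in> I" for i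
  proof -
    have "(\<lambda>c. c i) \<in> measurable (Pi\<^sub>M I coeff_law) (coeff_law i)"
      by (rule measurable_component_singleton[OF that])
    then have "(\<lambda>c. c i) \<in> borel_measurable (Pi\<^sub>M I coeff_law)" by simp
    from measurable_compose[OF measurable_fst this] show ?thesis .
  qed
  have PQG [measurable]: "(\<lambda>p. P (fst p) (snd p)) \<in> borel_measurable (Pi\<^sub>M I coeff_law \<Otimes>\<^sub>M lborel)"
    "(\<lambda>p. Q (fst p) (snd p)) \<in> borel_measurable (Pi\<^sub>M I coeff_law \<Otimes>\<^sub>M lborel)"
    "(\<lambda>p. G (fst p) (snd p)) \<in> borel_measurable (Pi\<^sub>M I coeff_law \<Otimes>\<^sub>M lborel)"
    unfolding P_def Q_def G_def
    by (intro borel_measurable_add borel_measurable_sum borel_measurable_times comp; simp add: I_def)+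
  have Km: "(\<lambda>(c, z). K c z) \<in> borel_measurable (Pi\<^sub>M I coeff_law \<Otimes>\<^sub>M lborel)"
    unfolding K_def case_prod_beta by measurable
  have nm: "(\<lambda>c. num_zeros n m (\<lambda>j. c (Inl j)) (\<lambda>j. c (Inr j))) \<in> borel_measurable (Pi\<^sub>M (insert (Inl 0) I) coeff_law)"
    unfolding num_zeros_def
  proof (rule measurable_count_zeros)
    have comp': "(\<lambda>c. c i) \<in> borel_measurable (Pi\<^sub>M (insert (Inl 0) I) coeff_law)" if "i \<in> insert (Inl 0) I" for i
      using measurable_component_singleton[OF that, of coeff_law] by simp
    fix z show "(\<lambda>c. harmonic_poly n m (\<lambda>j. c (Inl j)) (\<lambda>j. c (Inr j)) z) \<in> borel_measurable (Pi\<^sub>M (insert (Inl 0) I) coeff_law)"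
      unfolding harmonic_poly_def
      by (intro borel_measurable_add borel_measurable_sum borel_measurable_times borel_measurable_const comp')
         (auto simp: ins[symmetric])
    fix c :: "nat + nat \<Rightarrow> complex"
    show "continuous_on UNIV (harmonic_poly n m (\<lambda>j. c (Inl j)) (\<lambda>j. c (Inr j)))"
      unfolding harmonic_poly_def by (intro continuous_intros)
  qed
  define R where "R = (\<lambda>x. signed_mean (drift n m x) (discr n m x) / total_sum n m x)"
  have [measurable]: "R \<in> borel_measurable borel" unfolding R_def by measurable
  \<comment> \<open>Multiplying the derivatives by \<open>z\<close> and \<open>cnj z\<close> brings
    them into the form of \<open>gaussian_jacobian\<close> and costs the squared modulus of
    \<open>z\<close>, the factor \<open>x\<close> in the denominator of the final density.\<close>
  have inner: "(\<integral>\<^sup>+c. K c z \<partial>Pi\<^sub>M I coeff_law) = ennreal (1 / (pi * (cmod z)\<^sup>2) * R ((cmod z)\<^sup>2))" if z: "z \<noteq> 0" for z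
  proof -
    let ?U = "\<lambda>c. \<Sum>j=1..n. c (Inl j) * (of_nat j * z ^ j)" and ?V = "\<lambda>c. \<Sum>j\<le>m. c (Inr j) * (of_nat j * cnj z ^ j)"
    have pw: "of_nat j * y ^ j = y * (of_nat j * y ^ (j - 1))" for j and y :: complex
      by (cases j) auto
    have U: "?U c = z * P c z" for c unfolding P_def by (subst pw) (simp add: sum_distrib_left mult_ac)
    have V: "?V c = cnj z * Q c z" for c unfolding Q_def by (subst pw) (simp add: sum_distrib_left mult_ac)
    have x: "0 < (cmod z)\<^sup>2" using z by simp
    have k: "K c z = ennreal (1 / (pi * (cmod z)\<^sup>2)) *
        ennreal (\<bar>(cmod (?U c))\<^sup>2 - (cmod (?V c))\<^sup>2\<bar> * exp (- (cmod (G c z))\<^sup>2))" for c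
    proof -
      have "\<bar>(cmod (?U c))\<^sup>2 - (cmod (?V c))\<^sup>2\<bar> = (cmod z)\<^sup>2 * \<bar>(cmod (P c z))\<^sup>2 - (cmod (Q c z))\<^sup>2\<bar>"
        unfolding U V norm_mult power_mult_distrib complex_mod_cnj right_diff_distrib[symmetric] abs_mult by simp
      then show ?thesis unfolding K_def using x by (simp add: ennreal_mult[symmetric])
    qed
    have m: "(\<lambda>c. ennreal (\<bar>(cmod (?U c))\<^sup>2 - (cmod (?V c))\<^sup>2\<bar> * exp (- (cmod (G c z))\<^sup>2))) \<in> borel_measurable (Pi\<^sub>M I coeff_law)"
    proof -
      have pair: "(\<lambda>c. (c, z)) \<in> measurable (Pi\<^sub>M I coeff_law) (Pi\<^sub>M I coeff_law \<Otimes>\<^sub>M lborel)" by simp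
      have [measurable]: "(\<lambda>c. P c z) \<in> borel_measurable (Pi\<^sub>M I coeff_law)"
        "(\<lambda>c. Q c z) \<in> borel_measurable (Pi\<^sub>M I coeff_law)" "(\<lambda>c. G c z) \<in> borel_measurable (Pi\<^sub>M I coeff_law)"
        using measurable_compose[OF pair PQG(1)] measurable_compose[OF pair PQG(2)] measurable_compose[OF pair PQG(3)]
        by simp_all
      show ?thesis unfolding U V by measurable
    qed
    have "(\<integral>\<^sup>+c. K c z \<partial>Pi\<^sub>M I coeff_law) = ennreal (1 / (pi * (cmod z)\<^sup>2)) *
      (\<integral>\<^sup>+c. ennreal (\<bar>(cmod (?U c))\<^sup>2 - (cmod (?V c))\<^sup>2\<bar> * exp (- (cmod (G c z))\<^sup>2)) \<partial>Pi\<^sub>M I coeff_law)"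
      unfolding k by (rule nn_integral_cmult[OF m])
    also have "\<dots> = ennreal (1 / (pi * (cmod z)\<^sup>2)) * ennreal (R ((cmod z)\<^sup>2))"
      unfolding G_def I_def R_def gaussian_jacobian[OF z n, of m] ..
    also have "\<dots> = ennreal (1 / (pi * (cmod z)\<^sup>2) * R ((cmod z)\<^sup>2))"
      using x by (subst ennreal_mult') auto
    finally show ?thesis .
  qed
  have "expected_zeros M n m a b
    = (\<integral>\<^sup>+c. num_zeros n m (\<lambda>j. c (Inl j)) (\<lambda>j. c (Inr j)) \<partial>Pi\<^sub>M (insert (Inl 0) I) coeff_law)"
    unfolding weyl_model_law[OF wm] ins ..
  also have "\<dots> = (\<integral>\<^sup>+c. (\<integral>\<^sup>+y. num_zeros n m (\<lambda>j. (c(Inl 0 := y)) (Inl j)) (\<lambda>j. (c(Inl 0 := y)) (Inr j)) \<partial>coeff_law (Inl 0)) \<partial>Pi\<^sub>M I coeff_law)"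
    by (rule product_nn_integral_insert[OF fin nm])
  also have "\<dots> = (\<integral>\<^sup>+c. \<integral>\<^sup>+z. K c z \<partial>lborel \<partial>Pi\<^sub>M I coeff_law)"
    unfolding zeros_given_rest K_def P_def Q_def G_def ..
  also have "\<dots> = (\<integral>\<^sup>+z. \<integral>\<^sup>+c. K c z \<partial>Pi\<^sub>M I coeff_law \<partial>lborel)"
    by (rule L.Fubini'[OF Km, symmetric])
  also have "\<dots> = (\<integral>\<^sup>+z. ennreal (1 / (pi * (cmod z)\<^sup>2) * R ((cmod z)\<^sup>2)) \<partial>lborel)"
    \<comment> \<open>The formula \<open>inner\<close> requires a nonzero point, and the origin is a
      null set.\<close>
    using AE_lborel_singleton[of "0 :: complex"] by (intro nn_integral_cong_AE) (auto simp: inner elim!: eventually_mono)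
  also have "\<dots> = ennreal pi * (\<integral>\<^sup>+x\<in>{0..}. ennreal (1 / (pi * x) * R x) \<partial>lborel)"
    by (subst nn_integral_lborel_radial[where f = "\<lambda>x. ennreal (1 / (pi * x) * R x)"]) auto
  also have "\<dots> = (\<integral>\<^sup>+x. ennreal pi * (ennreal (1 / (pi * x) * R x) * indicator {0..} x) \<partial>lborel)"
    by (rule nn_integral_cmult[symmetric]) measurable
  also have "\<dots> = (\<integral>\<^sup>+x\<in>{0..}. ennreal (signed_mean (drift n m x) (discr n m x) / (x * total_sum n m x)) \<partial>lborel)"
    by (intro nn_integral_cong)
       (auto simp: R_def ennreal_mult'[symmetric] mult.assoc[symmetric] mult.commute split: split_indicator)
  finally show ?thesis .
qed

section \<open>Bounds for truncated Poisson moments\<close>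

text \<open>With \<open>s = sqrt (d\<^sup>2 + 4 * D)\<close> the mean equals
  \<open>(s + d\<^sup>2 / s) / 2\<close>. It is at least \<open>d\<close> by the inequality of
  arithmetic and geometric mean, at least \<open>s / 2\<close>, and at most
  \<open>(s + d) / 2\<close>. The last bound is meant for variances \<open>q\<close> and
  \<open>d + q\<close>, where \<open>D\<close> is at most their product: the mean never exceeds the
  larger variance.\<close>

lemma signed_mean_bounds:
  assumes d: "0 \<le> d" and D: "0 \<le> D"
  shows "d \<le> signed_mean d D" "sqrt D \<le> signed_mean d D" "signed_mean d D \<le> d + sqrt D"
    and "0 \<le> q \<Longrightarrow> D \<le> (d + q) * q \<Longrightarrow> signed_mean d D \<le> d + q"
proof -
  define s where "s = sqrt (d\<^sup>2 + 4 * D)"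
  have s2: "s\<^sup>2 = d\<^sup>2 + 4 * D" and s0: "0 \<le> s" using D by (simp_all add: s_def)
  have ds: "d \<le> s" using D by (intro power2_le_imp_le[OF _ s0]) (simp add: s2)
  have Ds: "2 * sqrt D \<le> s"
    using D by (intro power2_le_imp_le[OF _ s0]) (simp add: s2 power_mult_distrib)
  have sd: "s \<le> d + 2 * sqrt D"
    by (rule power2_le_imp_le) (use d D in \<open>simp_all add: s2 power2_sum power_mult_distrib\<close>)
  \<comment> \<open>If \<open>s = 0\<close>, then \<open>d = 0\<close> and both sides are 0, since
    division by 0 yields 0.\<close>
  have eq: "signed_mean d D = (s + d * (d / s)) / 2"
  proof (cases "s = 0")
    case True
    then show ?thesis using ds d by (simp add: signed_mean_def s_def)
  next
    case False
    have "d\<^sup>2 + 2 * D = (s\<^sup>2 + d\<^sup>2) / 2" using s2 by simp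
    then have "signed_mean d D = (s\<^sup>2 + d\<^sup>2) / 2 / s" by (simp only: signed_mean_def s_def)
    then show ?thesis using False by (simp add: field_simps power2_eq_square)
  qed
  have q1: "d * (d / s) \<le> d" "0 \<le> d * (d / s)"
    using d ds by (auto simp: divide_le_eq intro!: mult_left_mono)
  have am: "2 * d \<le> s + d * (d / s)"
  proof (cases "s = 0")
    case True
    then show ?thesis using ds d by simp
  next
    case False
    then have "s + d * (d / s) - 2 * d = (s - d)\<^sup>2 / s"
      by (simp add: field_simps power2_eq_square)
    also have "\<dots> \<ge> 0" using s0 by simp
    finally show ?thesis by simp
  qed
  show "d \<le> signed_mean d D" using am eq by simp
  show "sqrt D \<le> signed_mean d D" using Ds q1(2) eq by simp
  show "signed_mean d D \<le> d + sqrt D" using sd q1(1) eq by simp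
  show "signed_mean d D \<le> d + q" if q: "0 \<le> q" "D \<le> (d + q) * q"
  proof -
    have "s\<^sup>2 \<le> (d + 2 * q)\<^sup>2" using q(2) unfolding s2 by (simp add: power2_eq_square algebra_simps)
    then have "s \<le> d + 2 * q" by (rule power2_le_imp_le) (use d q(1) in simp)
    then show ?thesis using q1(1) eq by simp
  qed
qed

section \<open>Recursions and inequalities for truncated moments\<close>

lemma moment_sum_nonneg: "0 \<le> x \<Longrightarrow> 0 \<le> moment_sum k N x"
  unfolding moment_sum_def by (intro sum_nonneg) simp

lemma moment_sum_mono: "0 \<le> x \<Longrightarrow> N \<le> N' \<Longrightarrow> moment_sum k N x \<le> moment_sum k N' x"
  unfolding moment_sum_def by (intro sum_mono2) auto

lemma moment_sum_Suc: "moment_sum k (Suc N) x = moment_sum k N x + real (Suc N) ^ k * x ^ Suc N / fact (Suc N)"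
  by (simp add: moment_sum_def)

lemma moment_sum_1_Suc: "moment_sum 1 (Suc N) x = x * moment_sum 0 N x"
proof (induction N)
  case 0
  then show ?case by (simp add: moment_sum_def)
next
  case (Suc N)
  have "real (Suc (Suc N)) * x ^ Suc (Suc N) / fact (Suc (Suc N)) = x * (x ^ Suc N / fact (Suc N))"
    by (simp add: field_simps del: of_nat_Suc)
  then have "moment_sum 1 (Suc (Suc N)) x = x * moment_sum 0 N x + x * (x ^ Suc N / fact (Suc N))"
    using moment_sum_Suc[of 1 "Suc N" x] Suc.IH by (simp only: power_one_right)
  moreover have "moment_sum 0 (Suc N) x = moment_sum 0 N x + x ^ Suc N / fact (Suc N)"
    using moment_sum_Suc[of 0 N x] by (simp only: power_0 mult_1_left)
  ultimately show ?case by (simp only: distrib_left)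
qed

text \<open>Write \<open>j\<^sup>2\<close> as \<open>j + j * (j - 1)\<close>: cancelling against the
  factorial lowers the truncation by one in the first part and by two in the second.\<close>

lemma moment_sum_2_Suc: "moment_sum 2 (Suc (Suc N)) x = x * moment_sum 0 (Suc N) x + x\<^sup>2 * moment_sum 0 N x"
proof (induction N)
  case 0
  then show ?case by (simp add: moment_sum_def power2_eq_square numeral_2_eq_2 algebra_simps)
next
  case (Suc N)
  define M where "M = Suc (Suc N)"
  have f: "(fact (Suc M) :: real) = real (Suc M) * (real M * fact (Suc N))"
    by (simp add: M_def)
  have "(r + 1)\<^sup>2 * (x * (x * y)) / ((r + 1) * (r * f)) = x * (x * y / (r * f)) + x\<^sup>2 * (y / f)"
    if "0 < r" "0 < f" for r f y :: real
    using that by (simp add: divide_simps) algebra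
  from this[of "real M" "fact (Suc N)" "x ^ Suc N"]
  have "real (Suc M) ^ 2 * x ^ Suc M / fact (Suc M) = x * (x ^ M / (real M * fact (Suc N))) + x\<^sup>2 * (x ^ Suc N / fact (Suc N))"
    unfolding f by (simp add: M_def add.commute)
  also have "real M * fact (Suc N) = (fact M :: real)" by (simp add: M_def)
  finally have top: "real (Suc M) ^ 2 * x ^ Suc M / fact (Suc M) = x * (x ^ M / fact M) + x\<^sup>2 * (x ^ Suc N / fact (Suc N))" .
  have a: "moment_sum 0 M x = moment_sum 0 (Suc N) x + x ^ M / fact M"
    and b: "moment_sum 0 (Suc N) x = moment_sum 0 N x + x ^ Suc N / fact (Suc N)"
    using moment_sum_Suc[of 0 "Suc N" x] moment_sum_Suc[of 0 N x] by (simp_all only: power_0 mult_1_left M_def)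
  have "moment_sum 2 (Suc M) x = moment_sum 2 M x + (x * (x ^ M / fact M) + x\<^sup>2 * (x ^ Suc N / fact (Suc N)))"
    by (subst moment_sum_Suc) (simp only: top)
  also have "moment_sum 2 M x = x * moment_sum 0 (Suc N) x + x\<^sup>2 * moment_sum 0 N x"
    unfolding M_def by (rule Suc.IH)
  also have "x * moment_sum 0 (Suc N) x + x\<^sup>2 * moment_sum 0 N x + (x * (x ^ M / fact M) + x\<^sup>2 * (x ^ Suc N / fact (Suc N)))
      = x * (moment_sum 0 (Suc N) x + x ^ M / fact M) + x\<^sup>2 * (moment_sum 0 N x + x ^ Suc N / fact (Suc N))"
    by (simp only: distrib_left add_ac)
  finally show ?case unfolding a[symmetric] b[symmetric] by (simp only: M_def)
qed

text \<open>The variance of the truncated Poisson distribution times the square of the total weight.\<close>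

definition spread :: "nat \<Rightarrow> real \<Rightarrow> real" where
  "spread N x = moment_sum 0 N x * moment_sum 2 N x - (moment_sum 1 N x)\<^sup>2"

text \<open>The variance does not depend on the centre \<open>c\<close>. Taking the mean as centre
  gives the Cauchy-Schwarz inequality, taking the truncation point gives an upper bound for
  \<open>spread\<close>.\<close>

lemma sum_square_product:
  fixes w :: "'i \<Rightarrow> real"
  assumes "finite A"
  shows "(\<Sum>i\<in>A. w i) * (\<Sum>i\<in>A. (f i - c)\<^sup>2 * w i) - ((\<Sum>i\<in>A. f i * w i) - c * (\<Sum>i\<in>A. w i))\<^sup>2
    = (\<Sum>i\<in>A. w i) * (\<Sum>i\<in>A. (f i)\<^sup>2 * w i) - (\<Sum>i\<in>A. f i * w i)\<^sup>2"
proof -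
  have "(\<Sum>i\<in>A. (f i - c)\<^sup>2 * w i) = (\<Sum>i\<in>A. (f i)\<^sup>2 * w i) - 2 * c * (\<Sum>i\<in>A. f i * w i) + c\<^sup>2 * (\<Sum>i\<in>A. w i)"
    by (simp add: power2_diff algebra_simps sum.distrib sum_subtractf sum_distrib_left sum_distrib_right)
  moreover have "W * Q - (F - c * W)\<^sup>2 = W * R - F\<^sup>2" if "Q = R - 2 * c * F + c\<^sup>2 * W" for W Q F R :: real
    unfolding that by algebra
  ultimately show ?thesis by blast
qed

lemma sum_variance_nonneg:
  fixes w :: "'i \<Rightarrow> real"
  assumes fin: "finite A" and w: "\<And>i. i \<in> A \<Longrightarrow> 0 \<le> w i"
  shows "(\<Sum>i\<in>A. f i * w i)\<^sup>2 \<le> (\<Sum>i\<in>A. w i) * (\<Sum>i\<in>A. (f i)\<^sup>2 * w i)"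
proof (cases "(\<Sum>i\<in>A. w i) = 0")
  case True
  then have "\<forall>i\<in>A. w i = 0" using fin w by (simp add: sum_nonneg_eq_0_iff)
  then show ?thesis by simp
next
  case False
  define c where "c = (\<Sum>i\<in>A. f i * w i) / (\<Sum>i\<in>A. w i)"
  have "0 \<le> (\<Sum>i\<in>A. w i) * (\<Sum>i\<in>A. (f i - c)\<^sup>2 * w i)"
    using w by (intro mult_nonneg_nonneg sum_nonneg) auto
  moreover have "(\<Sum>i\<in>A. f i * w i) - c * (\<Sum>i\<in>A. w i) = 0" using False by (simp add: c_def)
  ultimately show ?thesis using sum_square_product[OF fin, of w f c] by simp
qed

lemma spread_nonneg:
  assumes x: "0 \<le> x"
  shows "0 \<le> spread N x"
  using sum_variance_nonneg[of "{..N}" "\<lambda>j. x ^ j / fact j" real] x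
  by (simp add: spread_def moment_sum_def)

lemma spread_le_second_moment:
  assumes x: "0 \<le> x"
  shows "spread N x \<le> moment_sum 0 N x * (\<Sum>j\<le>N. (real j - c)\<^sup>2 * (x ^ j / fact j))"
proof -
  define w where "w = (\<lambda>j. x ^ j / fact j)"
  have "moment_sum 0 N x * (\<Sum>j\<le>N. (real j - c)\<^sup>2 * w j) - (moment_sum 1 N x - c * moment_sum 0 N x)\<^sup>2 = spread N x"
    using sum_square_product[of "{..N}" w real c] by (simp add: spread_def moment_sum_def w_def)
  moreover have "0 \<le> (moment_sum 1 N x - c * moment_sum 0 N x)\<^sup>2" by simp
  ultimately show ?thesis unfolding w_def by linarith
qed

lemma moment_sum_le:
  assumes x: "0 \<le> x" and N: "N \<le> n"
  shows "moment_sum 2 N x \<le> (real n)\<^sup>2 * moment_sum 0 N x" "moment_sum 1 N x \<le> real n * moment_sum 0 N x"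
proof -
  have le: "real j ^ k * x ^ j / fact j \<le> (real n) ^ k * (real j ^ 0 * x ^ j / fact j)" if "j \<in> {..N}" for j k
    using x N that mult_right_mono[OF power_mono[of "real j" "real n" k], of "x ^ j / fact j"] by simp
  show "moment_sum 2 N x \<le> (real n)\<^sup>2 * moment_sum 0 N x"
    unfolding moment_sum_def sum_distrib_left by (intro sum_mono le)
  have "moment_sum 1 N x \<le> real n ^ 1 * moment_sum 0 N x"
    unfolding moment_sum_def sum_distrib_left by (intro sum_mono le)
  then show "moment_sum 1 N x \<le> real n * moment_sum 0 N x" by simp
qed

lemma spread_Suc:
  "spread (Suc (Suc N)) x = x * moment_sum 0 (Suc (Suc N)) x * moment_sum 0 (Suc N) x
    + x\<^sup>2 * (moment_sum 0 (Suc (Suc N)) x * moment_sum 0 N x - (moment_sum 0 (Suc N) x)\<^sup>2)"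
  unfolding spread_def moment_sum_1_Suc moment_sum_2_Suc by (simp add: power2_eq_square algebra_simps)

text \<open>With \<open>v\<close> the last term of the middle sum \<open>A\<close> and
  \<open>w\<close> the next term, the claim reads \<open>w * A \<le> v * (A + w)\<close>. Since
  \<open>(N + 2) * w = v * x\<close>, it follows from the bound
  \<open>x * A \<le> (N + 2) * (A + w)\<close> on the first moment of the longest sum.\<close>

lemma moment_sum_log_concave:
  assumes x: "0 \<le> x"
  shows "moment_sum 0 (Suc (Suc N)) x * moment_sum 0 N x \<le> (moment_sum 0 (Suc N) x)\<^sup>2"
proof -
  define A v w where "A = moment_sum 0 (Suc N) x" and "v = x ^ Suc N / fact (Suc N)"
    and "w = x ^ Suc (Suc N) / fact (Suc (Suc N))"
  have A2: "moment_sum 0 (Suc (Suc N)) x = A + w" and A0: "moment_sum 0 N x = A - v"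
    by (simp_all add: A_def v_def w_def moment_sum_Suc del: fact_Suc)
  have nz: "real (Suc (Suc N)) > 0" by simp
  have w: "real (Suc (Suc N)) * w = v * x"
    unfolding v_def w_def fact_Suc[of "Suc N"] using nz by (simp del: of_nat_Suc fact_Suc)
  have "x * A = moment_sum 1 (Suc (Suc N)) x" by (simp only: A_def moment_sum_1_Suc)
  also have "\<dots> \<le> real (Suc (Suc N)) * (A + w)" using moment_sum_le(2)[OF x order_refl] unfolding A2[symmetric] .
  finally have "v * (x * A) \<le> v * (real (Suc (Suc N)) * (A + w))"
    using x by (intro mult_left_mono) (auto simp: v_def)
  then have "real (Suc (Suc N)) * (w * A) \<le> real (Suc (Suc N)) * (v * (A + w))"
    using w by (simp add: algebra_simps del: of_nat_Suc)
  then have "w * A \<le> v * (A + w)" using nz by (simp only: mult_le_cancel_left_pos)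
  then show ?thesis unfolding A2 A0 A_def[symmetric] by (simp add: power2_eq_square algebra_simps)
qed

text \<open>After normalisation: truncation does not raise the variance above the value
  \<open>x\<close> of the full Poisson law.\<close>

lemma spread_le:
  assumes x: "0 \<le> x" and N: "2 \<le> N"
  shows "spread N x \<le> x * (moment_sum 0 N x)\<^sup>2"
proof -
  obtain K where K: "N = Suc (Suc K)" using N by (metis add_2_eq_Suc le_Suc_ex)
  have "spread N x \<le> x * moment_sum 0 N x * moment_sum 0 (Suc K) x + x\<^sup>2 * 0"
    unfolding K spread_Suc using moment_sum_log_concave[OF x, of K] by (intro add_left_mono mult_left_mono) auto
  also have "\<dots> \<le> x * moment_sum 0 N x * moment_sum 0 N x"
    unfolding K using x moment_sum_mono[OF x, of "Suc K" "Suc (Suc K)" 0] moment_sum_nonneg[OF x]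
    by (simp add: mult_left_mono)
  finally show ?thesis by (simp add: power2_eq_square mult.assoc)
qed

lemma moment_sum_2_le:
  assumes x: "0 \<le> x" and N: "2 \<le> N"
  shows "moment_sum 2 N x \<le> (x + x\<^sup>2) * moment_sum 0 N x"
proof -
  obtain K where K: "N = Suc (Suc K)" using N by (metis add_2_eq_Suc le_Suc_ex)
  have "moment_sum 0 (Suc K) x \<le> moment_sum 0 N x" "moment_sum 0 K x \<le> moment_sum 0 N x"
    using moment_sum_mono[OF x] K by auto
  then show ?thesis unfolding K moment_sum_2_Suc distrib_right
    using x by (intro add_mono mult_left_mono) auto
qed

lemma total_sum_pos: "0 \<le> x \<Longrightarrow> 0 < total_sum n m x"
  unfolding total_sum_def using moment_sum_0_pos[of x] by (simp add: add_pos_pos)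

text \<open>In this form no cancellation is left: both summands are nonnegative, and upper bounds
  for \<open>spread\<close> suffice.\<close>

lemma discr_eq:
  assumes x: "0 \<le> x"
  shows "discr n m x = (moment_sum 2 m x * spread n x + moment_sum 2 n x * spread m x) / total_sum n m x"
proof -
  have "total_sum n m x \<noteq> 0" using total_sum_pos[OF x, of n m] by simp
  then have "discr n m x = (moment_sum 2 n x * moment_sum 2 m x * total_sum n m x
     - ((moment_sum 1 n x)\<^sup>2 * moment_sum 2 m x + moment_sum 2 n x * (moment_sum 1 m x)\<^sup>2)) / total_sum n m x"
    by (simp add: discr_def diff_divide_distrib)
  then show ?thesis by (simp add: spread_def total_sum_def algebra_simps)
qed

lemma discr_nonneg: "0 \<le> x \<Longrightarrow> 0 \<le> discr n m x"
  by (simp add: discr_eq moment_sum_nonneg spread_nonneg less_imp_le total_sum_pos)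

text \<open>Let \<open>d k\<close> be the moments over the indices between \<open>m\<close> and
  \<open>n\<close>. Times \<open>total_sum\<close>, the drift is
  \<open>d 0 * d 2 - (d 1)\<^sup>2\<close>, nonnegative by Cauchy-Schwarz, plus twice a mixed term.
  The latter is nonnegative because the factor \<open>j\<close> is at most \<open>m\<close> in the
  lower sum and at least \<open>m\<close> in the upper one.\<close>

lemma drift_nonneg:
  assumes x: "0 \<le> x" and mn: "m \<le> n"
  shows "0 \<le> drift n m x"
proof -
  define w where "w = (\<lambda>j. x ^ j / fact j)"
  define d where "d = (\<lambda>k. \<Sum>j\<in>{m<..n}. real j ^ k * w j)"
  have w0: "0 \<le> w j" for j using x by (simp add: w_def)
  have split: "moment_sum k n x = moment_sum k m x + d k" for k
  proof -
    have "{..n} = {..m} \<union> {m<..n}" using mn by auto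
    then show ?thesis unfolding moment_sum_def d_def w_def
      by (simp add: sum.union_disjoint ivl_disj_int)
  qed
  have S: "0 < total_sum n m x" by (rule total_sum_pos[OF x])
  have cs: "(d 1)\<^sup>2 \<le> d 0 * d 2"
    using sum_variance_nonneg[of "{m<..n}" w real] w0 by (simp add: d_def)
  have B: "moment_sum 1 m x \<le> real m * moment_sum 0 m x" by (rule moment_sum_le(2)[OF x order_refl])
  have C: "real m * d 1 \<le> d 2"
    unfolding d_def sum_distrib_left using w0
    by (intro sum_mono) (auto simp: power2_eq_square mult.assoc intro!: mult_right_mono)
  have d1: "0 \<le> d 1" unfolding d_def using w0 by (intro sum_nonneg) auto
  have "moment_sum 1 m x * d 1 \<le> real m * moment_sum 0 m x * d 1" using B d1 by (rule mult_right_mono)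
  also have "\<dots> = moment_sum 0 m x * (real m * d 1)" by simp
  also have "\<dots> \<le> moment_sum 0 m x * d 2" using C moment_sum_nonneg[OF x] by (rule mult_left_mono)
  finally have "0 \<le> (d 0 * d 2 - (d 1)\<^sup>2) + 2 * (moment_sum 0 m x * d 2 - moment_sum 1 m x * d 1)"
    using cs by simp
  also have "\<dots> = drift n m x * total_sum n m x"
  proof -
    have "drift n m x * total_sum n m x = (moment_sum 2 n x - moment_sum 2 m x) * total_sum n m x
        - ((moment_sum 1 n x)\<^sup>2 - (moment_sum 1 m x)\<^sup>2)"
    proof -
      have "(u - p / S') * S' = u * S' - p" if "0 < S'" for u p S' :: real
        using that by (simp add: field_simps)
      from this[OF S] show ?thesis by (simp only: drift_def)
    qed
    also have "\<dots> = (d 0 * d 2 - (d 1)\<^sup>2) + 2 * (moment_sum 0 m x * d 2 - moment_sum 1 m x * d 1)"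
      unfolding total_sum_def split[of 0] split[of 1] split[of 2] by algebra
    finally show ?thesis by simp
  qed
  finally show ?thesis using S by (simp add: zero_le_mult_iff)
qed

text \<open>Here \<open>q\<close> is the variance of the antiholomorphic derivative given
  \<open>H(z) = 0\<close>, and \<open>drift n m x + q\<close> that of the holomorphic one. The
  determinant \<open>discr\<close> is their product minus the squared covariance.\<close>

lemma discr_le:
  assumes x: "0 \<le> x" and mn: "m \<le> n"
  defines "q \<equiv> moment_sum 2 m x - (moment_sum 1 m x)\<^sup>2 / total_sum n m x"
  shows "0 \<le> q" "discr n m x \<le> (drift n m x + q) * q" "q \<le> moment_sum 2 m x"
proof -
  have S: "0 < total_sum n m x" by (rule total_sum_pos[OF x])
  have "(moment_sum 1 m x)\<^sup>2 \<le> moment_sum 0 m x * moment_sum 2 m x"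
    using spread_nonneg[OF x, of m] by (simp add: spread_def)
  also have "\<dots> \<le> total_sum n m x * moment_sum 2 m x"
    using moment_sum_nonneg[OF x] by (intro mult_right_mono) (simp_all add: total_sum_def)
  finally show "0 \<le> q" using S by (simp add: q_def divide_le_eq mult.commute)
  show "q \<le> moment_sum 2 m x" using S by (simp add: q_def)
  have "(drift n m x + q) * q - discr n m x = ((moment_sum 1 n x) * (moment_sum 1 m x) / total_sum n m x)\<^sup>2"
    using S unfolding drift_def q_def discr_def by (simp add: field_simps power2_eq_square)
  then show "discr n m x \<le> (drift n m x + q) * q" by (metis diff_ge_0_iff_ge zero_le_power2)
qed

section \<open>Truncated weights at arguments beyond the truncation\<close>

text \<open>The recursion for the second moment gives
  \<open>q * (2 * r ^ 3 + 2 * r\<^sup>2 + r)\<close>, whence the constant 5. The factor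
  \<open>q\<close> survives because the term \<open>k = 0\<close> vanishes; it provides the decay
  for large \<open>x\<close> in \<open>crossing_density_le_far\<close>.\<close>

lemma geometric_second_moment:
  fixes q :: real
  assumes q: "0 \<le> q" "q < 1"
  shows "(\<Sum>k\<le>N. q ^ k) \<le> 1 / (1 - q)" "(\<Sum>k\<le>N. (real k)\<^sup>2 * q ^ k) \<le> 5 * q * (1 / (1 - q)) ^ 3"
proof -
  define r where "r = 1 / (1 - q)"
  have r1: "1 \<le> r" using q by (simp add: r_def)
  have qr: "q * r = r - 1" using q by (simp add: r_def field_simps)
  define T where "T = (\<lambda>i N. \<Sum>k\<le>N. real k ^ i * q ^ k)"
  have shift: "T i (Suc N) = 0 ^ i + q * (\<Sum>k\<le>N. (real k + 1) ^ i * q ^ k)" for i N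
    unfolding T_def sum.atMost_Suc_shift sum_distrib_left
    by (simp add: mult_ac add.commute)
  have T0: "T 0 N \<le> r" for N
  proof (induction N)
    case 0 then show ?case using r1 by (simp add: T_def)
  next
    case (Suc N)
    have "T 0 (Suc N) = 1 + q * T 0 N" unfolding shift by (simp add: T_def)
    also have "\<dots> \<le> 1 + q * r" using Suc q by (simp add: mult_left_mono)
    finally show ?case using qr by simp
  qed
  have T1: "T 1 N \<le> r\<^sup>2" for N
  proof (induction N)
    case 0 then show ?case by (simp add: T_def)
  next
    case (Suc N)
    have "T 1 (Suc N) = q * (T 1 N + T 0 N)" unfolding shift by (simp add: T_def sum.distrib algebra_simps)
    also have "\<dots> \<le> q * (r\<^sup>2 + r)" using Suc T0[of N] q by (intro mult_left_mono add_mono) auto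
    also have "\<dots> = (q * r) * (r + 1)" by (simp add: power2_eq_square algebra_simps)
    also have "\<dots> \<le> r\<^sup>2" unfolding qr by (simp add: power2_eq_square algebra_simps)
    finally show ?case .
  qed
  have rec: "T 2 (Suc N) = q * (T 2 N + 2 * T 1 N + T 0 N)" for N
    unfolding shift by (simp add: T_def sum.distrib sum_distrib_left algebra_simps power2_eq_square)
  have T2: "T 2 N \<le> 2 * r ^ 3" for N
  proof (induction N)
    case 0 then show ?case using r1 by (simp add: T_def)
  next
    case (Suc N)
    have "T 2 (Suc N) \<le> q * (2 * r ^ 3 + 2 * r\<^sup>2 + r)"
      unfolding rec using Suc T0[of N] T1[of N] q by (intro mult_left_mono add_mono) auto
    also have "\<dots> = (q * r) * (2 * r\<^sup>2 + 2 * r + 1)" by (simp add: power2_eq_square power3_eq_cube algebra_simps)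
    also have "\<dots> = 2 * r ^ 3 - r - 1" unfolding qr by (simp add: power2_eq_square power3_eq_cube algebra_simps)
    also have "\<dots> \<le> 2 * r ^ 3" using r1 by simp
    finally show ?case .
  qed
  show "(\<Sum>k\<le>N. q ^ k) \<le> 1 / (1 - q)" using T0[of N] by (simp add: T_def r_def)
  have "T 2 N \<le> 5 * q * r ^ 3"
  proof (cases N)
    case 0 then show ?thesis using q r1 by (simp add: T_def)
  next
    case (Suc K)
    have p: "r \<le> r ^ 3" "r\<^sup>2 \<le> r ^ 3"
      using power_increasing[of 1 3 r] power_increasing[of 2 3 r] r1 by auto
    have "T 2 N \<le> q * (2 * r ^ 3 + 2 * r\<^sup>2 + r)"
      unfolding Suc rec using T2[of K] T0[of K] T1[of K] q by (intro mult_left_mono add_mono) auto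
    also have "\<dots> \<le> q * (5 * r ^ 3)" using p q by (intro mult_left_mono) auto
    finally show ?thesis by simp
  qed
  then show "(\<Sum>k\<le>N. (real k)\<^sup>2 * q ^ k) \<le> 5 * q * (1 / (1 - q)) ^ 3" by (simp add: T_def r_def)
qed

text \<open>Going down by one index multiplies the weight by \<open>j / x\<close>, which is at most
  \<open>N / x\<close>.\<close>

lemma weight_le_geometric:
  assumes x: "0 < x" and j: "j \<le> N"
  shows "x ^ j / fact j \<le> x ^ N / fact N * (real N / x) ^ (N - j)"
  using j
proof (induction rule: dec_induct)
  case base then show ?case by simp
next
  case (step M)
  have nz: "real (Suc M) \<noteq> 0" by simp
  have "x ^ j / fact j \<le> x ^ M / fact M * (real M / x) ^ (M - j)" by (rule step.IH)
  also have "\<dots> = x ^ Suc M / fact (Suc M) * ((real (Suc M) / x) * (real M / x) ^ (M - j))"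
    using x nz by (simp add: field_simps del: of_nat_Suc)
  also have "\<dots> \<le> x ^ Suc M / fact (Suc M) * ((real (Suc M) / x) * (real (Suc M) / x) ^ (M - j))"
    using x by (intro mult_left_mono power_mono divide_right_mono) auto
  also have "\<dots> = x ^ Suc M / fact (Suc M) * (real (Suc M) / x) ^ (Suc M - j)"
    using step.hyps by (simp add: Suc_diff_le)
  finally show ?case .
qed

text \<open>For \<open>x\<close> beyond the truncation the weights decay geometrically downwards
  from the top index. Their mean square distance from \<open>N\<close> is therefore bounded in terms
  of \<open>N / x\<close> alone.\<close>

lemma moment_sum_tail_bounds:
  assumes x: "0 < x" and N: "real N < x"
  defines "q \<equiv> real N / x"
  shows "moment_sum 0 N x \<le> x ^ N / fact N * (1 / (1 - q))"
    "(\<Sum>j\<le>N. (real j - real N)\<^sup>2 * (x ^ j / fact j)) \<le> moment_sum 0 N x * (5 * q * (1 / (1 - q)) ^ 3)"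
proof -
  have q: "0 \<le> q" "q < 1" using x N by (simp_all add: q_def)
  have le: "x ^ j / fact j \<le> x ^ N / fact N * q ^ (N - j)" if "j \<le> N" for j
    using weight_le_geometric[OF x that] by (simp add: q_def)
  have "moment_sum 0 N x \<le> (\<Sum>j\<le>N. x ^ N / fact N * q ^ (N - j))"
    unfolding moment_sum_def using le by (intro sum_mono) auto
  also have "\<dots> = x ^ N / fact N * (\<Sum>k\<le>N. q ^ k)"
    unfolding sum_distrib_left
    by (rule sum.reindex_bij_witness[of _ "\<lambda>k. N - k" "\<lambda>k. N - k"]) auto
  also have "\<dots> \<le> x ^ N / fact N * (1 / (1 - q))"
    using geometric_second_moment(1)[OF q, of N] x by (intro mult_left_mono) auto
  finally show "moment_sum 0 N x \<le> x ^ N / fact N * (1 / (1 - q))" .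
  have "(\<Sum>j\<le>N. (real j - real N)\<^sup>2 * (x ^ j / fact j)) \<le> (\<Sum>j\<le>N. (real j - real N)\<^sup>2 * (x ^ N / fact N * q ^ (N - j)))"
    using le by (intro sum_mono mult_left_mono) auto
  also have "\<dots> = (\<Sum>k\<le>N. (real k)\<^sup>2 * (x ^ N / fact N * q ^ k))"
    by (rule sum.reindex_bij_witness[of _ "\<lambda>k. N - k" "\<lambda>k. N - k"]) (auto simp: of_nat_diff power2_commute)
  also have "\<dots> = x ^ N / fact N * (\<Sum>k\<le>N. (real k)\<^sup>2 * q ^ k)"
    unfolding sum_distrib_left by (intro sum.cong) auto
  also have "\<dots> \<le> x ^ N / fact N * (5 * q * (1 / (1 - q)) ^ 3)"
    using geometric_second_moment(2)[OF q, of N] x by (intro mult_left_mono) auto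
  also have "\<dots> \<le> moment_sum 0 N x * (5 * q * (1 / (1 - q)) ^ 3)"
  proof (rule mult_right_mono)
    show "x ^ N / fact N \<le> moment_sum 0 N x"
      unfolding moment_sum_def using x member_le_sum[of N "{..N}" "\<lambda>j. real j ^ 0 * x ^ j / fact j"] by simp
  qed (use q in simp)
  finally show "(\<Sum>j\<le>N. (real j - real N)\<^sup>2 * (x ^ j / fact j)) \<le> moment_sum 0 N x * (5 * q * (1 / (1 - q)) ^ 3)" .
qed

section \<open>The drift term and fixed degree\<close>

text \<open>The termwise derivative. It agrees with \<open>moment_sum (Suc k) N x / x\<close> but
  also has the right value at \<open>x = 0\<close>, where the fundamental theorem of calculus needs
  it.\<close>

definition moment_deriv :: "nat \<Rightarrow> nat \<Rightarrow> real \<Rightarrow> real" where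
  "moment_deriv k N x = (\<Sum>j\<le>N. real j ^ k * (real j * x ^ (j - 1)) / fact j)"

lemma has_derivative_moment_sum:
  "(moment_sum k N has_real_derivative moment_deriv k N x) (at x)"
  unfolding moment_sum_def[abs_def] moment_deriv_def
  by (intro DERIV_sum DERIV_cdivide DERIV_cmult) (auto intro!: derivative_eq_intros)

lemma moment_deriv_eq: "x * moment_deriv k N x = moment_sum (Suc k) N x"
proof -
  have "x * (real j ^ k * (real j * x ^ (j - 1)) / fact j) = real j ^ Suc k * x ^ j / fact j" for j
    by (cases j) (simp_all add: mult_ac)
  then show ?thesis unfolding moment_deriv_def moment_sum_def sum_distrib_left by (intro sum.cong refl)
qed

lemma measurable_moment_deriv [measurable]: "moment_deriv k N \<in> borel_measurable borel"
  unfolding moment_deriv_def by measurable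

text \<open>The integrand is the derivative of \<open>\<phi>\<close>, which starts at 0. For
  \<open>m < n\<close> the weight of the single index \<open>n\<close> dominates all others at
  infinity, and the quotient tends to \<open>n\<close>. For \<open>m = n\<close> everything cancels
  by symmetry.\<close>

lemma nn_integral_drift:
  assumes mn: "m \<le> n"
  shows "(\<integral>\<^sup>+x\<in>{0..}. ennreal (drift n m x / (x * total_sum n m x)) \<partial>lborel) = ennreal (if m < n then n else 0)"
proof (cases "m < n")
  case False
  then have "m = n" using mn by simp
  then show ?thesis by (simp add: drift_def)
next
  case True
  define \<phi> where "\<phi> = (\<lambda>x. (moment_sum 1 n x - moment_sum 1 m x) / total_sum n m x)"
  define f where "f = (\<lambda>x. ((moment_deriv 1 n x - moment_deriv 1 m x) * total_sum n m x
     - (moment_sum 1 n x - moment_sum 1 m x) * (moment_deriv 0 n x + moment_deriv 0 m x)) / (total_sum n m x)\<^sup>2)"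
  have f: "f x = drift n m x / (x * total_sum n m x)" if x: "0 < x" for x
  proof -
    have S: "0 < total_sum n m x" using x by (intro total_sum_pos) simp
    have "x * f x = ((x * moment_deriv 1 n x - x * moment_deriv 1 m x) * total_sum n m x
     - (moment_sum 1 n x - moment_sum 1 m x) * (x * moment_deriv 0 n x + x * moment_deriv 0 m x)) / (total_sum n m x)\<^sup>2"
      unfolding f_def by (simp add: algebra_simps)
    also have "\<dots> = ((moment_sum 2 n x - moment_sum 2 m x) * total_sum n m x
     - ((moment_sum 1 n x)\<^sup>2 - (moment_sum 1 m x)\<^sup>2)) / (total_sum n m x)\<^sup>2"
      unfolding moment_deriv_eq by (simp add: numeral_2_eq_2 power2_eq_square algebra_simps)
    also have "\<dots> = drift n m x / total_sum n m x"
      using S by (simp add: drift_def power2_eq_square diff_divide_distrib)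
    finally have xf: "x * f x = drift n m x / total_sum n m x" .
    have "f x = x * f x / x" using x by simp
    then show ?thesis unfolding xf by (simp add: mult.commute)
  qed
  have "(\<integral>\<^sup>+x\<in>{0..}. ennreal (drift n m x / (x * total_sum n m x)) \<partial>lborel)
      = (\<integral>\<^sup>+x. ennreal (f x) * indicator {0..} x \<partial>lborel)"
  proof (rule nn_integral_cong_AE)
    show "AE x in lborel. ennreal (drift n m x / (x * total_sum n m x)) * indicator {0..} x = ennreal (f x) * indicator {0..} x"
      using AE_lborel_singleton[of "0 :: real"]
      by eventually_elim (auto simp: f split: split_indicator)
  qed
  also have "\<dots> = ennreal (real n - \<phi> 0)"
  proof (rule nn_integral_FTC_atLeast)
    show "f \<in> borel_measurable borel" unfolding f_def by measurable
    show "(\<phi> has_real_derivative f x) (at x)" if "0 \<le> x" for x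
    proof -
      have S: "total_sum n m x \<noteq> 0" using total_sum_pos[OF that, of n m] by simp
      have dS: "(total_sum n m has_real_derivative moment_deriv 0 n x + moment_deriv 0 m x) (at x)"
        unfolding total_sum_def[abs_def] by (intro DERIV_add has_derivative_moment_sum)
      have dN: "((\<lambda>x. moment_sum 1 n x - moment_sum 1 m x) has_real_derivative moment_deriv 1 n x - moment_deriv 1 m x) (at x)"
        by (intro DERIV_diff has_derivative_moment_sum)
      show ?thesis
        using DERIV_divide[OF dN dS S] unfolding \<phi>_def f_def power2_eq_square .
    qed
    show "0 \<le> f x" if "0 \<le> x" for x
    proof (cases "x = 0")
      case True
      have "moment_sum 1 N 0 = 0" for N unfolding moment_sum_def by (intro sum.neutral) (auto simp: power_0_left)
      moreover have "moment_deriv 1 m 0 \<le> moment_deriv 1 n 0"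
        unfolding moment_deriv_def using mn by (intro sum_mono2) auto
      ultimately show ?thesis using total_sum_pos[of 0 n m] by (simp add: f_def True)
    next
      case False
      then show ?thesis using that drift_nonneg[OF that mn] total_sum_pos[OF that, of n m] by (simp add: f)
    qed
    have bound: "\<bar>\<phi> x - real n\<bar> \<le> (3 * (real n + 1) * (real n)\<^sup>2) / x" if x: "real n \<le> x" for x
    proof -
      have n0: "0 < real n" using True by simp
      then have x0: "0 < x" using x by simp
      define w where "w = (\<lambda>j. x ^ j / fact j)"
      have w0: "0 \<le> w j" for j using x0 by (simp add: w_def)
      have wle: "w j \<le> w n * (real n / x)" if "j < n" for j
      proof -
        have "w j \<le> w n * (real n / x) ^ (n - j)" unfolding w_def using weight_le_geometric[OF x0] that by simp
        also have "\<dots> \<le> w n * (real n / x) ^ 1"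
          using that x x0 w0 by (intro mult_left_mono power_decreasing) auto
        finally show ?thesis by simp
      qed
      have S: "0 < total_sum n m x" using x0 by (intro total_sum_pos) simp
      have wS: "w n \<le> total_sum n m x"
      proof -
        have "w n \<le> moment_sum 0 n x"
          unfolding moment_sum_def w_def using x0 member_le_sum[of n "{..n}" "\<lambda>j. real j ^ 0 * x ^ j / fact j"] by simp
        then show ?thesis using moment_sum_0_pos[of x m] x0 by (simp add: total_sum_def)
      qed
      \<comment> \<open>In the deficit \<open>E\<close> the index \<open>n\<close> of the longer sum
        has coefficient 0, and every other weight is at most \<open>w n * (n / x)\<close>. At most
        \<open>n + 1\<close> terms with coefficient up to \<open>n\<close> and as many with
        coefficient up to \<open>2 * n\<close> give the constant.\<close>
      define E where "E = real n * total_sum n m x - (moment_sum 1 n x - moment_sum 1 m x)"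
      have E: "E = (\<Sum>j\<le>n. (real n - real j) * w j) + (\<Sum>j\<le>m. (real n + real j) * w j)"
        unfolding E_def total_sum_def moment_sum_def w_def
        by (simp add: sum_distrib_left sum_subtractf sum.distrib algebra_simps diff_divide_distrib add_divide_distrib)
      have "0 \<le> E" unfolding E using w0 by (intro add_nonneg_nonneg sum_nonneg) auto
      have "E \<le> (\<Sum>j\<le>n. real n * (w n * (real n / x))) + (\<Sum>j\<le>m. (2 * real n) * (w n * (real n / x)))"
        unfolding E
      proof (intro add_mono sum_mono)
        fix j assume j: "j \<in> {..n}"
        show "(real n - real j) * w j \<le> real n * (w n * (real n / x))"
        proof (cases "j = n")
          case True
          then show ?thesis using w0[of n] x0 by simp
        next
          case False
          then have "w j \<le> w n * (real n / x)" using j by (intro wle) simp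
          then show ?thesis using w0[of j] by (intro mult_mono) auto
        qed
      next
        fix j assume "j \<in> {..m}"
        then show "(real n + real j) * w j \<le> (2 * real n) * (w n * (real n / x))"
          using wle[of j] w0 x0 True by (intro mult_mono) auto
      qed
      also have "\<dots> \<le> (\<Sum>j\<le>n. real n * (w n * (real n / x))) + (\<Sum>j\<le>n. (2 * real n) * (w n * (real n / x)))"
        using mn w0 x0 by (intro add_left_mono sum_mono2) auto
      also have "\<dots> = 3 * (real n + 1) * (real n)\<^sup>2 / x * w n" by (simp add: power2_eq_square algebra_simps add_divide_distrib)
      also have "\<dots> \<le> 3 * (real n + 1) * (real n)\<^sup>2 / x * total_sum n m x"
        using wS x0 by (intro mult_left_mono) auto
      finally have "E / total_sum n m x \<le> 3 * (real n + 1) * (real n)\<^sup>2 / x" using S by (simp add: divide_le_eq)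
      moreover have "\<phi> x - real n = - (E / total_sum n m x)"
        unfolding \<phi>_def E_def using S by (simp add: field_simps)
      ultimately show ?thesis using \<open>0 \<le> E\<close> S by simp
    qed
    have "((\<lambda>x. \<phi> x - real n) \<longlongrightarrow> 0) at_top"
    proof (rule Lim_null_comparison)
      show "\<forall>\<^sub>F x in at_top. norm (\<phi> x - real n) \<le> (3 * (real n + 1) * (real n)\<^sup>2) / x"
        using eventually_ge_at_top[of "real n"] by eventually_elim (use bound in simp)
      show "((\<lambda>x. (3 * (real n + 1) * (real n)\<^sup>2) / x) \<longlongrightarrow> 0) at_top"
        by (intro tendsto_divide_0[OF tendsto_const] filterlim_at_top_imp_at_infinity filterlim_ident)
    qed
    then show "(\<phi> \<longlongrightarrow> real n) at_top" by (rule LIM_zero_cancel)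
  qed
  also have "\<phi> 0 = 0"
  proof -
    have "moment_sum 1 N 0 = 0" for N unfolding moment_sum_def by (intro sum.neutral) (auto simp: power_0_left)
    then show ?thesis by (simp add: \<phi>_def)
  qed
  finally show ?thesis using True by simp
qed

text \<open>Collects the \<open>sqrt D\<close> of the bounds. For comparable degrees it has the
  order \<open>m powr (3 / 2)\<close>, while the drift adds at most \<open>n\<close>.\<close>

definition crossing_integral :: "nat \<Rightarrow> nat \<Rightarrow> ennreal" where
  "crossing_integral n m = (\<integral>\<^sup>+x\<in>{0..}. ennreal (sqrt (discr n m x) / (x * total_sum n m x)) \<partial>lborel)"

lemma expected_zeros_bounds:
  assumes wm: "weyl_model M n m a b" and n: "1 \<le> n" and mn: "m \<le> n"
  shows "crossing_integral n m \<le> expected_zeros M n m a b"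
    and "expected_zeros M n m a b \<le> of_nat n + crossing_integral n m"
    and "m < n \<Longrightarrow> of_nat n \<le> expected_zeros M n m a b"
proof -
  have S: "0 \<le> x * total_sum n m x" if "0 \<le> x" for x using total_sum_pos[OF that, of n m] that by simp
  note sm = signed_mean_bounds[OF drift_nonneg[OF _ mn] discr_nonneg]
  show "crossing_integral n m \<le> expected_zeros M n m a b"
    unfolding crossing_integral_def expected_zeros_formula[OF wm n]
    by (intro nn_integral_mono) (auto split: split_indicator intro!: ennreal_leI divide_right_mono sm S)
  have drift: "(\<integral>\<^sup>+x\<in>{0..}. ennreal (drift n m x / (x * total_sum n m x)) \<partial>lborel) \<le> of_nat n"
    unfolding nn_integral_drift[OF mn] by simp
  have "expected_zeros M n m a b \<le> (\<integral>\<^sup>+x. ennreal (drift n m x / (x * total_sum n m x)) * indicator {0..} x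
      + ennreal (sqrt (discr n m x) / (x * total_sum n m x)) * indicator {0..} x \<partial>lborel)"
    unfolding expected_zeros_formula[OF wm n]
  proof (rule nn_integral_mono)
    fix x
    show "ennreal (signed_mean (drift n m x) (discr n m x) / (x * total_sum n m x)) * indicator {0..} x
      \<le> ennreal (drift n m x / (x * total_sum n m x)) * indicator {0..} x
      + ennreal (sqrt (discr n m x) / (x * total_sum n m x)) * indicator {0..} x"
    proof (cases "0 \<le> x")
      case True
      have "ennreal (signed_mean (drift n m x) (discr n m x) / (x * total_sum n m x))
        \<le> ennreal (drift n m x / (x * total_sum n m x) + sqrt (discr n m x) / (x * total_sum n m x))"
        unfolding add_divide_distrib[symmetric] using True by (intro ennreal_leI divide_right_mono sm S)
      also have "\<dots> = ennreal (drift n m x / (x * total_sum n m x)) + ennreal (sqrt (discr n m x) / (x * total_sum n m x))"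
        using True S[OF True] drift_nonneg[OF True mn] discr_nonneg[OF True] by (intro ennreal_plus) auto
      finally show ?thesis using True by simp
    qed simp
  qed
  also have "\<dots> = (\<integral>\<^sup>+x\<in>{0..}. ennreal (drift n m x / (x * total_sum n m x)) \<partial>lborel) + crossing_integral n m"
    unfolding crossing_integral_def by (rule nn_integral_add) measurable
  also have "\<dots> \<le> of_nat n + crossing_integral n m" using drift by (rule add_right_mono)
  finally show "expected_zeros M n m a b \<le> of_nat n + crossing_integral n m" .
  show "of_nat n \<le> expected_zeros M n m a b" if "m < n"
  proof -
    have "of_nat n = (\<integral>\<^sup>+x\<in>{0..}. ennreal (drift n m x / (x * total_sum n m x)) \<partial>lborel)"
      unfolding nn_integral_drift[OF mn] using that by (simp add: ennreal_of_nat_eq_real_of_nat)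
    also have "\<dots> \<le> expected_zeros M n m a b"
      unfolding expected_zeros_formula[OF wm n]
      by (intro nn_integral_mono) (auto split: split_indicator intro!: ennreal_leI divide_right_mono sm S)
    finally show ?thesis .
  qed
qed

text \<open>The left side is a polynomial in \<open>x\<close> of degree at most
  \<open>m + 1\<close>, which is below \<open>n\<close>, so each of its powers is a multiple of a
  term of \<open>moment_sum 0 n x\<close>. The constant does not depend on \<open>n\<close>, and
  \<open>1 + x\<^sup>2\<close> leaves an integrable majorant.\<close>

lemma moment_deriv_le:
  "\<exists>K\<ge>0. \<forall>n\<ge>m + 2. \<forall>x\<ge>0. (1 + x\<^sup>2) * moment_deriv 1 m x \<le> K * moment_sum 0 n x"
proof -
  \<comment> \<open>The factorials come from bounding \<open>x ^ (j - 1)\<close> and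
    \<open>x ^ (j + 1)\<close>, the two powers of the product with
    \<open>1 + x\<^sup>2\<close>.\<close>
  define c where "c = (\<lambda>j. (real j)\<^sup>2 / fact j * (fact (j - 1) + fact (j + 1)))"
  have "(1 + x\<^sup>2) * moment_deriv 1 m x \<le> (\<Sum>j\<le>m. c j) * moment_sum 0 n x" if n: "m + 2 \<le> n" and x: "0 \<le> x" for n x
  proof -
    have pw: "x ^ i \<le> fact i * moment_sum 0 n x" if "i \<le> n" for i
    proof -
      have "x ^ i / fact i \<le> moment_sum 0 n x"
        unfolding moment_sum_def using x that member_le_sum[of i "{..n}" "\<lambda>j. real j ^ 0 * x ^ j / fact j"] by simp
      then show ?thesis by (simp add: divide_le_eq mult.commute)
    qed
    have "(1 + x\<^sup>2) * (real j ^ 1 * (real j * x ^ (j - 1)) / fact j) \<le> c j * moment_sum 0 n x" if "j \<le> m" for j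
    proof (cases "j = 0")
      case True then show ?thesis by (simp add: c_def)
    next
      case False
      have "(1 + x\<^sup>2) * x ^ (j - 1) = x ^ (j - 1) + x ^ (j + 1)"
        using False by (cases j) (simp_all add: power2_eq_square algebra_simps)
      also have "\<dots> \<le> (fact (j - 1) + fact (j + 1)) * moment_sum 0 n x"
        unfolding distrib_right using that n by (intro add_mono pw) auto
      finally have "(real j)\<^sup>2 / fact j * ((1 + x\<^sup>2) * x ^ (j - 1))
          \<le> (real j)\<^sup>2 / fact j * ((fact (j - 1) + fact (j + 1)) * moment_sum 0 n x)"
        by (intro mult_left_mono) auto
      then show ?thesis by (simp add: c_def power2_eq_square mult_ac)
    qed
    then show ?thesis unfolding moment_deriv_def sum_distrib_left sum_distrib_right by (intro sum_mono) auto
  qed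
  moreover have "0 \<le> (\<Sum>j\<le>m. c j)" unfolding c_def by (intro sum_nonneg) auto
  ultimately show ?thesis by blast
qed

lemma nn_integral_cauchy_density:
  assumes K: "0 \<le> K"
  shows "(\<integral>\<^sup>+x\<in>{0..}. ennreal (K / (1 + x\<^sup>2)) \<partial>lborel) = ennreal (K * (pi / 2))"
proof -
  have "(\<integral>\<^sup>+x\<in>{0..}. ennreal (K / (1 + x\<^sup>2)) \<partial>lborel) = ennreal (K * (pi / 2) - K * arctan 0)"
  proof (rule nn_integral_FTC_atLeast)
    show "((\<lambda>x. K * arctan x) has_real_derivative K / (1 + x\<^sup>2)) (at x)" for x
      by (auto intro!: derivative_eq_intros simp: divide_inverse)
    show "((\<lambda>x. K * arctan x) \<longlongrightarrow> K * (pi / 2)) at_top"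
      by (intro tendsto_intros tendsto_arctan_at_top)
  qed (use K in auto)
  then show ?thesis by simp
qed

text \<open>The bound by the larger variance is used: beyond the drift it costs at most
  \<open>moment_sum 2 m x\<close>, the variance of the antiholomorphic derivative before
  conditioning. Relative to \<open>x * total_sum n m x\<close> this is at most a multiple of the
  Cauchy density, uniformly in \<open>n\<close>.\<close>

lemma expected_zeros_fixed_degree:
  "\<exists>C\<ge>0. \<forall>(M :: 'w measure) n a b. m + 2 \<le> n \<longrightarrow> weyl_model M n m a b \<longrightarrow>
     of_nat n \<le> expected_zeros M n m a b \<and> expected_zeros M n m a b \<le> ennreal (real n + C)"
proof -
  obtain K where K: "0 \<le> K" "\<And>n x. m + 2 \<le> n \<Longrightarrow> 0 \<le> x \<Longrightarrow> (1 + x\<^sup>2) * moment_deriv 1 m x \<le> K * moment_sum 0 n x"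
    using moment_deriv_le[of m] by blast
  have "of_nat n \<le> expected_zeros M n m a b \<and> expected_zeros M n m a b \<le> ennreal (real n + K * (pi / 2))"
    if n: "m + 2 \<le> n" and wm: "weyl_model M n m a b" for M :: "'w measure" and n a b
  proof
    have n1: "1 \<le> n" and mn: "m \<le> n" using n by auto
    show "of_nat n \<le> expected_zeros M n m a b" using n by (intro expected_zeros_bounds(3)[OF wm n1 mn]) simp
    have pt: "signed_mean (drift n m x) (discr n m x) / (x * total_sum n m x)
        \<le> drift n m x / (x * total_sum n m x) + K / (1 + x\<^sup>2)" if x: "0 \<le> x" for x
    proof (cases "x = 0")
      case True then show ?thesis using K(1) by simp
    next
      case False
      then have x0: "0 < x" using x by simp
      have S: "0 < total_sum n m x" by (rule total_sum_pos[OF x])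
      define q where "q = moment_sum 2 m x - (moment_sum 1 m x)\<^sup>2 / total_sum n m x"
      have "signed_mean (drift n m x) (discr n m x) \<le> drift n m x + q"
        unfolding q_def
        by (rule signed_mean_bounds(4)[OF drift_nonneg[OF x mn] discr_nonneg[OF x] discr_le(1)[OF x mn] discr_le(2)[OF x mn]])
      also have "\<dots> \<le> drift n m x + x * moment_deriv 1 m x"
        using discr_le(3)[OF x mn] moment_deriv_eq[of x 1 m] by (simp add: q_def numeral_2_eq_2)
      finally have "signed_mean (drift n m x) (discr n m x) / (x * total_sum n m x)
          \<le> (drift n m x + x * moment_deriv 1 m x) / (x * total_sum n m x)"
        using x S by (intro divide_right_mono) auto
      also have "\<dots> = drift n m x / (x * total_sum n m x) + moment_deriv 1 m x / total_sum n m x"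
        using x0 by (simp add: add_divide_distrib)
      also have "moment_deriv 1 m x / total_sum n m x \<le> K / (1 + x\<^sup>2)"
      proof -
        have "(1 + x\<^sup>2) * moment_deriv 1 m x \<le> K * total_sum n m x"
          using K(2)[OF n x] mult_left_mono[OF less_imp_le[OF moment_sum_0_pos[OF x, of m]] K(1)]
          by (simp add: total_sum_def distrib_left)
        moreover have "0 < 1 + x\<^sup>2" by (simp add: add_pos_nonneg)
        ultimately show ?thesis using S by (simp add: field_simps)
      qed
      finally show ?thesis by simp
    qed
    have "expected_zeros M n m a b \<le> (\<integral>\<^sup>+x. ennreal (drift n m x / (x * total_sum n m x)) * indicator {0..} x
      + ennreal (K / (1 + x\<^sup>2)) * indicator {0..} x \<partial>lborel)"
      unfolding expected_zeros_formula[OF wm n1]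
    proof (rule nn_integral_mono)
      fix x
      show "ennreal (signed_mean (drift n m x) (discr n m x) / (x * total_sum n m x)) * indicator {0..} x
        \<le> ennreal (drift n m x / (x * total_sum n m x)) * indicator {0..} x + ennreal (K / (1 + x\<^sup>2)) * indicator {0..} x"
      proof (cases "0 \<le> x")
        case True
        have "ennreal (signed_mean (drift n m x) (discr n m x) / (x * total_sum n m x))
          \<le> ennreal (drift n m x / (x * total_sum n m x) + K / (1 + x\<^sup>2))"
          by (intro ennreal_leI pt True)
        also have "\<dots> = ennreal (drift n m x / (x * total_sum n m x)) + ennreal (K / (1 + x\<^sup>2))"
          using True drift_nonneg[OF True mn] total_sum_pos[OF True, of n m] K(1) by (intro ennreal_plus) auto
        finally show ?thesis using True by simp
      qed simp
    qed
    also have "\<dots> = (\<integral>\<^sup>+x\<in>{0..}. ennreal (drift n m x / (x * total_sum n m x)) \<partial>lborel)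
       + (\<integral>\<^sup>+x\<in>{0..}. ennreal (K / (1 + x\<^sup>2)) \<partial>lborel)"
      by (rule nn_integral_add) measurable
    also have "\<dots> = ennreal n + ennreal (K * (pi / 2))"
      unfolding nn_integral_drift[OF mn] nn_integral_cauchy_density[OF K(1)] using n by simp
    also have "\<dots> = ennreal (real n + K * (pi / 2))" using K(1) by (intro ennreal_plus[symmetric]) auto
    finally show "expected_zeros M n m a b \<le> ennreal (real n + K * (pi / 2))" .
  qed
  then show ?thesis using K(1) by (intro exI[of _ "K * (pi / 2)"]) auto
qed

lemma expected_zeros_fixed_asymp:
  fixes M :: "nat \<Rightarrow> 'w measure"
  assumes wm: "\<And>n. m \<le> n \<Longrightarrow> weyl_model (M n) n m (a n) (b n)"
  shows "(\<lambda>n. enn2real (expected_zeros (M n) n m (a n) (b n))) \<sim>[at_top] (\<lambda>n. real n)"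
proof (rule asymp_equivI')
  obtain C where C: "0 \<le> C" and CE: "\<And>(M :: 'w measure) n a b. m + 2 \<le> n \<Longrightarrow> weyl_model M n m a b \<Longrightarrow>
     of_nat n \<le> expected_zeros M n m a b \<and> expected_zeros M n m a b \<le> ennreal (real n + C)"
    using expected_zeros_fixed_degree[of m] by blast
  have b: "real n \<le> enn2real (expected_zeros (M n) n m (a n) (b n)) \<and>
      enn2real (expected_zeros (M n) n m (a n) (b n)) \<le> real n + C" if n: "m + 2 \<le> n" for n
  proof -
    note E = CE[OF n wm[of n]]
    have mn: "m \<le> n" using n by simp
    have "enn2real (expected_zeros (M n) n m (a n) (b n)) \<le> real n + C"
      using E[OF mn] C by (intro enn2real_leI) auto
    moreover have "enn2real (of_nat n) \<le> enn2real (expected_zeros (M n) n m (a n) (b n))"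
      using E[OF mn] by (intro enn2real_mono) (auto simp: less_top[symmetric] top_unique)
    ultimately show ?thesis by simp
  qed
  have ev: "eventually (\<lambda>n. m + 2 \<le> n) sequentially" by (rule eventually_ge_at_top)
  show "(\<lambda>n. enn2real (expected_zeros (M n) n m (a n) (b n)) / real n) \<longlonglongrightarrow> 1"
  proof (rule tendsto_sandwich)
    show "eventually (\<lambda>n. 1 \<le> enn2real (expected_zeros (M n) n m (a n) (b n)) / real n) sequentially"
      using ev by eventually_elim (use b in \<open>auto simp: le_divide_eq\<close>)
    show "eventually (\<lambda>n. enn2real (expected_zeros (M n) n m (a n) (b n)) / real n \<le> (real n + C) / real n) sequentially"
      using ev by eventually_elim (use b in \<open>auto intro!: divide_right_mono\<close>)
    show "(\<lambda>n. (real n + C) / real n) \<longlonglongrightarrow> 1" by real_asymp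
  qed simp
qed

section \<open>The crossing density\<close>

definition crossing_density :: "nat \<Rightarrow> nat \<Rightarrow> real \<Rightarrow> real" where
  "crossing_density n m x = sqrt (discr n m x) / (x * total_sum n m x)"

lemma crossing_density_nonneg: "0 \<le> x \<Longrightarrow> 0 \<le> crossing_density n m x"
  unfolding crossing_density_def using total_sum_pos[of x n m] discr_nonneg[of x n m] by simp

lemma crossing_density_le:
  assumes x: "0 < x" and Q: "0 \<le> Q" and le: "discr n m x \<le> Q * (total_sum n m x)\<^sup>2"
  shows "crossing_density n m x \<le> sqrt Q / x"
proof -
  have S: "0 < total_sum n m x" using x by (intro total_sum_pos) simp
  have "sqrt (discr n m x) \<le> sqrt (Q * (total_sum n m x)\<^sup>2)" by (rule real_sqrt_le_mono[OF le])
  also have "\<dots> = sqrt Q * total_sum n m x" using S by (simp add: real_sqrt_mult)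
  finally have "crossing_density n m x \<le> sqrt Q * total_sum n m x / (x * total_sum n m x)"
    unfolding crossing_density_def using x S by (intro divide_right_mono) auto
  then show ?thesis using S by simp
qed

text \<open>The common shape of the estimates below. They differ only in the source of
  \<open>c\<close>, the bound for normalised second moments, and of the two spread bounds.\<close>

lemma discr_le_of_spread:
  assumes x: "0 \<le> x" and c: "0 \<le> c" "0 \<le> u" "0 \<le> v"
    and C: "moment_sum 2 m x \<le> c * moment_sum 0 m x" "moment_sum 2 n x \<le> c * moment_sum 0 n x"
    and Dn: "spread n x \<le> u" and Dm: "spread m x \<le> v"
  shows "discr n m x * total_sum n m x \<le> c * (moment_sum 0 m x * u + moment_sum 0 n x * v)"
proof -
  have S: "0 < total_sum n m x" using x by (rule total_sum_pos)
  have "discr n m x * total_sum n m x = moment_sum 2 m x * spread n x + moment_sum 2 n x * spread m x"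
    using S by (simp add: discr_eq[OF x])
  also have "\<dots> \<le> (c * moment_sum 0 m x) * u + (c * moment_sum 0 n x) * v"
    using c C Dn Dm spread_nonneg[OF x] moment_sum_nonneg[OF x] by (intro add_mono mult_mono) auto
  finally show ?thesis by (simp add: algebra_simps)
qed

section \<open>Bounds for the dominating function\<close>

text \<open>The variance and second moment of the full Poisson law bound the truncated ones; the
  inequality \<open>a * b \<le> (a + b)\<^sup>2 / 4\<close> gives the factor 1/2. This has the order
  of the true density in the bulk, so little is lost.\<close>

lemma crossing_density_le_sqrt:
  assumes x: "0 < x" and m: "2 \<le> m" "m \<le> n"
  shows "crossing_density n m x \<le> sqrt (1 + x) / 2"
proof -
  have x0: "0 \<le> x" using x by simp
  define a b where "a = moment_sum 0 n x" and "b = moment_sum 0 m x"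
  have ab: "0 < a" "0 < b" "total_sum n m x = a + b"
    using moment_sum_0_pos[OF x0] by (auto simp: a_def b_def total_sum_def)
  have "discr n m x * (a + b) \<le> (x + x\<^sup>2) * (b * (x * a\<^sup>2) + a * (x * b\<^sup>2))"
    unfolding ab(3)[symmetric] unfolding a_def b_def
    by (intro discr_le_of_spread moment_sum_2_le spread_le) (use x0 m in auto)
  also have "\<dots> = (x\<^sup>2 * (1 + x) * (a * b)) * (a + b)" by (simp add: power2_eq_square algebra_simps)
  finally have "discr n m x \<le> x\<^sup>2 * (1 + x) * (a * b)" using ab by (simp add: mult_le_cancel_right)
  also have "\<dots> \<le> x\<^sup>2 * (1 + x) * ((a + b)\<^sup>2 / 4)"
  proof (rule mult_left_mono)
    have "0 \<le> (a - b)\<^sup>2" by simp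
    then show "a * b \<le> (a + b)\<^sup>2 / 4" by (simp add: power2_eq_square algebra_simps)
  qed (use x in simp)
  finally have "discr n m x \<le> (x\<^sup>2 * (1 + x) / 4) * (total_sum n m x)\<^sup>2" by (simp add: ab)
  then have "crossing_density n m x \<le> sqrt (x\<^sup>2 * (1 + x) / 4) / x"
    using x by (intro crossing_density_le) auto
  also have "\<dots> = sqrt (1 + x) / 2" using x by (simp add: real_sqrt_mult real_sqrt_divide)
  finally show ?thesis .
qed

lemma spread_le_tail:
  assumes x: "0 < x" and N: "real N < x"
  shows "spread N x \<le> (5 * (real N / x) * (1 / (1 - real N / x)) ^ 3) * (moment_sum 0 N x)\<^sup>2"
proof -
  have "spread N x \<le> moment_sum 0 N x * (\<Sum>j\<le>N. (real j - real N)\<^sup>2 * (x ^ j / fact j))"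
    using x by (intro spread_le_second_moment) simp
  also have "\<dots> \<le> moment_sum 0 N x * (moment_sum 0 N x * (5 * (real N / x) * (1 / (1 - real N / x)) ^ 3))"
    using x by (intro mult_left_mono moment_sum_tail_bounds(2)[OF x N] moment_sum_nonneg) auto
  finally show ?thesis by (simp add: power2_eq_square mult_ac)
qed

text \<open>Beyond \<open>2 * n\<close> both truncated laws cling to their top index, which gives
  decay like \<open>x powr (- 3 / 2)\<close>, integrable at infinity.\<close>

lemma crossing_density_le_far:
  assumes x: "0 < x" "2 * real n \<le> x" and m: "m \<le> n"
  shows "crossing_density n m x \<le> sqrt (10 * (real n / x) ^ 3)"
proof -
  have x0: "0 \<le> x" using x by simp
  define a b where "a = moment_sum 0 n x" and "b = moment_sum 0 m x"
  have ab: "0 < a" "0 < b" "total_sum n m x = a + b"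
    using moment_sum_0_pos[OF x0] by (auto simp: a_def b_def total_sum_def)
  \<comment> \<open>The ratio \<open>N / x\<close> is at most 1/2, so its cubed geometric factor is
    at most 8; hence \<open>40 = 5 * 8\<close>.\<close>
  have sp: "spread N x \<le> (40 * (real n / x)) * (moment_sum 0 N x)\<^sup>2" if N: "N \<le> n" for N
  proof -
    have q: "real N / x \<le> real n / x" "real N / x \<le> 1 / 2" "0 \<le> real N / x"
      using N x by (auto simp: divide_right_mono divide_le_eq)
    have "1 / (1 - y) \<le> 2" if "y \<le> 1 / 2" for y :: real using that by (simp add: divide_le_eq)
    from this[OF q(2)] have "1 / (1 - real N / x) \<le> 2" .
    moreover have q1: "real N / x \<le> 1" using q(2) by linarith
    ultimately have "(1 / (1 - real N / x)) ^ 3 \<le> 2 ^ 3" by (intro power_mono) auto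
    then have "5 * (real N / x) * (1 / (1 - real N / x)) ^ 3 \<le> 5 * (real n / x) * 2 ^ 3"
      using q q1 by (intro mult_mono) auto
    moreover have "real N < x" using N x by linarith
    ultimately show ?thesis
      using spread_le_tail[OF x(1), of N] mult_right_mono[of _ _ "(moment_sum 0 N x)\<^sup>2"] by fastforce
  qed
  have "discr n m x * (a + b) \<le> (real n)\<^sup>2 * (b * (40 * (real n / x) * a\<^sup>2) + a * (40 * (real n / x) * b\<^sup>2))"
    unfolding ab(3)[symmetric] unfolding a_def b_def
    by (intro discr_le_of_spread moment_sum_le sp) (use x0 m in auto)
  also have "\<dots> = (40 * (real n) ^ 3 / x * (a * b)) * (a + b)" by (simp add: power2_eq_square power3_eq_cube algebra_simps add_divide_distrib)
  finally have "discr n m x \<le> 40 * (real n) ^ 3 / x * (a * b)" by (rule mult_right_le_imp_le) (use ab in simp)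
  also have "\<dots> \<le> 40 * (real n) ^ 3 / x * ((a + b)\<^sup>2 / 4)"
  proof (rule mult_left_mono)
    have "0 \<le> (a - b)\<^sup>2" by simp
    then show "a * b \<le> (a + b)\<^sup>2 / 4" by (simp add: power2_eq_square algebra_simps)
  qed (use x in simp)
  finally have "discr n m x \<le> (10 * (real n) ^ 3 / x) * (total_sum n m x)\<^sup>2" by (simp add: ab)
  then have "crossing_density n m x \<le> sqrt (10 * (real n) ^ 3 / x) / x"
    using x by (intro crossing_density_le) auto
  also have "\<dots> = sqrt (10 * (real n) ^ 3 / x) / sqrt (x\<^sup>2)" using x by simp
  also have "\<dots> = sqrt (10 * (real n / x) ^ 3)"
    unfolding real_sqrt_divide[symmetric] by (simp add: power_divide power2_eq_square power3_eq_cube)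
  finally show ?thesis .
qed

section \<open>The density beyond the smaller degree\<close>

text \<open>The weights still increase up to index \<open>x\<close>, so each of the
  \<open>k + 1\<close> indices from \<open>m\<close> to \<open>m + k\<close> carries at least the
  weight of \<open>m\<close>. The lower sum is only a bounded multiple of that weight.\<close>

lemma moment_sum_0_ratio:
  assumes x: "0 < x" and m: "real m < x" and k: "k \<le> n - m" "m \<le> n" "real m + real k \<le> x"
  shows "moment_sum 0 m x * (real k + 1) \<le> 1 / (1 - real m / x) * moment_sum 0 n x"
proof -
  define w where "w = (\<lambda>j. x ^ j / fact j)"
  have w0: "0 \<le> w j" for j using x by (simp add: w_def)
  have up: "w m \<le> w (m + i)" if "i \<le> k" for i
    using that
  proof (induction i)
    case (Suc i)
    have "w M = w (Suc M) * (real (Suc M) / x)" for M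
    proof -
      have "real (Suc M) \<noteq> 0" by simp
      then show ?thesis using x by (simp add: w_def field_simps del: of_nat_Suc)
    qed
    from this[of "m + i"] have rec: "w (m + i) = w (m + Suc i) * (real (m + Suc i) / x)" by simp
    have "w m \<le> w (m + i)" using Suc by simp
    also have "w (m + i) = w (m + Suc i) * (real (m + Suc i) / x)" by (rule rec)
    also have "\<dots> \<le> w (m + Suc i) * 1"
    proof (rule mult_left_mono[OF _ w0])
      show "real (m + Suc i) / x \<le> 1" using Suc.prems k(3) x by (simp add: divide_le_eq)
    qed
    finally show ?case by simp
  qed simp
  have "w m * (real k + 1) = (\<Sum>i\<le>k. w m)" by simp
  also have "\<dots> \<le> (\<Sum>i\<le>k. w (m + i))" using up by (intro sum_mono) auto
  also have "\<dots> = (\<Sum>j\<in>{m..m + k}. w j)"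
    by (rule sum.reindex_bij_witness[of _ "\<lambda>j. j - m" "\<lambda>i. m + i"]) auto
  also have "\<dots> \<le> (\<Sum>j\<le>n. w j)" using w0 k by (intro sum_mono2) auto
  also have "\<dots> = moment_sum 0 n x" by (simp add: moment_sum_def w_def)
  finally have wk: "w m * (real k + 1) \<le> moment_sum 0 n x" .
  have r: "0 \<le> 1 / (1 - real m / x)" using x m by simp
  have "moment_sum 0 m x * (real k + 1) \<le> w m * (1 / (1 - real m / x)) * (real k + 1)"
    using moment_sum_tail_bounds(1)[OF x m] by (intro mult_right_mono) (auto simp: w_def)
  also have "\<dots> = 1 / (1 - real m / x) * (w m * (real k + 1))" by simp
  also have "\<dots> \<le> 1 / (1 - real m / x) * moment_sum 0 n x" using wk r by (rule mult_left_mono)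
  finally show ?thesis .
qed

text \<open>For \<open>t > 1\<close> the spread of the lower sum is bounded after normalisation. The
  spread of the upper sum may be of order \<open>x\<close>, but it is multiplied by the lower sum,
  and with \<open>k\<close> of order \<open>m\<close> the first bound compensates this through
  \<open>moment_sum_0_ratio\<close>. If \<open>n - m\<close> is bounded, the second bound shows that
  the upper sum also stays close to \<open>m\<close>.\<close>

lemma discr_le_beyond:
  fixes t :: real
  assumes t: "1 < t" and m: "1 \<le> m" "m \<le> n"
  defines "x \<equiv> real m * t" and "r \<equiv> 1 / (1 - 1 / t)"
  shows "2 \<le> n \<Longrightarrow> k \<le> n - m \<Longrightarrow> real m + real k \<le> x \<Longrightarrow>
      discr n m x \<le> ((real n)\<^sup>2 * (x * r / (real k + 1) + 5 * r ^ 3)) * (total_sum n m x)\<^sup>2"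
    and "n - m \<le> L \<Longrightarrow> discr n m x \<le> ((real n)\<^sup>2 * (10 * r ^ 3 + (real L)\<^sup>2)) * (total_sum n m x)\<^sup>2"
proof -
  have x: "0 < x" "real m < x" using t m by (simp_all add: x_def)
  then have x0: "0 \<le> x" by simp
  have q: "real m / x = 1 / t" using m by (simp add: x_def)
  have q1: "1 / t < 1" "0 < 1 / t" using t by auto
  have r: "0 < r" using q1 by (simp add: r_def)
  define K where "K = 5 * r ^ 3"
  have K: "0 < K" using r by (simp add: K_def)
  define a b where "a = moment_sum 0 n x" and "b = moment_sum 0 m x"
  have ab: "0 < a" "0 < b" "total_sum n m x = a + b"
    using moment_sum_0_pos[OF x0] by (auto simp: a_def b_def total_sum_def)
  have mb: "(\<Sum>j\<le>m. (real j - real m)\<^sup>2 * (x ^ j / fact j)) \<le> b * K"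
  proof -
    have "(\<Sum>j\<le>m. (real j - real m)\<^sup>2 * (x ^ j / fact j)) \<le> b * (5 * (1 / t) * r ^ 3)"
      using moment_sum_tail_bounds(2)[OF x] unfolding q b_def r_def .
    also have "\<dots> \<le> b * K"
      unfolding K_def using ab t r by (intro mult_left_mono mult_right_mono) (auto simp: divide_le_eq)
    finally show ?thesis .
  qed
  have Dm: "spread m x \<le> K * b\<^sup>2"
  proof -
    have "spread m x \<le> b * (\<Sum>j\<le>m. (real j - real m)\<^sup>2 * (x ^ j / fact j))"
      unfolding b_def by (rule spread_le_second_moment[OF x0])
    also have "\<dots> \<le> b * (b * K)" using mb ab by (intro mult_left_mono) auto
    finally show ?thesis by (simp add: power2_eq_square mult_ac)
  qed
  show "discr n m x \<le> ((real n)\<^sup>2 * (x * r / (real k + 1) + 5 * r ^ 3)) * (total_sum n m x)\<^sup>2"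
    if n: "2 \<le> n" and k: "k \<le> n - m" "real m + real k \<le> x"
  proof -
    have bk: "b \<le> r / (real k + 1) * a"
      using moment_sum_0_ratio[OF x k(1) m(2) k(2)] unfolding q r_def[symmetric] a_def b_def
      by (simp add: field_simps)
    have "discr n m x * (a + b) \<le> (real n)\<^sup>2 * (b * (x * a\<^sup>2) + a * (K * b\<^sup>2))"
      unfolding ab(3)[symmetric] using x0 m n ab Dm K unfolding a_def b_def
      by (intro discr_le_of_spread moment_sum_le spread_le) auto
    also have "\<dots> \<le> (real n)\<^sup>2 * ((r / (real k + 1) * a) * (x * a\<^sup>2) + (a + b) * (K * (a + b)\<^sup>2))"
      using ab x0 K bk by (intro mult_left_mono add_mono mult_mono power_mono) auto
    also have "(r / (real k + 1) * a) * (x * a\<^sup>2) = x * r / (real k + 1) * (a * a\<^sup>2)" by simp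
    also have "(real n)\<^sup>2 * (x * r / (real k + 1) * (a * a\<^sup>2) + (a + b) * (K * (a + b)\<^sup>2))
      \<le> (real n)\<^sup>2 * (x * r / (real k + 1) * ((a + b) * (a + b)\<^sup>2) + (a + b) * (K * (a + b)\<^sup>2))"
      using ab x0 r by (intro mult_left_mono add_right_mono mult_mono power_mono) auto
    also have "\<dots> = ((real n)\<^sup>2 * (x * r / (real k + 1) + K) * (a + b)\<^sup>2) * (a + b)" by (simp only: algebra_simps)
    finally show ?thesis using ab by (simp add: K_def mult_le_cancel_right)
  qed
  show "discr n m x \<le> ((real n)\<^sup>2 * (10 * r ^ 3 + (real L)\<^sup>2)) * (total_sum n m x)\<^sup>2" if L: "n - m \<le> L"
  proof -
    have "(\<Sum>j\<le>n. (real j - real m)\<^sup>2 * (x ^ j / fact j))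
      = (\<Sum>j\<le>m. (real j - real m)\<^sup>2 * (x ^ j / fact j)) + (\<Sum>j\<in>{m<..n}. (real j - real m)\<^sup>2 * (x ^ j / fact j))"
    proof -
      have "{..n} = {..m} \<union> {m<..n}" using m by auto
      then show ?thesis by (simp add: sum.union_disjoint ivl_disj_int)
    qed
    also have "(\<Sum>j\<in>{m<..n}. (real j - real m)\<^sup>2 * (x ^ j / fact j)) \<le> (\<Sum>j\<in>{m<..n}. (real L)\<^sup>2 * (x ^ j / fact j))"
      using L x0 by (intro sum_mono mult_right_mono power_mono) auto
    also have "\<dots> \<le> (\<Sum>j\<in>{..n}. (real L)\<^sup>2 * (x ^ j / fact j))" using x0 by (intro sum_mono2) auto
    also have "\<dots> = (real L)\<^sup>2 * a" by (simp add: a_def moment_sum_def sum_distrib_left)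
    finally have "(\<Sum>j\<le>n. (real j - real m)\<^sup>2 * (x ^ j / fact j)) \<le> b * K + (real L)\<^sup>2 * a"
      using mb by simp
    then have Dn: "spread n x \<le> a * (b * K + (real L)\<^sup>2 * a)"
      using spread_le_second_moment[OF x0, of n "real m"] ab unfolding a_def[symmetric]
      by (meson mult_left_mono order_trans less_imp_le)
    have "discr n m x * (a + b) \<le> (real n)\<^sup>2 * (b * (a * (b * K + (real L)\<^sup>2 * a)) + a * (K * b\<^sup>2))"
      unfolding ab(3)[symmetric] using x0 m ab Dm Dn K unfolding a_def b_def
      by (intro discr_le_of_spread moment_sum_le) auto
    also have "\<dots> \<le> (real n)\<^sup>2 * ((a + b) * ((a + b) * ((a + b) * K + (real L)\<^sup>2 * (a + b))) + (a + b) * (K * (a + b)\<^sup>2))"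
      using ab K by (intro mult_left_mono add_mono mult_mono power_mono) auto
    also have "\<dots> = ((real n)\<^sup>2 * (2 * K + (real L)\<^sup>2) * (a + b)\<^sup>2) * (a + b)" by (simp add: power2_eq_square algebra_simps)
    finally show ?thesis using ab by (simp add: K_def mult_le_cancel_right)
  qed
qed

section \<open>The density below the smaller degree\<close>

text \<open>Chernoff's argument: a term beyond the truncation grows at least by the factor
  \<open>s ^ N\<close> when \<open>x\<close> is replaced by \<open>s * x\<close>.\<close>

lemma exp_tail_le:
  fixes x s :: real
  assumes x: "0 \<le> x" and s: "1 \<le> s"
  shows "s ^ N * (exp x - moment_sum 0 N x) \<le> exp (s * x)"
proof -
  define f where "f = (\<lambda>j. (s ^ j - s ^ N) * (x ^ j / fact j))"
  have e: "(\<lambda>j. y ^ j / fact j) sums exp y" for y :: real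
    using exp_converges[of y] by (simp add: divide_inverse mult.commute)
  have "(\<lambda>j. (s * x) ^ j / fact j - s ^ N * (x ^ j / fact j)) sums (exp (s * x) - s ^ N * exp x)"
    by (intro sums_diff sums_mult e)
  then have fs: "f sums (exp (s * x) - s ^ N * exp x)"
    by (simp add: f_def power_mult_distrib algebra_simps)
  have "- (s ^ N * moment_sum 0 N x) \<le> (\<Sum>j\<le>N. f j)"
    unfolding moment_sum_def f_def sum_distrib_left sum_negf[symmetric]
    using x s by (intro sum_mono) (auto simp: algebra_simps)
  also have "\<dots> \<le> suminf f"
  proof (rule sum_le_suminf)
    show "summable f" using fs by (rule sums_summable)
    show "0 \<le> f j" if "j \<in> - {..N}" for j
      using that x s unfolding f_def by (intro mult_nonneg_nonneg) (auto intro: power_increasing)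
  qed simp
  also have "suminf f = exp (s * x) - s ^ N * exp x" using fs by (rule sums_unique[symmetric])
  finally show ?thesis by (simp add: algebra_simps)
qed

lemma moment_sum_0_le_exp:
  assumes x: "0 \<le> x"
  shows "moment_sum 0 N x \<le> exp x"
proof -
  have e: "(\<lambda>j. x ^ j / fact j) sums exp x"
    using exp_converges[of x] by (simp add: divide_inverse mult.commute)
  have "(\<Sum>j\<le>N. x ^ j / fact j) \<le> suminf (\<lambda>j. x ^ j / fact j)"
    using x by (intro sum_le_suminf sums_summable[OF e]) auto
  then show ?thesis using sums_unique[OF e] by (simp add: moment_sum_def)
qed

lemma bulk_tail:
  fixes t :: real
  assumes t: "0 < t" "t < 1" and m: "2 \<le> m" and N: "m \<le> N + 2"
  defines "x \<equiv> real m * t"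
  shows "0 \<le> 1 - moment_sum 0 N x * exp (- x)" "1 - moment_sum 0 N x * exp (- x) \<le> (t * exp (1 - t)) ^ m / t\<^sup>2"
proof -
  have x: "0 \<le> x" using t by (simp add: x_def)
  have "moment_sum 0 N x * exp (- x) \<le> exp x * exp (- x)"
    using moment_sum_0_le_exp[OF x] by (rule mult_right_mono) simp
  then show "0 \<le> 1 - moment_sum 0 N x * exp (- x)" by (simp add: exp_minus)
  have "(1 / t) ^ N * (exp x - moment_sum 0 N x) \<le> exp (1 / t * x)"
    using t x by (intro exp_tail_le) auto
  then have "exp x - moment_sum 0 N x \<le> t ^ N * exp (real m)"
    using t by (simp add: x_def power_divide field_simps)
  also have "\<dots> \<le> t ^ (m - 2) * exp (real m)"
    using t N by (intro mult_right_mono power_decreasing) auto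
  also have "t ^ (m - 2) = t ^ m / t\<^sup>2" using t m by (simp add: power_diff)
  finally have "(exp x - moment_sum 0 N x) * exp (- x) \<le> t ^ m / t\<^sup>2 * exp (real m) * exp (- x)"
    by (rule mult_right_mono) simp
  also have "(exp x - moment_sum 0 N x) * exp (- x) = 1 - moment_sum 0 N x * exp (- x)"
    by (simp add: left_diff_distrib exp_minus)
  also have "t ^ m / t\<^sup>2 * exp (real m) * exp (- x) = (t * exp (1 - t)) ^ m / t\<^sup>2"
    unfolding power_mult_distrib exp_of_nat_mult[symmetric] x_def
    by (simp add: exp_add[symmetric] algebra_simps)
  finally show "1 - moment_sum 0 N x * exp (- x) \<le> (t * exp (1 - t)) ^ m / t\<^sup>2" .
qed

lemma bulk_limits:
  fixes t :: real and m N :: "nat \<Rightarrow> nat"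
  assumes t: "0 < t" "t < 1" and m: "filterlim m at_top sequentially"
    and N: "\<And>n. m n \<le> N n"
  defines "x \<equiv> \<lambda>n. real (m n) * t"
  shows "(\<lambda>n. moment_sum 0 (N n) (x n) * exp (- x n)) \<longlonglongrightarrow> 1"
    and "(\<lambda>n. moment_sum 2 (N n) (x n) * exp (- x n) / (x n)\<^sup>2) \<longlonglongrightarrow> 1"
    and "(\<lambda>n. spread (N n) (x n) * (exp (- x n))\<^sup>2 / x n) \<longlonglongrightarrow> 1"
proof -
  \<comment> \<open>The Chernoff rate for a Poisson variable of mean \<open>m * t\<close> to exceed
    \<open>m\<close>. It is below 1 because \<open>ln t < t - 1\<close>.\<close>
  define \<rho> where "\<rho> = t * exp (1 - t)"
  have \<rho>: "0 < \<rho>" "\<rho> < 1"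
  proof -
    have "ln t < t - 1" using ln_le_minus_one[of t] ln_eq_minus_one[of t] t by (auto simp: less_le)
    then have "ln \<rho> < 0" using t by (simp add: \<rho>_def ln_mult)
    then show "\<rho> < 1" "0 < \<rho>" using t by (auto simp: \<rho>_def)
  qed
  have pw: "(\<lambda>k. real k * \<rho> ^ k) \<longlonglongrightarrow> 0" using \<rho> by (intro powser_times_n_limit_0) auto
  define e where "e = (\<lambda>n. \<rho> ^ m n / t\<^sup>2)"
  have "((\<lambda>k. \<rho> ^ k) \<longlonglongrightarrow> 0)" using \<rho> by (intro LIMSEQ_power_zero) auto
  from tendsto_divide[OF filterlim_compose[OF this m] tendsto_const[of "t\<^sup>2"]]
  have e0: "e \<longlonglongrightarrow> 0" using t by (simp add: e_def)
  from tendsto_divide[OF tendsto_mult[OF filterlim_compose[OF pw m] tendsto_const[of t]] tendsto_const[of "t\<^sup>2"]]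
  have xe0: "(\<lambda>n. x n * e n) \<longlonglongrightarrow> 0" using t by (simp add: e_def x_def mult_ac)
  have xinf: "filterlim x at_top sequentially"
    unfolding x_def using t
    by (intro filterlim_at_top_mult_tendsto_pos[OF tendsto_const] filterlim_compose[OF filterlim_real_sequentially m]) auto
  then have xinv: "(\<lambda>n. 1 / x n) \<longlonglongrightarrow> 0"
    by (intro tendsto_divide_0[OF tendsto_const] filterlim_at_top_imp_at_infinity)
  have ev: "eventually (\<lambda>n. 2 \<le> m n) sequentially"
    using m by (simp add: filterlim_at_top)
  \<comment> \<open>The index \<open>i\<close> is the number of steps by which the recursions lower
    the truncation; the exponential turns the sums into Poisson probabilities.\<close>
  define A where "A = (\<lambda>i n. moment_sum 0 (N n - i) (x n) * exp (- x n))"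
  have A: "0 \<le> 1 - A i n \<and> 1 - A i n \<le> e n" if "i \<le> 2" "2 \<le> m n" for i n
    using bulk_tail[OF t that(2), of "N n - i"] that N[of n] by (auto simp: A_def e_def \<rho>_def x_def)
  have lim: "A i \<longlonglongrightarrow> 1" if i: "i \<le> 2" for i
  proof -
    have "(\<lambda>n. 1 - A i n) \<longlonglongrightarrow> 0"
    proof (rule tendsto_sandwich[OF _ _ tendsto_const e0])
      show "\<forall>\<^sub>F n in sequentially. 0 \<le> 1 - A i n" using ev by eventually_elim (use A[OF i] in auto)
      show "\<forall>\<^sub>F n in sequentially. 1 - A i n \<le> e n" using ev by eventually_elim (use A[OF i] in auto)
    qed
    from tendsto_diff[OF tendsto_const[of 1] this] show ?thesis by simp
  qed
  show "(\<lambda>n. moment_sum 0 (N n) (x n) * exp (- x n)) \<longlonglongrightarrow> 1" using lim[of 0] by (simp add: A_def)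
  have xpos: "0 < x n" if "2 \<le> m n" for n using that t by (simp add: x_def)
  have NS: "N n = Suc (Suc (N n - 2))" "Suc (N n - 2) = N n - 1" if "2 \<le> m n" for n using N[of n] that by auto
  have "(\<lambda>n. A 1 n * (1 / x n) + A 2 n) \<longlonglongrightarrow> 1 * 0 + 1"
    by (intro tendsto_intros lim xinv) auto
  moreover have "\<forall>\<^sub>F n in sequentially. moment_sum 2 (N n) (x n) * exp (- x n) / (x n)\<^sup>2 = A 1 n * (1 / x n) + A 2 n"
    using ev
  proof eventually_elim
    case (elim n)
    have "moment_sum 2 (N n) (x n) = x n * moment_sum 0 (N n - 1) (x n) + (x n)\<^sup>2 * moment_sum 0 (N n - 2) (x n)"
      using moment_sum_2_Suc[of "N n - 2" "x n"] NS[OF elim] by metis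
    then show ?case using xpos[OF elim] by (simp add: A_def field_simps power2_eq_square)
  qed
  ultimately show "(\<lambda>n. moment_sum 2 (N n) (x n) * exp (- x n) / (x n)\<^sup>2) \<longlonglongrightarrow> 1"
    by (simp add: tendsto_cong)
  \<comment> \<open>In \<open>spread_Suc\<close> this difference carries \<open>x\<^sup>2\<close>,
    one power more than the main term. Since every \<open>A i\<close> misses 1 by an error
    exponentially small in \<open>m\<close>, the extra factor \<open>x\<close> is harmless.\<close>
  have "(\<lambda>n. x n * (A 0 n * A 2 n - (A 1 n)\<^sup>2)) \<longlonglongrightarrow> 0"
  proof (rule Lim_null_comparison)
    show "(\<lambda>n. 2 * (x n * e n)) \<longlonglongrightarrow> 0" using tendsto_mult[OF tendsto_const[of 2] xe0] by simp
    show "\<forall>\<^sub>F n in sequentially. norm (x n * (A 0 n * A 2 n - (A 1 n)\<^sup>2)) \<le> 2 * (x n * e n)"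
      using ev eventually_conj[OF ev order_tendstoD(2)[OF e0 zero_less_one]]
    proof eventually_elim
      case (elim n)
      note a = A[OF _ elim(1)]
      have en: "0 \<le> e n" "e n < 1" using a[of 0] elim(2) by auto
      have prod: "1 - 2 * e n \<le> u * v \<and> u * v \<le> 1" if "0 \<le> 1 - u \<and> 1 - u \<le> e n" "0 \<le> 1 - v \<and> 1 - v \<le> e n" for u v
      proof -
        have "(1 - e n) * (1 - e n) \<le> u * v" using that en by (intro mult_mono) auto
        moreover have "u * v \<le> 1 * 1" using that en by (intro mult_mono) auto
        moreover have "1 - 2 * e n \<le> (1 - e n) * (1 - e n)" by (simp add: algebra_simps)
        ultimately show ?thesis by simp
      qed
      have "\<bar>A 0 n * A 2 n - (A 1 n)\<^sup>2\<bar> \<le> 2 * e n"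
        using prod[OF a[of 0] a[of 2]] prod[OF a[of 1] a[of 1]] by (simp add: power2_eq_square abs_le_iff)
      then have "x n * \<bar>A 0 n * A 2 n - (A 1 n)\<^sup>2\<bar> \<le> x n * (2 * e n)"
        using xpos[OF elim(1)] by (intro mult_left_mono) auto
      then show ?case using xpos[OF elim(1)] by (simp add: abs_mult)
    qed
  qed
  from tendsto_add[OF tendsto_mult[OF lim[of 0] lim[of 1]] this]
  have "(\<lambda>n. A 0 n * A 1 n + x n * (A 0 n * A 2 n - (A 1 n)\<^sup>2)) \<longlonglongrightarrow> 1" by simp
  moreover have "\<forall>\<^sub>F n in sequentially. spread (N n) (x n) * (exp (- x n))\<^sup>2 / x n = A 0 n * A 1 n + x n * (A 0 n * A 2 n - (A 1 n)\<^sup>2)"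
    using ev
  proof eventually_elim
    case (elim n)
    have sp: "spread (N n) (x n) = x n * moment_sum 0 (N n) (x n) * moment_sum 0 (N n - 1) (x n)
      + (x n)\<^sup>2 * (moment_sum 0 (N n) (x n) * moment_sum 0 (N n - 2) (x n) - (moment_sum 0 (N n - 1) (x n))\<^sup>2)"
      using spread_Suc[of "N n - 2" "x n"] NS[OF elim] by metis
    show ?case unfolding sp using xpos[OF elim] by (simp add: A_def field_simps power2_eq_square)
  qed
  ultimately show "(\<lambda>n. spread (N n) (x n) * (exp (- x n))\<^sup>2 / x n) \<longlonglongrightarrow> 1"
    by (simp add: tendsto_cong)
qed

text \<open>By \<open>bulk_limits\<close> second moments behave like
  \<open>x\<^sup>2 * exp x\<close>, spreads like \<open>x * exp (2 * x)\<close> and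
  \<open>total_sum\<close> like \<open>2 * exp x\<close>. So \<open>discr\<close> is asymptotic to
  \<open>x ^ 3 * exp (2 * x)\<close> and the density to \<open>sqrt x / 2\<close>.\<close>

lemma crossing_density_bulk:
  fixes t :: real and m :: "nat \<Rightarrow> nat"
  assumes t: "0 < t" "t < 1" and m: "filterlim m at_top sequentially" and mn: "\<And>n. m n \<le> n"
  shows "(\<lambda>n. crossing_density n (m n) (real (m n) * t) / sqrt (real (m n))) \<longlonglongrightarrow> sqrt t / 2"
proof -
  define x where "x = (\<lambda>n. real (m n) * t)"
  define E where "E = (\<lambda>n. exp (- x n))"
  note Ln = bulk_limits[OF t m mn] and Lm = bulk_limits[OF t m order_refl]
  define c where "c = (\<lambda>k n. moment_sum 2 (k n) (x n) * E n / (x n)\<^sup>2)"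
  define \<delta> where "\<delta> = (\<lambda>k n. spread (k n) (x n) * (E n)\<^sup>2 / x n)"
  define S where "S = (\<lambda>n. total_sum n (m n) (x n) * E n)"
  have "S \<longlonglongrightarrow> 1 + 1"
    using tendsto_add[OF Ln(1) Lm(1)] by (simp add: S_def total_sum_def E_def x_def distrib_right)
  then have "(\<lambda>n. sqrt t * sqrt ((c m n * \<delta> id n + c id n * \<delta> m n) / S n ^ 3)) \<longlonglongrightarrow> sqrt t * sqrt ((1 * 1 + 1 * 1) / (1 + 1) ^ 3)"
    unfolding c_def \<delta>_def E_def id_def x_def using Ln Lm
    by (intro tendsto_mult tendsto_const tendsto_real_sqrt tendsto_divide tendsto_add tendsto_power) auto
  also have "sqrt t * sqrt ((1 * 1 + 1 * 1) / (1 + 1) ^ 3) = sqrt t / 2"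
  proof -
    have "(1 * 1 + 1 * 1) / (1 + 1) ^ 3 = (1 / 2 :: real)\<^sup>2" by (simp add: power3_eq_cube power2_eq_square)
    then show ?thesis by (simp only: real_sqrt_abs)
  qed
  finally have lim: "(\<lambda>n. sqrt t * sqrt ((c m n * \<delta> id n + c id n * \<delta> m n) / S n ^ 3)) \<longlonglongrightarrow> sqrt t / 2" .
  have "\<forall>\<^sub>F n in sequentially. 1 \<le> m n" using m by (simp add: filterlim_at_top)
  then have "\<forall>\<^sub>F n in sequentially. crossing_density n (m n) (x n) / sqrt (real (m n))
      = sqrt t * sqrt ((c m n * \<delta> id n + c id n * \<delta> m n) / S n ^ 3)"
  proof eventually_elim
    case (elim n)
    have x: "0 < x n" using elim t by (simp add: x_def)
    have T: "0 < total_sum n (m n) (x n)" using x by (intro total_sum_pos) simp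
    have E: "0 < E n" by (simp add: E_def)
    have "(c m n * \<delta> id n + c id n * \<delta> m n) / S n ^ 3 = discr n (m n) (x n) / ((x n) ^ 3 * (total_sum n (m n) (x n))\<^sup>2)"
    proof -
      have "c m n * \<delta> id n + c id n * \<delta> m n
        = (moment_sum 2 (m n) (x n) * spread n (x n) + moment_sum 2 n (x n) * spread (m n) (x n)) * (E n ^ 3 / x n ^ 3)"
        unfolding c_def \<delta>_def using x by (simp add: field_simps power2_eq_square power3_eq_cube)
      also have "moment_sum 2 (m n) (x n) * spread n (x n) + moment_sum 2 n (x n) * spread (m n) (x n)
          = discr n (m n) (x n) * total_sum n (m n) (x n)"
        using T x by (simp add: discr_eq)
      finally have num: "c m n * \<delta> id n + c id n * \<delta> m n
        = discr n (m n) (x n) * total_sum n (m n) (x n) * (E n ^ 3 / x n ^ 3)" .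
      show ?thesis unfolding num S_def using T E x by (simp add: field_simps power2_eq_square power3_eq_cube)
    qed
    also have "\<dots> = discr n (m n) (x n) / (x n * total_sum n (m n) (x n))\<^sup>2 / x n"
      by (simp add: power2_eq_square power3_eq_cube)
    finally have eq: "(c m n * \<delta> id n + c id n * \<delta> m n) / S n ^ 3 = discr n (m n) (x n) / (x n * total_sum n (m n) (x n))\<^sup>2 / x n" .
    have "sqrt (discr n (m n) (x n) / (x n * total_sum n (m n) (x n))\<^sup>2 / x n) = crossing_density n (m n) (x n) / sqrt (x n)"
      using T x by (simp add: crossing_density_def real_sqrt_divide real_sqrt_mult)
    moreover have "sqrt (x n) = sqrt (real (m n)) * sqrt t" by (simp add: x_def real_sqrt_mult)
    ultimately show ?case unfolding eq using t by simp
  qed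
  from iffD2[OF tendsto_cong[OF this] lim] show ?thesis unfolding x_def .
qed

text \<open>In both cases of \<open>gap\<close>, \<open>discr_le_beyond\<close> bounds
  \<open>discr\<close> by a constant times \<open>n\<^sup>2\<close> and the squared total. Division
  by \<open>x = m * t\<close> with \<open>n \<le> \<kappa> * m\<close> keeps the density bounded, so
  it vanishes against \<open>sqrt m\<close>.\<close>

lemma crossing_density_beyond:
  fixes t \<kappa> :: real and m :: "nat \<Rightarrow> nat"
  assumes t: "1 < t" and m: "filterlim m at_top sequentially" and mn: "\<And>n. m n \<le> n"
    and \<kappa>: "\<forall>\<^sub>F n in sequentially. real n \<le> \<kappa> * real (m n)"
    and gap: "(\<exists>L. \<forall>\<^sub>F n in sequentially. n - m n \<le> L) \<or> (\<exists>c>0. \<forall>\<^sub>F n in sequentially. c * real n \<le> real (n - m n))"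
  shows "(\<lambda>n. crossing_density n (m n) (real (m n) * t) / sqrt (real (m n))) \<longlonglongrightarrow> 0"
proof -
  define r where "r = 1 / (1 - 1 / t)"
  have r: "0 < r" using t by (simp add: r_def)
  have ev: "\<forall>\<^sub>F n in sequentially. 2 \<le> m n" using m by (simp add: filterlim_at_top)
  obtain Q where Q: "0 \<le> Q" "\<forall>\<^sub>F n in sequentially. discr n (m n) (real (m n) * t) \<le> ((real n)\<^sup>2 * Q) * (total_sum n (m n) (real (m n) * t))\<^sup>2"
    using gap
  proof (elim disjE exE conjE)
    fix L assume L: "\<forall>\<^sub>F n in sequentially. n - m n \<le> L"
    show ?thesis
    proof (rule that[of "10 * r ^ 3 + (real L)\<^sup>2"])
      show "0 \<le> 10 * r ^ 3 + (real L)\<^sup>2" using r by simp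
      show "\<forall>\<^sub>F n in sequentially. discr n (m n) (real (m n) * t)
          \<le> ((real n)\<^sup>2 * (10 * r ^ 3 + (real L)\<^sup>2)) * (total_sum n (m n) (real (m n) * t))\<^sup>2"
        using L ev by eventually_elim (use discr_le_beyond(2)[OF t _ mn] in \<open>simp add: r_def\<close>)
    qed
  next
    fix c assume c: "0 < c" "\<forall>\<^sub>F n in sequentially. c * real n \<le> real (n - m n)"
    \<comment> \<open>The \<open>k\<close> further indices, about \<open>d * m\<close> of them, must
      fit both below \<open>n\<close> and below \<open>x = m * t\<close>; the two entries of the
      minimum take care of this.\<close>
    define d where "d = min c (t - 1)"
    have d: "0 < d" "d \<le> c" "d \<le> t - 1" using c t by (auto simp: d_def)
    show ?thesis
    proof (rule that[of "t * r / d + 5 * r ^ 3"])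
      show "0 \<le> t * r / d + 5 * r ^ 3" using r d t by simp
      show "\<forall>\<^sub>F n in sequentially. discr n (m n) (real (m n) * t)
          \<le> ((real n)\<^sup>2 * (t * r / d + 5 * r ^ 3)) * (total_sum n (m n) (real (m n) * t))\<^sup>2"
        using c(2) ev
      proof eventually_elim
        case (elim n)
        define k where "k = nat \<lfloor>d * real (m n)\<rfloor>"
        have k: "real k \<le> d * real (m n)" "d * real (m n) \<le> real k + 1"
          using d by (auto simp: k_def)
        have "d * real (m n) \<le> c * real n" using d mn[of n] c(1) by (intro mult_mono) auto
        then have "real k \<le> real (n - m n)" using k(1) elim(1) by linarith
        then have kn: "k \<le> n - m n" by simp
        have "d * real (m n) \<le> (t - 1) * real (m n)" using d by (intro mult_right_mono) auto
        then have km: "real (m n) + real k \<le> real (m n) * t" using k(1) by (simp add: algebra_simps)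
        have "discr n (m n) (real (m n) * t) \<le> ((real n)\<^sup>2 * (real (m n) * t * r / (real k + 1) + 5 * r ^ 3)) * (total_sum n (m n) (real (m n) * t))\<^sup>2"
          using discr_le_beyond(1)[OF t _ mn _ kn km] elim(2) mn[of n] by (simp add: r_def)
        also have "\<dots> \<le> ((real n)\<^sup>2 * (t * r / d + 5 * r ^ 3)) * (total_sum n (m n) (real (m n) * t))\<^sup>2"
        proof (intro mult_right_mono mult_left_mono add_right_mono)
          have "real (m n) * (t * r) * d \<le> (t * r) * (real k + 1)"
            using mult_left_mono[OF k(2), of "t * r"] t r by (simp add: mult_ac)
          then show "real (m n) * t * r / (real k + 1) \<le> t * r / d"
            using d by (simp add: field_simps)
        qed auto
        finally show ?case .
      qed
    qed
  qed
  have bound: "\<forall>\<^sub>F n in sequentially. norm (crossing_density n (m n) (real (m n) * t) / sqrt (real (m n)))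
      \<le> (\<bar>\<kappa>\<bar> * sqrt Q / t) * (1 / sqrt (real (m n)))"
    using Q(2) ev \<kappa>
  proof eventually_elim
    case (elim n)
    have x: "0 < real (m n) * t" using elim t by simp
    have "crossing_density n (m n) (real (m n) * t) \<le> sqrt ((real n)\<^sup>2 * Q) / (real (m n) * t)"
      using elim(1) Q(1) by (intro crossing_density_le[OF x]) auto
    also have "\<dots> = (real n / real (m n)) * (sqrt Q / t)" by (simp add: real_sqrt_mult)
    also have "\<dots> \<le> \<bar>\<kappa>\<bar> * (sqrt Q / t)"
    proof (rule mult_right_mono)
      have "real n \<le> \<bar>\<kappa>\<bar> * real (m n)" using elim(3) mult_right_mono[OF abs_ge_self, of "real (m n)" \<kappa>] by linarith
      then show "real n / real (m n) \<le> \<bar>\<kappa>\<bar>" using elim(2) by (simp add: divide_le_eq)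
    qed (use Q(1) t in simp)
    finally have "crossing_density n (m n) (real (m n) * t) / sqrt (real (m n)) \<le> \<bar>\<kappa>\<bar> * (sqrt Q / t) / sqrt (real (m n))"
      by (rule divide_right_mono) simp
    then show ?case using crossing_density_nonneg[of "real (m n) * t" n "m n"] x by simp
  qed
  have "filterlim (\<lambda>n. sqrt (real (m n))) at_top sequentially"
    by (intro filterlim_compose[OF sqrt_at_top] filterlim_compose[OF filterlim_real_sequentially m])
  then have "(\<lambda>n. 1 / sqrt (real (m n))) \<longlonglongrightarrow> 0"
    by (intro tendsto_divide_0[OF tendsto_const] filterlim_at_top_imp_at_infinity)
  then have "(\<lambda>n. (\<bar>\<kappa>\<bar> * sqrt Q / t) * (1 / sqrt (real (m n)))) \<longlonglongrightarrow> 0" by (rule tendsto_mult_right_zero)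
  then show ?thesis by (rule Lim_null_comparison[OF bound])
qed

section \<open>Proportional degrees\<close>

lemma measurable_crossing_density [measurable]: "crossing_density n m \<in> borel_measurable borel"
  unfolding crossing_density_def[abs_def] by measurable

lemma nn_integral_half_sqrt:
  "(\<integral>\<^sup>+t. ennreal (if 0 < t \<and> t < 1 then sqrt t / 2 else 0) \<partial>lborel) = ennreal (1 / 3)"
proof -
  have "((\<lambda>t. sqrt t / 2) has_integral (sqrt 1 * 1 / 3 - sqrt 0 * 0 / 3)) {0..1}"
  proof (rule fundamental_theorem_of_calculus_interior)
    show "continuous_on {0..1} (\<lambda>t. sqrt t * t / 3)" by (auto intro!: continuous_intros)
    fix t :: real assume t: "t \<in> {0<..<1}"
    have "((\<lambda>t. sqrt t * t / 3) has_real_derivative (inverse (sqrt t) / 2 * t + sqrt t) / 3) (at t)"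
      using t by (auto intro!: derivative_eq_intros)
    moreover have "(inverse (sqrt t) / 2 * t + sqrt t) / 3 = sqrt t / 2"
    proof -
      have "inverse (sqrt t) * t = sqrt t"
        using t by (metis divide_inverse greaterThanLessThan_iff less_imp_le mult.commute real_div_sqrt)
      then show ?thesis by simp
    qed
    ultimately show "((\<lambda>t. sqrt t * t / 3) has_vector_derivative sqrt t / 2) (at t)"
      by (simp add: has_real_derivative_iff_has_vector_derivative)
  qed simp
  then have "((\<lambda>t. if t \<in> {0..1} then sqrt t / 2 else 0) has_integral 1 / 3) UNIV"
    by (subst has_integral_restrict_UNIV) simp
  then have "(\<integral>\<^sup>+t. ennreal (if t \<in> {0..1} then sqrt t / 2 else 0) \<partial>lborel) = ennreal (1 / 3)"
    by (intro nn_integral_has_integral_lborel) auto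
  moreover have "(\<integral>\<^sup>+t. ennreal (if 0 < t \<and> t < 1 then sqrt t / 2 else 0) \<partial>lborel)
      = (\<integral>\<^sup>+t. ennreal (if t \<in> {0..1} then sqrt t / 2 else 0) \<partial>lborel)"
  proof (rule nn_integral_cong_AE)
    show "AE t in lborel. ennreal (if 0 < t \<and> t < 1 then sqrt t / 2 else 0) = ennreal (if t \<in> {0..1} then sqrt t / 2 else 0)"
      using AE_lborel_singleton[of "0 :: real"] AE_lborel_singleton[of "1 :: real"]
      by eventually_elim auto
  qed
  ultimately show ?thesis by simp
qed

section \<open>Dominated convergence after rescaling\<close>

text \<open>The bound \<open>crossing_density_le_sqrt\<close> is used for \<open>t\<close> up to
  \<open>2 * \<kappa>\<close>. Beyond, \<open>n \<le> \<kappa> * m\<close> gives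
  \<open>m * t \<ge> 2 * n\<close>, and \<open>crossing_density_le_far\<close> takes over.\<close>

definition dominator :: "real \<Rightarrow> real \<Rightarrow> ennreal" where
  "dominator \<kappa> t = ennreal (sqrt (1 + 2 * \<kappa>) / 2) * indicator {0..2 * \<kappa>} t
     + ennreal (sqrt (10 * \<kappa> ^ 3) * (1 / (t * sqrt t))) * indicator {2 * \<kappa>..} t"

lemma nn_integral_dominator:
  assumes \<kappa>: "0 < \<kappa>"
  shows "(\<integral>\<^sup>+t. dominator \<kappa> t \<partial>lborel) < \<infinity>"
proof -
  have "(\<integral>\<^sup>+t. dominator \<kappa> t \<partial>lborel)
    = (\<integral>\<^sup>+t. ennreal (sqrt (1 + 2 * \<kappa>) / 2) * indicator {0..2 * \<kappa>} t \<partial>lborel)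
    + (\<integral>\<^sup>+t. ennreal (sqrt (10 * \<kappa> ^ 3) * (1 / (t * sqrt t))) * indicator {2 * \<kappa>..} t \<partial>lborel)"
    unfolding dominator_def by (rule nn_integral_add) measurable
  also have "(\<integral>\<^sup>+t. ennreal (sqrt (1 + 2 * \<kappa>) / 2) * indicator {0..2 * \<kappa>} t \<partial>lborel)
      = ennreal (sqrt (1 + 2 * \<kappa>) / 2) * ennreal (2 * \<kappa>)"
    using \<kappa> by (subst nn_integral_cmult_indicator) auto
  also have "(\<integral>\<^sup>+t. ennreal (sqrt (10 * \<kappa> ^ 3) * (1 / (t * sqrt t))) * indicator {2 * \<kappa>..} t \<partial>lborel)
      = ennreal (sqrt (10 * \<kappa> ^ 3) * 0 - sqrt (10 * \<kappa> ^ 3) * (- 2 / sqrt (2 * \<kappa>)))"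
  proof (rule nn_integral_FTC_atLeast)
    fix t assume "2 * \<kappa> \<le> t"
    then have t: "0 < t" using \<kappa> by linarith
    have "((\<lambda>t. - 2 / sqrt t) has_real_derivative 1 / (t * sqrt t)) (at t)"
      using t by (auto intro!: derivative_eq_intros simp: field_simps)
    then show "((\<lambda>t. sqrt (10 * \<kappa> ^ 3) * (- 2 / sqrt t)) has_real_derivative sqrt (10 * \<kappa> ^ 3) * (1 / (t * sqrt t))) (at t)"
      by (rule DERIV_cmult)
    show "0 \<le> sqrt (10 * \<kappa> ^ 3) * (1 / (t * sqrt t))" using t \<kappa> by simp
  next
    have "((\<lambda>t :: real. - 2 / sqrt t) \<longlongrightarrow> 0) at_top" by real_asymp
    then show "((\<lambda>t. sqrt (10 * \<kappa> ^ 3) * (- 2 / sqrt t)) \<longlongrightarrow> sqrt (10 * \<kappa> ^ 3) * 0) at_top"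
      by (intro tendsto_intros)
  qed measurable
  finally show ?thesis by (simp add: ennreal_mult_less_top)
qed

lemma crossing_density_dominated:
  fixes \<kappa> t :: real
  assumes m: "2 \<le> m" "m \<le> n" and \<kappa>: "0 < \<kappa>" "real n \<le> \<kappa> * real m"
  shows "ennreal (crossing_density n m (real m * t) / sqrt (real m)) * indicator {0<..} t \<le> dominator \<kappa> t"
proof (cases "0 < t")
  case True
  have m0: "0 < real m" "1 \<le> real m" using m by auto
  have x: "0 < real m * t" using True m0 by simp
  show ?thesis
  proof (cases "t \<le> 2 * \<kappa>")
    case le: True
    have "crossing_density n m (real m * t) / sqrt (real m) \<le> sqrt (1 + real m * t) / 2 / sqrt (real m)"
      by (intro divide_right_mono crossing_density_le_sqrt x m) simp
    also have "\<dots> = sqrt ((1 + real m * t) / real m) / 2" by (simp add: real_sqrt_divide)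
    also have "\<dots> \<le> sqrt (1 + 2 * \<kappa>) / 2"
    proof (intro divide_right_mono real_sqrt_le_mono)
      have "(1 + real m * t) / real m = 1 / real m + t" using m0 by (simp add: add_divide_distrib)
      also have "1 / real m + t \<le> 1 + 2 * \<kappa>" using m0 le by (intro add_mono) (auto simp: divide_le_eq)
      finally show "(1 + real m * t) / real m \<le> 1 + 2 * \<kappa>" .
    qed simp
    finally have "ennreal (crossing_density n m (real m * t) / sqrt (real m)) \<le> ennreal (sqrt (1 + 2 * \<kappa>) / 2)"
      by (rule ennreal_leI)
    then show ?thesis using True le unfolding dominator_def by (simp add: add_increasing2)
  next
    case gt: False
    have "2 * real n \<le> 2 * (\<kappa> * real m)" using \<kappa> by simp
    also have "\<dots> \<le> real m * t" using gt m0 by simp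
    finally have far: "2 * real n \<le> real m * t" .
    have "crossing_density n m (real m * t) / sqrt (real m) \<le> sqrt (10 * (real n / (real m * t)) ^ 3) / sqrt (real m)"
      by (intro divide_right_mono crossing_density_le_far x far m) simp
    also have "\<dots> \<le> sqrt (10 * (real n / (real m * t)) ^ 3) / 1"
      using m0 x by (intro divide_left_mono) auto
    also have "\<dots> \<le> sqrt (10 * (\<kappa> / t) ^ 3)"
    proof -
      have "real n / (real m * t) \<le> \<kappa> / t" using \<kappa> True m0 by (simp add: field_simps)
      then have "(real n / (real m * t)) ^ 3 \<le> (\<kappa> / t) ^ 3" using x by (intro power_mono) auto
      then show ?thesis by simp
    qed
    also have "\<dots> = sqrt (10 * \<kappa> ^ 3) * (1 / (t * sqrt t))"
    proof -
      have "sqrt (t ^ 3) = t * sqrt t" using True by (simp add: power3_eq_cube real_sqrt_mult)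
      then show ?thesis by (simp add: power_divide real_sqrt_divide real_sqrt_mult)
    qed
    finally have "ennreal (crossing_density n m (real m * t) / sqrt (real m)) \<le> ennreal (sqrt (10 * \<kappa> ^ 3) * (1 / (t * sqrt t)))"
      by (rule ennreal_leI)
    then show ?thesis using True gt unfolding dominator_def by simp
  qed
qed simp

lemma crossing_integral_scaled:
  assumes m: "0 < m"
  shows "crossing_integral n m = ennreal (real m * sqrt (real m)) *
    (\<integral>\<^sup>+t. ennreal (crossing_density n m (real m * t) / sqrt (real m)) * indicator {0<..} t \<partial>lborel)"
proof -
  have m0: "0 < real m" using m by simp
  have "crossing_integral n m = (\<integral>\<^sup>+x. ennreal (crossing_density n m x) * indicator {0<..} x \<partial>lborel)"
    unfolding crossing_integral_def
  proof (rule nn_integral_cong_AE)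
    show "AE x in lborel. ennreal (sqrt (discr n m x) / (x * total_sum n m x)) * indicator {0..} x
        = ennreal (crossing_density n m x) * indicator {0<..} x"
      using AE_lborel_singleton[of "0 :: real"]
      by eventually_elim (auto simp: crossing_density_def split: split_indicator)
  qed
  also have "\<dots> = \<bar>real m\<bar> * (\<integral>\<^sup>+t. ennreal (crossing_density n m (0 + real m * t)) * indicator {0<..} (0 + real m * t) \<partial>lborel)"
    using m by (intro nn_integral_real_affine) auto
  also have "(\<integral>\<^sup>+t. ennreal (crossing_density n m (0 + real m * t)) * indicator {0<..} (0 + real m * t) \<partial>lborel)
      = (\<integral>\<^sup>+t. ennreal (sqrt (real m)) * (ennreal (crossing_density n m (real m * t) / sqrt (real m)) * indicator {0<..} t) \<partial>lborel)"
  proof (rule nn_integral_cong)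
    fix t
    have i: "indicator {0<..} (0 + real m * t) = (indicator {0<..} t :: ennreal)"
      using m0 by (auto simp: zero_less_mult_iff split: split_indicator)
    have "ennreal (crossing_density n m (real m * t)) = ennreal (sqrt (real m)) * ennreal (crossing_density n m (real m * t) / sqrt (real m))"
      using m0 by (subst ennreal_mult'[symmetric]) auto
    then show "ennreal (crossing_density n m (0 + real m * t)) * indicator {0<..} (0 + real m * t)
      = ennreal (sqrt (real m)) * (ennreal (crossing_density n m (real m * t) / sqrt (real m)) * indicator {0<..} t)"
      unfolding i by (simp add: mult.assoc)
  qed
  also have "\<dots> = ennreal (sqrt (real m)) * (\<integral>\<^sup>+t. ennreal (crossing_density n m (real m * t) / sqrt (real m)) * indicator {0<..} t \<partial>lborel)"
    by (rule nn_integral_cmult) measurable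
  finally show ?thesis by (simp add: ennreal_mult mult.assoc)
qed

lemma crossing_integral_limit:
  fixes m :: "nat \<Rightarrow> nat" and \<kappa> :: real
  assumes m: "filterlim m at_top sequentially" and mn: "\<And>n. m n \<le> n"
    and \<kappa>: "0 < \<kappa>" "\<forall>\<^sub>F n in sequentially. real n \<le> \<kappa> * real (m n)"
    and gap: "(\<exists>L. \<forall>\<^sub>F n in sequentially. n - m n \<le> L) \<or> (\<exists>c>0. \<forall>\<^sub>F n in sequentially. c * real n \<le> real (n - m n))"
  shows "(\<lambda>n. \<integral>\<^sup>+t. ennreal (crossing_density n (m n) (real (m n) * t) / sqrt (real (m n))) * indicator {0<..} t \<partial>lborel)
    \<longlonglongrightarrow> ennreal (1 / 3)"
proof -
  have "\<forall>\<^sub>F n in sequentially. 2 \<le> m n" using m by (simp add: filterlim_at_top)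
  then have "\<forall>\<^sub>F n in sequentially. 2 \<le> m n \<and> real n \<le> \<kappa> * real (m n)"
    using \<kappa>(2) by eventually_elim simp
  \<comment> \<open>Domination must hold for every member of the sequence, so the finitely many
    exceptional indices are shifted away.\<close>
  then obtain n0 where n0: "\<And>n. n0 \<le> n \<Longrightarrow> 2 \<le> m n \<and> real n \<le> \<kappa> * real (m n)"
    by (auto simp: eventually_sequentially)
  define u where "u = (\<lambda>n t. ennreal (crossing_density n (m n) (real (m n) * t) / sqrt (real (m n))) * indicator {0<..} t)"
  have "(\<lambda>n. \<integral>\<^sup>+t. u (n + n0) t \<partial>lborel) \<longlonglongrightarrow> (\<integral>\<^sup>+t. ennreal (if 0 < t \<and> t < 1 then sqrt t / 2 else 0) \<partial>lborel)"
  proof (rule nn_integral_dominated_convergence[where w = "dominator \<kappa>"])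
    show "(\<lambda>t. u (i + n0) t) \<in> borel_measurable lborel" for i unfolding u_def by measurable
    show "dominator \<kappa> \<in> borel_measurable lborel" unfolding dominator_def[abs_def] by measurable
    show "AE t in lborel. u (j + n0) t \<le> dominator \<kappa> t" for j
      unfolding u_def using n0[of "j + n0"] mn[of "j + n0"] \<kappa>(1)
      by (intro AE_I2 crossing_density_dominated) auto
    show "(\<integral>\<^sup>+t. dominator \<kappa> t \<partial>lborel) < \<infinity>" by (rule nn_integral_dominator[OF \<kappa>(1)])
    show "AE t in lborel. (\<lambda>i. u (i + n0) t) \<longlonglongrightarrow> ennreal (if 0 < t \<and> t < 1 then sqrt t / 2 else 0)"
      \<comment> \<open>At \<open>t = 1\<close>, where the lower truncation sets in, neither the
        bulk nor the beyond regime applies; a single point is null.\<close>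
      using AE_lborel_singleton[of "1 :: real"]
    proof eventually_elim
      case (elim t)
      have "(\<lambda>i. u i t) \<longlonglongrightarrow> ennreal (if 0 < t \<and> t < 1 then sqrt t / 2 else 0)"
      proof (cases "0 < t")
        case True
        have "(\<lambda>n. crossing_density n (m n) (real (m n) * t) / sqrt (real (m n))) \<longlonglongrightarrow> (if t < 1 then sqrt t / 2 else 0)"
          using crossing_density_bulk[OF True _ m mn] crossing_density_beyond[OF _ m mn \<kappa>(2) gap] elim by (cases "t < 1") auto
        from tendsto_ennrealI[OF this] show ?thesis using True unfolding u_def by simp
      next
        case False
        then show ?thesis unfolding u_def by simp
      qed
      then show ?case by (rule LIMSEQ_ignore_initial_segment)
    qed
  qed measurable
  then have "(\<lambda>n. \<integral>\<^sup>+t. u n t \<partial>lborel) \<longlonglongrightarrow> ennreal (1 / 3)"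
    unfolding nn_integral_half_sqrt by (rule LIMSEQ_offset)
  then show ?thesis unfolding u_def .
qed

text \<open>Upper and lower bound differ by at most \<open>n\<close>, hence by at most
  \<open>\<kappa> * m\<close>, which is \<open>\<kappa> / sqrt m\<close> relative to the order
  \<open>P\<close> of the crossing integral.\<close>

lemma expected_zeros_proportional_asymp:
  fixes M :: "nat \<Rightarrow> 'w measure" and m :: "nat \<Rightarrow> nat" and \<kappa> :: real
  assumes wm: "\<And>n. weyl_model (M n) n (m n) (a n) (b n)"
    and m: "filterlim m at_top sequentially" and mn: "\<And>n. m n \<le> n"
    and \<kappa>: "0 < \<kappa>" "\<forall>\<^sub>F n in sequentially. real n \<le> \<kappa> * real (m n)"
    and gap: "(\<exists>L. \<forall>\<^sub>F n in sequentially. n - m n \<le> L) \<or> (\<exists>c>0. \<forall>\<^sub>F n in sequentially. c * real n \<le> real (n - m n))"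
  shows "(\<lambda>n. enn2real (expected_zeros (M n) n (m n) (a n) (b n)))
    \<sim>[at_top] (\<lambda>n. 1 / 3 * real (m n) powr (3 / 2))"
proof -
  define I where "I = (\<lambda>n. \<integral>\<^sup>+t. ennreal (crossing_density n (m n) (real (m n) * t) / sqrt (real (m n))) * indicator {0<..} t \<partial>lborel)"
  define P where "P = (\<lambda>n. real (m n) * sqrt (real (m n)))"
  have lim: "I \<longlonglongrightarrow> ennreal (1 / 3)" unfolding I_def by (rule crossing_integral_limit[OF m mn \<kappa> gap])
  then have limr: "(\<lambda>n. enn2real (I n)) \<longlonglongrightarrow> 1 / 3"
    by (rule tendsto_enn2real) simp
  have fin: "\<forall>\<^sub>F n in sequentially. I n < \<infinity>"
    using lim by (rule order_tendstoD) simp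
  have m1: "\<forall>\<^sub>F n in sequentially. 1 \<le> m n" using m by (simp add: filterlim_at_top)
  have sqrt_top: "filterlim (\<lambda>n. sqrt (real (m n))) at_top sequentially"
    by (intro filterlim_compose[OF sqrt_at_top] filterlim_compose[OF filterlim_real_sequentially m])
  have bounds: "\<forall>\<^sub>F n in sequentially. enn2real (I n) \<le> enn2real (expected_zeros (M n) n (m n) (a n) (b n)) / P n
      \<and> enn2real (expected_zeros (M n) n (m n) (a n) (b n)) / P n \<le> \<kappa> / sqrt (real (m n)) + enn2real (I n)"
    using fin m1 \<kappa>(2)
  proof eventually_elim
    case (elim n)
    define E where "E = expected_zeros (M n) n (m n) (a n) (b n)"
    have n1: "1 \<le> n" using elim(2) mn[of n] by simp
    have P: "0 < P n" using elim(2) by (simp add: P_def)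
    obtain i where i: "I n = ennreal i" "0 \<le> i" using elim(1) by (cases "I n") auto
    have ci: "crossing_integral n (m n) = ennreal (P n * i)"
      using crossing_integral_scaled[of "m n" n] elim(2) i P unfolding I_def P_def by (simp add: ennreal_mult)
    have lo: "ennreal (P n * i) \<le> E" and up: "E \<le> of_nat n + ennreal (P n * i)"
      using expected_zeros_bounds(1,2)[OF wm n1 mn] unfolding ci E_def by auto
    have "of_nat n + ennreal (P n * i) = ennreal (real n + P n * i)"
      using P i by (simp add: ennreal_of_nat_eq_real_of_nat)
    with up have up': "E \<le> ennreal (real n + P n * i)" by simp
    then have e: "enn2real E \<le> real n + P n * i" using P i by (intro enn2real_leI) auto
    obtain e where E: "E = ennreal e" "0 \<le> e"
      using up' by (cases E) (auto simp: top_unique)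
    have "P n * i \<le> e" using lo unfolding E(1) by (simp add: E(2))
    moreover have "e \<le> real n + P n * i" using e E by simp
    moreover have "real n / P n \<le> \<kappa> / sqrt (real (m n))"
      using elim(2,3) by (simp add: P_def field_simps)
    ultimately have "i \<le> e / P n" "e / P n \<le> \<kappa> / sqrt (real (m n)) + i"
    proof -
      assume a: "P n * i \<le> e" "e \<le> real n + P n * i" "real n / P n \<le> \<kappa> / sqrt (real (m n))"
      show "i \<le> e / P n" using a(1) P by (simp add: le_divide_eq mult.commute)
      have "e / P n \<le> (real n + P n * i) / P n" using a(2) P by (intro divide_right_mono) auto
      also have "\<dots> = real n / P n + i" using P by (simp add: add_divide_distrib)
      finally show "e / P n \<le> \<kappa> / sqrt (real (m n)) + i" using a(3) by simp
    qed
    then show ?case unfolding E_def[symmetric] E i(1) using E(2) i(2) by simp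
  qed
  have "(\<lambda>n. \<kappa> / sqrt (real (m n))) \<longlonglongrightarrow> 0"
    by (intro tendsto_divide_0[OF tendsto_const] filterlim_at_top_imp_at_infinity sqrt_top)
  from tendsto_add[OF this limr] have up: "(\<lambda>n. \<kappa> / sqrt (real (m n)) + enn2real (I n)) \<longlonglongrightarrow> 1 / 3" by simp
  have "(\<lambda>n. enn2real (expected_zeros (M n) n (m n) (a n) (b n)) / P n) \<longlonglongrightarrow> 1 / 3"
  proof (rule tendsto_sandwich[OF _ _ limr up])
    show "\<forall>\<^sub>F n in sequentially. enn2real (I n) \<le> enn2real (expected_zeros (M n) n (m n) (a n) (b n)) / P n"
      using bounds by eventually_elim simp
    show "\<forall>\<^sub>F n in sequentially. enn2real (expected_zeros (M n) n (m n) (a n) (b n)) / P n \<le> \<kappa> / sqrt (real (m n)) + enn2real (I n)"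
      using bounds by eventually_elim simp
  qed
  from tendsto_mult[OF tendsto_const[of 3] this]
  have "(\<lambda>n. 3 * (enn2real (expected_zeros (M n) n (m n) (a n) (b n)) / P n)) \<longlonglongrightarrow> 1" by simp
  moreover have Peq: "P n = real (m n) powr (3 / 2)" if "1 \<le> m n" for n
  proof -
    have "real (m n) powr (3 / 2) = real (m n) powr (1 + 1 / 2)" by simp
    also have "\<dots> = real (m n) * sqrt (real (m n))"
      using that by (subst powr_add) (simp add: powr_half_sqrt)
    finally show ?thesis by (simp add: P_def)
  qed
  have "\<forall>\<^sub>F n in sequentially. 3 * (enn2real (expected_zeros (M n) n (m n) (a n) (b n)) / P n)
      = enn2real (expected_zeros (M n) n (m n) (a n) (b n)) / (1 / 3 * real (m n) powr (3 / 2))"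
    using m1 by eventually_elim (simp add: Peq)
  ultimately show ?thesis
    by (intro asymp_equivI') (simp add: tendsto_cong)
qed

theorem theorem1:
  "(\<forall>(m :: nat) (M :: nat \<Rightarrow> 'w measure) a b.
      (\<forall>n\<ge>m. weyl_model (M n) n m (a n) (b n)) \<longrightarrow>
      (\<lambda>n. enn2real (expected_zeros (M n) n m (a n) (b n))) \<sim>[at_top] (\<lambda>n. real n)) \<and>
   (\<forall>(\<alpha> :: real) (m :: nat \<Rightarrow> nat) (M :: nat \<Rightarrow> 'w measure) a b.
      0 < \<alpha> \<and> \<alpha> \<le> 1 \<and>
      (\<lambda>n. real (m n) - \<alpha> * real n) \<in> O[at_top](\<lambda>_. 1) \<and>
      (\<forall>n. m n \<le> n \<and> weyl_model (M n) n (m n) (a n) (b n)) \<longrightarrow>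
      (\<lambda>n. enn2real (expected_zeros (M n) n (m n) (a n) (b n)))
        \<sim>[at_top] (\<lambda>n. 1 / 3 * real (m n) powr (3 / 2)))"
proof (intro conjI allI impI)
  fix m :: nat and M :: "nat \<Rightarrow> 'w measure" and a b
  assume "\<forall>n\<ge>m. weyl_model (M n) n m (a n) (b n)"
  then show "(\<lambda>n. enn2real (expected_zeros (M n) n m (a n) (b n))) \<sim>[at_top] (\<lambda>n. real n)"
    by (intro expected_zeros_fixed_asymp) simp
next
  fix \<alpha> :: real and m :: "nat \<Rightarrow> nat" and M :: "nat \<Rightarrow> 'w measure" and a b
  assume *: "0 < \<alpha> \<and> \<alpha> \<le> 1 \<and> (\<lambda>n. real (m n) - \<alpha> * real n) \<in> O[at_top](\<lambda>_. 1) \<and>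
      (\<forall>n. m n \<le> n \<and> weyl_model (M n) n (m n) (a n) (b n))"
  then have \<alpha>: "0 < \<alpha>" "\<alpha> \<le> 1" and mn: "\<And>n. m n \<le> n" by auto
  from * obtain c where c: "\<forall>\<^sub>F n in sequentially. \<bar>real (m n) - \<alpha> * real n\<bar> \<le> c"
    by (auto elim!: landau_o.bigE)
  have large: "\<forall>\<^sub>F n in sequentially. c \<le> d * real n" if "0 < d" for d
    using eventually_ge_at_top[of "nat \<lceil>c / d\<rceil>"]
  proof eventually_elim
    case (elim n)
    then have "c / d \<le> real n" by linarith
    then show ?case using that by (simp add: divide_le_eq mult.commute)
  qed
  show "(\<lambda>n. enn2real (expected_zeros (M n) n (m n) (a n) (b n))) \<sim>[at_top] (\<lambda>n. 1 / 3 * real (m n) powr (3 / 2))"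
  \<comment> \<open>The bounded error is eventually at most \<open>\<alpha> / 2 * n\<close>, so
    \<open>m n\<close> is at least half of \<open>\<alpha> * n\<close>; this fixes
    \<open>\<kappa>\<close>.\<close>
  proof (rule expected_zeros_proportional_asymp[where \<kappa> = "2 / \<alpha>"])
    show "weyl_model (M n) n (m n) (a n) (b n)" "m n \<le> n" for n using * by auto
    show "0 < 2 / \<alpha>" using \<alpha> by simp
    have half: "\<forall>\<^sub>F n in sequentially. \<alpha> / 2 * real n \<le> real (m n)"
    proof -
      have "0 < \<alpha> / 2" using \<alpha> by simp
      from large[OF this] c show ?thesis
      proof eventually_elim
        case (elim n)
        then have "\<alpha> * real n - real (m n) \<le> \<alpha> / 2 * real n" by linarith
        then show ?case by simp
      qed
    qed
    then show "\<forall>\<^sub>F n in sequentially. real n \<le> 2 / \<alpha> * real (m n)"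
      by eventually_elim (use \<alpha> in \<open>simp add: field_simps\<close>)
    have "filterlim (\<lambda>n. \<alpha> / 2 * real n) at_top sequentially"
      using \<alpha> by real_asymp
    then have "filterlim (\<lambda>n. real (m n)) at_top sequentially"
      by (rule filterlim_at_top_mono[OF _ half])
    then show "filterlim m at_top sequentially"
      by (simp add: filterlim_sequentially_iff_filterlim_real)
    show "(\<exists>L. \<forall>\<^sub>F n in sequentially. n - m n \<le> L) \<or> (\<exists>c>0. \<forall>\<^sub>F n in sequentially. c * real n \<le> real (n - m n))"
    \<comment> \<open>The degrees differ by a bounded amount for \<open>\<alpha> = 1\<close>.
      Otherwise they differ by about \<open>(1 - \<alpha>) * n\<close>, half of which absorbs the
      error.\<close>
    proof (cases "\<alpha> = 1")
      case True
      from c have "\<forall>\<^sub>F n in sequentially. n - m n \<le> nat \<lceil>c\<rceil>"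
      proof eventually_elim
        case (elim n)
        have "real (n - m n) = real n - real (m n)" using mn[of n] by (rule of_nat_diff)
        also have "\<dots> \<le> c" using elim True by (simp add: abs_le_iff)
        also have "c \<le> real (nat \<lceil>c\<rceil>)" by (rule real_nat_ceiling_ge)
        finally show ?case by (simp only: of_nat_le_iff)
      qed
      then show ?thesis by blast
    next
      case False
      then have d: "0 < (1 - \<alpha>) / 2" using \<alpha> by simp
      have "\<forall>\<^sub>F n in sequentially. (1 - \<alpha>) / 2 * real n \<le> real (n - m n)"
        using c large[OF d]
      proof eventually_elim
        case (elim n)
        have "real (n - m n) = real n - real (m n)" using mn[of n] by (rule of_nat_diff)
        also have "\<dots> \<ge> (1 - \<alpha>) * real n - c" using elim(1) by (simp add: algebra_simps)
        also have "(1 - \<alpha>) * real n - c \<ge> (1 - \<alpha>) / 2 * real n" using elim(2) by (simp add: field_simps)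
        finally show ?case by simp
      qed
      then show ?thesis using d by blast
    qed
  qed
qed

end
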